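(* Let $n<p$ and let $\mathcal{P}=(r_1,\dots,r_\ell)$ be a partition of $k$ with $p-k(p-n+1)+\ell\ge 0$. Let $f_1,f_2:(\mathbb{C}^n,0)\to(\mathbb{C}^p,0)$ be corank 1, $\mathcal{A}$-finite and $\mathcal{A}$-equivalent map-germs. Then $N(f_1,\mathcal{P})=N(f_2,\mathcal{P})$.
   Context: $\mathcal{A}=\mathrm{Diff}(\mathbb{C}^n,0)\times \mathrm{Diff}(\mathbb{C}^p,0)$ acts on map-germs by composition on the right and left; a germ $f$ is $\mathcal{A}$-finite if for some $k<\infty$ every germ with the same $k$-jet at $0$ is $\mathcal{A}$-equivalent to $f$. $\mathcal{O}_m$ is the ring of germs at $0$ of holomorphic functions on $\mathbb{C}^m$ and $\mathcal{M}_m$ its maximal ideal. A partition of $k$ satisfies $r_1\ge\dots\ge r_\ell\ge1$, $r_1+\dots+r_\ell=k$. Corank 1 germs are given in the form $f(x,z)=(x,h_1(x,z),\dots,h_{p-n+1}(x,z))$ with $x\in\mathbb{C}^{n-1}$, $z\in\mathbb{C}$. For $1\le i\le\ell$ let $\pi_i(\mathcal{P}):\mathbb{C}^{n-1+\ell}\to\mathbb{C}^n$ be $(x,z_1,\dots,z_\ell)\mapsto(x,z_i)$. Define $H_{\mathcal{P}}:\mathbb{C}^{n-1+\ell}\to\mathbb{C}^{(p-n+1)(k-\ell)}$ with components $\frac{\partial^s h_j}{\partial z^s}\circ\pi_i(\mathcal{P})$ for $1\le j\le p-n+1$, $1\le i\le\ell$, $1\le s\le r_i-1$; $G_{\mathcal{P}}:\mathbb{C}^{n-1+\ell}\to\mathbb{C}^{(p-n+1)(\ell-1)}$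 with components $h_j\circ\pi_1(\mathcal{P})-h_j\circ\pi_i(\mathcal{P})$ for $1\le j\le p-n+1$, $2\le i\le\ell$; $F_{\mathcal{P}}=(G_{\mathcal{P}},H_{\mathcal{P}}):\mathbb{C}^{n-1+\ell}\to\mathbb{C}^{(p-n+1)(k-1)}$. Then $$N(f,\mathcal{P})=\dim_{\mathbb{C}}\frac{\mathcal{O}_{n-1+\ell}}{F_{\mathcal{P}}^*(\mathcal{M}_{(p-n+1)(k-1)})\,\mathcal{O}_{n-1+\ell}+J(F_{\mathcal{P}})}\in\mathbb{Z}_{\ge0}\cup\{\infty\},$$ where $J(F_{\mathcal{P}})$ is the ideal generated by the $(p-n+1)(k-1)\times(p-n+1)(k-1)$ minors of the Jacobian matrix of $F_{\mathcal{P}}$. *)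

theory Defs
  imports
    "HOL-Complex_Analysis.Complex_Analysis"
    "HOL-Algebra.QuotRing"
    "HOL-Algebra.Embedded_Algebras"
    "HOL-Library.Extended_Nat"
    "Jordan_Normal_Form.DL_Rank"
    "Jordan_Normal_Form.DL_Submatrix"
begin

section \<open>Complex affine spaces and holomorphic germs\<close>

text \<open>
  The dimensions in play vary with the partition and may be zero, so the m-dimensional complex
  space is the set of sequences supported on the indices below m, with the topology induced by
  the product topology on \<^typ>\<open>nat \<Rightarrow> complex\<close>; this is the Euclidean topology.
  Coordinates are numbered from 0. Germs at the origin are handled through representatives,
  whose values away from a small polydisc of the space are irrelevant.
\<close>

type_synonym point = "nat \<Rightarrow> complex"

definition cspace :: "nat \<Rightarrow> point set" where
  "cspace m = {x. \<forall>i\<ge>m. x i = 0}"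

definition origin :: point where
  "origin = (\<lambda>_. 0)"

definition polydisc :: "nat \<Rightarrow> real \<Rightarrow> point set" where
  "polydisc m r = {x \<in> cspace m. \<forall>i<m. norm (x i) < r}"

definition near_origin :: "nat \<Rightarrow> (point \<Rightarrow> bool) \<Rightarrow> bool" where
  "near_origin m Q \<longleftrightarrow> (\<exists>r>0. \<forall>x\<in>polydisc m r. Q x)"

text \<open>
  A function of several complex variables is holomorphic if it is continuous and holomorphic in
  each variable separately.
\<close>

definition holomorphic_germ :: "nat \<Rightarrow> (point \<Rightarrow> complex) \<Rightarrow> bool" where
  "holomorphic_germ m f \<longleftrightarrow> (\<exists>r>0. continuous_on (polydisc m r) f \<and>
     (\<forall>x\<in>polydisc m r. \<forall>i<m. (\<lambda>t. f (x(i := t))) holomorphic_on ball 0 r))"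

definition partial :: "nat \<Rightarrow> (point \<Rightarrow> complex) \<Rightarrow> point \<Rightarrow> complex" where
  "partial i f x = deriv (\<lambda>t. f (x(i := t))) (x i)"

section \<open>The local ring and its quotients\<close>

definition germ :: "nat \<Rightarrow> (point \<Rightarrow> complex) \<Rightarrow> (point \<Rightarrow> complex) set" where
  "germ m f = {g. near_origin m (\<lambda>x. g x = f x)}"

definition germ_ring :: "nat \<Rightarrow> (point \<Rightarrow> complex) set ring" where
  "germ_ring m = \<lparr>carrier = germ m ` {f. holomorphic_germ m f},
     mult = (\<lambda>A B. \<Union>f\<in>A. \<Union>g\<in>B. germ m (\<lambda>x. f x * g x)),
     one = germ m (\<lambda>_. 1),
     zero = germ m (\<lambda>_. 0),
     add = (\<lambda>A B. \<Union>f\<in>A. \<Union>g\<in>B. germ m (\<lambda>x. f x + g x))\<rparr>"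

definition max_ideal :: "nat \<Rightarrow> (point \<Rightarrow> complex) set set" where
  "max_ideal m = germ m ` {f. holomorphic_germ m f \<and> f origin = 0}"

text \<open>
  The field of constants is embedded in the quotient ring as K. For the unit ideal K collapses to
  the zero ring and the dimension is 0, as it should be.
\<close>

definition quotient_dim :: "nat \<Rightarrow> (point \<Rightarrow> complex) set set \<Rightarrow> enat" where
  "quotient_dim m I =
     (let Q = germ_ring m Quot I;
          K = (\<lambda>c. I +>\<^bsub>germ_ring m\<^esub> germ m (\<lambda>_. c)) ` (UNIV :: complex set)
      in if ring.finite_dimension Q K (carrier Q) then enat (ring.dim Q K (carrier Q)) else \<infinity>)"

section \<open>Map-germs\<close>

definition map_germ :: "nat \<Rightarrow> nat \<Rightarrow> (point \<Rightarrow> point) \<Rightarrow> bool" where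
  "map_germ n p f \<longleftrightarrow> near_origin n (\<lambda>x. f x \<in> cspace p) \<and>
     (\<forall>j<p. holomorphic_germ n (\<lambda>x. f x j)) \<and> f origin = origin"

definition diffeo_germ :: "nat \<Rightarrow> (point \<Rightarrow> point) \<Rightarrow> bool" where
  "diffeo_germ n \<phi> \<longleftrightarrow> map_germ n n \<phi> \<and>
     (\<exists>\<phi>'. map_germ n n \<phi>' \<and> near_origin n (\<lambda>x. \<phi>' (\<phi> x) = x) \<and> near_origin n (\<lambda>x. \<phi> (\<phi>' x) = x))"

definition A_equivalent :: "nat \<Rightarrow> nat \<Rightarrow> (point \<Rightarrow> point) \<Rightarrow> (point \<Rightarrow> point) \<Rightarrow> bool" where
  "A_equivalent n p f g \<longleftrightarrow>
     (\<exists>\<phi> \<psi>. diffeo_germ n \<phi> \<and> diffeo_germ p \<psi> \<and> near_origin n (\<lambda>x. g x = \<psi> (f (\<phi> x))))"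

definition same_jet :: "nat \<Rightarrow> nat \<Rightarrow> nat \<Rightarrow> (point \<Rightarrow> point) \<Rightarrow> (point \<Rightarrow> point) \<Rightarrow> bool" where
  "same_jet k n p f g \<longleftrightarrow>
     (\<forall>is. set is \<subseteq> {..<n} \<and> length is \<le> k \<longrightarrow>
        (\<forall>j<p. foldr partial is (\<lambda>x. f x j) origin = foldr partial is (\<lambda>x. g x j) origin))"

definition A_finite :: "nat \<Rightarrow> nat \<Rightarrow> (point \<Rightarrow> point) \<Rightarrow> bool" where
  "A_finite n p f \<longleftrightarrow> (\<exists>k. \<forall>g. map_germ n p g \<and> same_jet k n p f g \<longrightarrow> A_equivalent n p f g)"

definition corank :: "nat \<Rightarrow> nat \<Rightarrow> (point \<Rightarrow> point) \<Rightarrow> nat" where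
  "corank n p f =
     min n p - vec_space.rank p (mat p n (\<lambda>(j, i). partial i (\<lambda>x. f x j) origin))"

text \<open>
  The normal form (x, z) \<open>\<mapsto>\<close> (x, h(x, z)): x is made of the coordinates 0, ..., n - 2, and z is
  the coordinate n - 1.
\<close>

definition in_linear_form :: "nat \<Rightarrow> (point \<Rightarrow> point) \<Rightarrow> bool" where
  "in_linear_form n f \<longleftrightarrow> near_origin n (\<lambda>x. \<forall>i<n-1. f x i = x i)"

definition h_comp :: "nat \<Rightarrow> (point \<Rightarrow> point) \<Rightarrow> nat \<Rightarrow> point \<Rightarrow> complex" where
  "h_comp n f j = (\<lambda>x. f x (n - 1 + j))"

section \<open>The maps attached to a partition\<close>

definition partition_of :: "nat \<Rightarrow> nat list \<Rightarrow> bool" where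
  "partition_of k P \<longleftrightarrow> P \<noteq> [] \<and> sorted_wrt (\<ge>) P \<and> (\<forall>r\<in>set P. r \<ge> 1) \<and> sum_list P = k"

text \<open>
  Parts and the components of h are numbered from 0, so the coordinate n - 1 + i of the source is
  the variable z belonging to the part P ! i, and the base point of G is the one for i = 0.
\<close>

definition proj_part :: "nat \<Rightarrow> nat \<Rightarrow> point \<Rightarrow> point" where
  "proj_part n i = (\<lambda>y a. if a < n - 1 then y a else if a = n - 1 then y (n - 1 + i) else 0)"

definition H_map :: "nat \<Rightarrow> nat \<Rightarrow> (point \<Rightarrow> point) \<Rightarrow> nat list \<Rightarrow> (point \<Rightarrow> complex) list" where
  "H_map n p f P =
     [(partial (n - 1) ^^ s) (h_comp n f j) \<circ> proj_part n i.
        i \<leftarrow> [0..<length P], s \<leftarrow> [1..<P ! i], j \<leftarrow> [0..<p - n + 1]]"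

definition G_map :: "nat \<Rightarrow> nat \<Rightarrow> (point \<Rightarrow> point) \<Rightarrow> nat list \<Rightarrow> (point \<Rightarrow> complex) list" where
  "G_map n p f P =
     [(\<lambda>y. h_comp n f j (proj_part n 0 y) - h_comp n f j (proj_part n i y)).
        i \<leftarrow> [1..<length P], j \<leftarrow> [0..<p - n + 1]]"

definition F_map :: "nat \<Rightarrow> nat \<Rightarrow> (point \<Rightarrow> point) \<Rightarrow> nat list \<Rightarrow> (point \<Rightarrow> complex) list" where
  "F_map n p f P = G_map n p f P @ H_map n p f P"

definition eval_map :: "(point \<Rightarrow> complex) list \<Rightarrow> point \<Rightarrow> point" where
  "eval_map F y = (\<lambda>a. if a < length F then (F ! a) y else 0)"

text \<open>
  The map F need not vanish at the origin, because of the derivatives in H. A pullback is then not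
  determined by the germ at the origin of the function pulled back, and only those which are
  holomorphic near the origin are kept. A component of F not vanishing at the origin is itself
  such a pullback and a unit, so the ideal is the unit ideal in that case; if F does vanish at the
  origin, the restriction is no restriction. In both cases the components of F generate the ideal.
\<close>

definition pullback_ideal :: "nat \<Rightarrow> (point \<Rightarrow> complex) list \<Rightarrow> (point \<Rightarrow> complex) set set" where
  "pullback_ideal m F =
     Idl\<^bsub>germ_ring m\<^esub> {germ m (u \<circ> eval_map F) | u.
        germ (length F) u \<in> max_ideal (length F) \<and> holomorphic_germ m (u \<circ> eval_map F)}"

definition jacobian :: "nat \<Rightarrow> (point \<Rightarrow> complex) list \<Rightarrow> point \<Rightarrow> complex mat" where
  "jacobian m F y = mat (length F) m (\<lambda>(a, b). partial b (F ! a) y)"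

definition minors_ideal :: "nat \<Rightarrow> (point \<Rightarrow> complex) list \<Rightarrow> (point \<Rightarrow> complex) set set" where
  "minors_ideal m F =
     Idl\<^bsub>germ_ring m\<^esub> {germ m (\<lambda>y. Determinant.det (submatrix (jacobian m F y) UNIV J)) | J.
        J \<subseteq> {..<m} \<and> card J = length F}"

definition N_inv :: "nat \<Rightarrow> nat \<Rightarrow> (point \<Rightarrow> point) \<Rightarrow> nat list \<Rightarrow> enat" where
  "N_inv n p f P =
     (let m = n - 1 + length P; F = F_map n p f P
      in quotient_dim m (pullback_ideal m F <+>\<^bsub>germ_ring m\<^esub> minors_ideal m F))"

section \<open>Checks of the definitions\<close>

lemma length_concat_map_const: "length (concat (map (\<lambda>x. map (g x) xs) ys)) = length ys * length xs"
  by (induction ys) auto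

lemma length_G_map: "length (G_map n p f P) = (p - n + 1) * (length P - 1)"
  unfolding G_map_def length_concat_map_const by (simp add: mult.commute)

lemma length_H_map:
  assumes "partition_of k P"
  shows "length (H_map n p f P) = (p - n + 1) * (k - length P)"
proof -
  have P: "\<forall>r\<in>set P. r \<ge> 1" and k: "sum_list P = k"
    using assms by (auto simp: partition_of_def)
  have "length (H_map n p f P) = (\<Sum>i\<leftarrow>[0..<length P]. (P ! i - 1) * (p - n + 1))"
    unfolding H_map_def length_concat map_map o_def length_concat_map_const by (simp add: length_concat o_def sum_list_triv)
  also have "\<dots> = (\<Sum>r\<leftarrow>P. (r - 1) * (p - n + 1))"
    by (rule arg_cong[of _ _ sum_list], rule nth_equalityI) auto
  also have "\<dots> = (p - n + 1) * (\<Sum>r\<leftarrow>P. r - 1)"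
    by (induction P) (auto simp: algebra_simps)
  also have "(\<Sum>r\<leftarrow>P. r - 1) + length P = sum_list P"
    using P by (induction P) auto
  then have "(\<Sum>r\<leftarrow>P. r - 1) = k - length P"
    using k by simp
  finally show ?thesis .
qed

lemma length_F_map:
  assumes "partition_of k P"
  shows "length (F_map n p f P) = (p - n + 1) * (k - 1)"
proof -
  have P: "\<forall>r\<in>set P. r \<ge> 1" and k: "sum_list P = k" and "P \<noteq> []"
    using assms by (auto simp: partition_of_def)
  have "length P \<le> sum_list P"
    using P by (induction P) auto
  moreover have "length P \<ge> 1"
    using \<open>P \<noteq> []\<close> by (cases P) auto
  ultimately have "(length P - 1) + (k - length P) = k - 1"
    using k by linarith
  then show ?thesis
    unfolding F_map_def length_append length_G_map length_H_map[OF assms]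
    by (metis distrib_left)
qed

lemma polydisc_mono: "r \<le> s \<Longrightarrow> polydisc m r \<subseteq> polydisc m s"
  by (force simp: polydisc_def)

lemma near_origin_conj:
  assumes "near_origin m Q" "near_origin m R"
  shows "near_origin m (\<lambda>x. Q x \<and> R x)"
proof -
  obtain r s where "r > 0" "\<forall>x\<in>polydisc m r. Q x" "s > 0" "\<forall>x\<in>polydisc m s. R x"
    using assms by (auto simp: near_origin_def)
  then show ?thesis
    unfolding near_origin_def
    using polydisc_mono[of "min r s" r m] polydisc_mono[of "min r s" s m]
    by (intro exI[of _ "min r s"]) auto
qed

lemma near_origin_mono: "near_origin m Q \<Longrightarrow> (\<And>x. Q x \<Longrightarrow> R x) \<Longrightarrow> near_origin m R"
  by (auto simp: near_origin_def)

lemma near_origin_triv: "(\<And>x. Q x) \<Longrightarrow> near_origin m Q"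
  by (auto simp: near_origin_def intro: exI[of _ 1])

lemma germ_self: "f \<in> germ m f"
  by (simp add: germ_def near_origin_triv)

lemma germ_eq_iff: "germ m f = germ m g \<longleftrightarrow> near_origin m (\<lambda>x. f x = g x)"
proof
  assume "germ m f = germ m g"
  then show "near_origin m (\<lambda>x. f x = g x)"
    using germ_self[of f m] by (simp add: germ_def)
next
  assume fg: "near_origin m (\<lambda>x. f x = g x)"
  show "germ m f = germ m g"
    unfolding germ_def
    by (intro Collect_cong iffI; drule near_origin_conj[OF fg]; erule near_origin_mono) auto
qed

lemma germ_binop:
  fixes op :: "complex \<Rightarrow> complex \<Rightarrow> complex"
  shows "(\<Union>f'\<in>germ m f. \<Union>g'\<in>germ m g. germ m (\<lambda>x. op (f' x) (g' x))) = germ m (\<lambda>x. op (f x) (g x))"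
proof -
  have "germ m (\<lambda>x. op (f' x) (g' x)) = germ m (\<lambda>x. op (f x) (g x))"
    if "f' \<in> germ m f" "g' \<in> germ m g" for f' g'
    unfolding germ_eq_iff using that unfolding germ_def mem_Collect_eq
    by (rule near_origin_mono[OF near_origin_conj]) simp
  then show ?thesis
    using germ_self[of f m] germ_self[of g m] by blast
qed

lemma germ_ring_simps:
  "germ m f \<otimes>\<^bsub>germ_ring m\<^esub> germ m g = germ m (\<lambda>x. f x * g x)"
  "germ m f \<oplus>\<^bsub>germ_ring m\<^esub> germ m g = germ m (\<lambda>x. f x + g x)"
  "\<one>\<^bsub>germ_ring m\<^esub> = germ m (\<lambda>_. 1)"
  "\<zero>\<^bsub>germ_ring m\<^esub> = germ m (\<lambda>_. 0)"
  "carrier (germ_ring m) = germ m ` {f. holomorphic_germ m f}"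
  by (simp_all add: germ_ring_def germ_binop)

lemma holomorphic_germ_const: "holomorphic_germ m (\<lambda>_. c)"
  by (auto simp: holomorphic_germ_def intro: exI[of _ 1])

lemma holomorphic_germ_binop:
  fixes op :: "complex \<Rightarrow> complex \<Rightarrow> complex"
  assumes cont: "\<And>S f g. continuous_on S f \<Longrightarrow> continuous_on S g \<Longrightarrow> continuous_on (S :: point set) (\<lambda>x. op (f x) (g x))"
    and hol: "\<And>S f g. f holomorphic_on S \<Longrightarrow> g holomorphic_on S \<Longrightarrow> (\<lambda>t. op (f t) (g t)) holomorphic_on S"
    and "holomorphic_germ m f" "holomorphic_germ m g"
  shows "holomorphic_germ m (\<lambda>x. op (f x) (g x))"
proof -
  obtain r where r: "r > 0" "continuous_on (polydisc m r) f"
    "\<forall>x\<in>polydisc m r. \<forall>i<m. (\<lambda>t. f (x(i := t))) holomorphic_on ball 0 r"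
    using assms(3) by (auto simp: holomorphic_germ_def)
  obtain s where s: "s > 0" "continuous_on (polydisc m s) g"
    "\<forall>x\<in>polydisc m s. \<forall>i<m. (\<lambda>t. g (x(i := t))) holomorphic_on ball 0 s"
    using assms(4) by (auto simp: holomorphic_germ_def)
  define q where "q = min r s"
  have q: "q > 0" "polydisc m q \<subseteq> polydisc m r" "polydisc m q \<subseteq> polydisc m s"
    "ball 0 q \<subseteq> (ball 0 r :: complex set)" "ball 0 q \<subseteq> (ball 0 s :: complex set)"
    using r(1) s(1) by (auto simp: q_def intro!: polydisc_mono)
  have "continuous_on (polydisc m q) (\<lambda>x. op (f x) (g x))"
    using q r(2) s(2) by (blast intro: cont continuous_on_subset)
  moreover have "(\<lambda>t. op (f (x(i := t))) (g (x(i := t)))) holomorphic_on ball 0 q"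
    if "x \<in> polydisc m q" "i < m" for x i
  proof (rule hol)
    show "(\<lambda>t. f (x(i := t))) holomorphic_on ball 0 q"
      using that q(2,4) r(3) by (meson holomorphic_on_subset subsetD)
    show "(\<lambda>t. g (x(i := t))) holomorphic_on ball 0 q"
      using that q(3,5) s(3) by (meson holomorphic_on_subset subsetD)
  qed
  ultimately show ?thesis
    using q(1) unfolding holomorphic_germ_def by blast
qed

lemma cring_germ_ring: "cring (germ_ring m)"
proof -
  have mult: "holomorphic_germ m (\<lambda>x. f x * g x)" and add: "holomorphic_germ m (\<lambda>x. f x + g x)"
    if "holomorphic_germ m f" "holomorphic_germ m g" for f g
    using that holomorphic_germ_binop[of "(*)" m f g] holomorphic_germ_binop[of "(+)" m f g]
    by (simp_all add: continuous_on_mult continuous_on_add holomorphic_on_mult holomorphic_on_add)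
  have inv: "\<exists>B\<in>carrier (germ_ring m). B \<oplus>\<^bsub>germ_ring m\<^esub> A = \<zero>\<^bsub>germ_ring m\<^esub>"
    if A: "A \<in> carrier (germ_ring m)" for A
  proof -
    obtain f where f: "holomorphic_germ m f" "A = germ m f"
      using A by (auto simp: germ_ring_simps)
    have "holomorphic_germ m (\<lambda>x. - 1 * f x)"
      by (rule mult[OF holomorphic_germ_const f(1)])
    then show ?thesis
      by (intro bexI[of _ "germ m (\<lambda>x. - 1 * f x)"]) (auto simp: f germ_ring_simps)
  qed
  have "abelian_group (germ_ring m)"
  proof (rule abelian_groupI)
    show "\<exists>B\<in>carrier (germ_ring m). B \<oplus>\<^bsub>germ_ring m\<^esub> A = \<zero>\<^bsub>germ_ring m\<^esub>"
      if "A \<in> carrier (germ_ring m)" for A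
      using that by (rule inv)
  qed (auto simp: germ_ring_simps add_ac intro!: add holomorphic_germ_const imageI)
  moreover have "comm_monoid (germ_ring m)"
    by (rule comm_monoidI)
       (auto simp: germ_ring_simps mult_ac intro!: mult holomorphic_germ_const imageI)
  ultimately show ?thesis
    by (rule cringI) (auto simp: germ_ring_simps algebra_simps)
qed

end

theory Submission
  imports Defs "Jordan_Normal_Form.DL_Rank_Submatrix"
begin

text \<open>
  Write the second germ as \<open>f2 = \<psi> \<circ> f1 \<circ> \<phi>\<close> and let \<open>\<theta> = (X, Z)\<close> be the inverse of \<open>\<phi>\<close>, so that
  \<open>f2 \<circ> \<theta> = \<psi> \<circ> f1\<close>. The equations of F say that the points \<open>(x, z\<^sub>i)\<close> have the same image and that h has
  vanishing derivatives of order less than \<open>r\<^sub>i\<close> in the direction z at \<open>(x, z\<^sub>i)\<close>. The map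
  \<open>\<Phi>(x, z\<^sub>0, z\<^sub>1, ...) = (X(x, z\<^sub>0), Z(x, z\<^sub>0), Z(x, z\<^sub>1), ...)\<close> moves such tuples for f1 to such tuples for
  f2, and this holds on the level of ideals.

  By the normal form, X is the first block of \<open>\<psi> \<circ> f1\<close>, hence \<open>X(x, z\<^sub>i)\<close> is congruent to \<open>X(x, z\<^sub>0)\<close>
  modulo the components of F for f1; the two-point lemma of Hadamard (\<open>ideal_gen_compose_diff\<close>) then
  shows that the differences of the values of the component functions of f2 are pulled back into the
  ideal. For the derivatives (\<open>z_derivatives\<close>), the chain rule in the direction z has a single term
  outside of the ideal, and its coefficient \<open>\<partial>Z/\<partial>z\<close> is a unit as the corank is 1. Altogether, the pullback
  along \<open>\<Phi>\<close> maps the ideal of F for f2 into that for f1 (\<open>F_map_\<Phi>\<close>). The same construction for the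
  inverse change of coordinates gives a map \<open>\<Psi>\<close>, and \<open>\<Psi> \<circ> \<Phi>\<close> is the identity modulo the ideal
  (\<open>\<Psi>_\<Phi>\<close>).

  For the minors, \<open>F\<^sub>2 \<circ> \<Phi> = M F\<^sub>1\<close> with a square matrix M gives \<open>(DF\<^sub>2 \<circ> \<Phi>) D\<Phi> = M DF\<^sub>1\<close> modulo \<open>F\<^sub>1\<close>. The
  derivative of \<open>\<Psi> \<circ> \<Phi>\<close> at the origin is the identity, so \<open>D\<Phi>\<close> is invertible there, and the maximal
  minors of \<open>DF\<^sub>2 \<circ> \<Phi>\<close> lie in the ideal generated by the components of \<open>F\<^sub>1\<close> and the maximal minors of
  \<open>DF\<^sub>1\<close> (\<open>minors_transfer\<close>, \<open>minors_\<Phi>\<close>). Hence the two quotient rings are isomorphic over the constants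
  (\<open>quotient_dim_eq\<close>).

  The calculus of several variables behind this, that is, the chain rule, the holomorphy of
  compositions and of partial derivatives, and the lemma of Hadamard, is derived from the holomorphy
  of divided differences (\<open>hol_on_dd\<close>).
\<close>

section \<open>Holomorphic functions on polydiscs\<close>

text \<open>
  Holomorphy with an explicit radius: a function is a holomorphic germ iff it satisfies this for
  some positive radius.
\<close>

definition hol_on :: "nat \<Rightarrow> real \<Rightarrow> (point \<Rightarrow> complex) \<Rightarrow> bool" where
  "hol_on m r f \<longleftrightarrow> continuous_on (polydisc m r) f \<and>
     (\<forall>x\<in>polydisc m r. \<forall>i<m. (\<lambda>t. f (x(i := t))) holomorphic_on ball 0 r)"

lemma holomorphic_germ_iff: "holomorphic_germ m f \<longleftrightarrow> (\<exists>r>0. hol_on m r f)"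
  by (simp add: holomorphic_germ_def hol_on_def)

lemma polydisc_iff: "x \<in> polydisc m r \<longleftrightarrow> (\<forall>i\<ge>m. x i = 0) \<and> (\<forall>i<m. norm (x i) < r)"
  by (auto simp: polydisc_def cspace_def)

lemma polydisc_upd: "x \<in> polydisc m r \<Longrightarrow> i < m \<Longrightarrow> norm t < r \<Longrightarrow> x(i := t) \<in> polydisc m r"
  by (auto simp: polydisc_iff)

lemma origin_polydisc: "0 < r \<Longrightarrow> origin \<in> polydisc m r"
  by (auto simp: polydisc_iff origin_def)

text \<open>
  The radius bounds only finitely many coordinates, so a point of an open
  polydisc already lies in a smaller one.
\<close>

lemma polydisc_shrink:
  assumes "x \<in> polydisc m r" "0 < r"
  obtains R where "0 < R" "R < r" "x \<in> polydisc m R"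
proof -
  define M where "M = Max (insert 0 ((\<lambda>i. norm (x i)) ` {..<m}))"
  have M: "M < r" "M \<ge> 0" and le: "\<And>i. i < m \<Longrightarrow> norm (x i) \<le> M"
    using assms by (auto simp: M_def polydisc_iff)
  show ?thesis
  proof (rule that[of "(M + r) / 2"])
    show "x \<in> polydisc m ((M + r) / 2)"
      using assms M le by (force simp: polydisc_iff)
  qed (use M in auto)
qed

lemma hol_on_cong: "(\<And>x. x \<in> polydisc m r \<Longrightarrow> f x = g x) \<Longrightarrow> hol_on m r f \<longleftrightarrow> hol_on m r g"
  unfolding hol_on_def
  by (intro arg_cong2[where f="(\<and>)"] continuous_on_cong ball_cong all_cong holomorphic_cong)
     (auto simp: polydisc_upd)

lemma hol_on_subset: "hol_on m r f \<Longrightarrow> s \<le> r \<Longrightarrow> hol_on m s f"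
  unfolding hol_on_def
  by (meson continuous_on_subset holomorphic_on_subset polydisc_mono subset_ball subsetD)

lemma hol_on_coord: "i < m \<Longrightarrow> hol_on m r (\<lambda>x. x i)"
  unfolding hol_on_def
proof (intro conjI ballI allI impI)
  show "(\<lambda>t. (x(j := t)) i) holomorphic_on ball 0 r" for x j
    by (cases "i = j") (auto intro: holomorphic_intros)
qed (rule continuous_on_product_then_coordinatewise[OF continuous_on_id])

lemma tendsto_point:
  fixes v :: "'a \<Rightarrow> point"
  assumes "\<And>a. ((\<lambda>t. v t a) \<longlongrightarrow> l a) F"
  shows "(v \<longlongrightarrow> l) F"
proof -
  have "limitin (product_topology (\<lambda>i. euclidean) UNIV) v l F"
    unfolding limitin_componentwise using assms by auto
  then show ?thesis
    by (simp add: euclidean_product_topology)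
qed

lemma continuous_on_small:
  fixes f :: "point \<Rightarrow> complex"
  assumes f: "continuous_on (polydisc m r) f" and "0 < r" "0 < e"
  obtains s where "0 < s" "s \<le> r" "\<And>x. x \<in> polydisc m s \<Longrightarrow> norm (f x - f origin) < e"
proof (rule ccontr)
  assume "\<not> thesis"
  then have "\<exists>x\<in>polydisc m (min r (1 / Suc k)). \<not> norm (f x - f origin) < e" for k
    using that[of "min r (1 / Suc k)"] assms(2) by auto
  then obtain X where X: "\<And>k. X k \<in> polydisc m (min r (1 / Suc k))" "\<And>k. \<not> norm (f (X k) - f origin) < e"
    by metis
  have "X \<longlonglongrightarrow> origin"
  proof (rule tendsto_point)
    fix a
    have "norm (X k a) \<le> 1 / Suc k" for k
      using X(1)[of k] by (cases "a < m") (auto simp: polydisc_iff less_imp_le)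
    then have "(\<lambda>k. X k a) \<longlonglongrightarrow> 0"
      using LIMSEQ_inverse_real_of_nat
      by (intro Lim_null_comparison[of "\<lambda>k. X k a" "\<lambda>k. 1 / Suc k"]) (auto simp: divide_inverse)
    then show "(\<lambda>k. X k a) \<longlonglongrightarrow> origin a"
      by (simp add: origin_def)
  qed
  moreover have "X k \<in> polydisc m r" for k
    using X(1)[of k] polydisc_mono[of "min r (1 / Suc k)" r m] by auto
  ultimately have "(\<lambda>k. f (X k)) \<longlonglongrightarrow> f origin"
    using assms(2) by (intro continuous_on_tendsto_compose[OF f]) (auto simp: origin_polydisc)
  then have "\<forall>\<^sub>F k in sequentially. norm (f (X k) - f origin) < e"
    using assms(3) by (auto simp: tendsto_iff dist_norm)
  then show False
    using X(2) by (auto simp: eventually_sequentially)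
qed

text \<open>
  The divided difference in the coordinate a of the function u, at the two values s and t of that
  coordinate, written as a Cauchy integral over the circle of radius R about 0. The coordinate a of
  the point y is overwritten and plays no role. The integral form makes continuity in all arguments
  evident, including on the diagonal \<open>s = t\<close>, where the value is the partial derivative.
\<close>

definition dd :: "real \<Rightarrow> (point \<Rightarrow> complex) \<Rightarrow> nat \<Rightarrow> point \<Rightarrow> complex \<Rightarrow> complex \<Rightarrow> complex" where
  "dd R u a y s t = integral (cbox 0 1) (\<lambda>\<theta>. u (y(a := circlepath 0 R \<theta>)) /
     ((circlepath 0 R \<theta> - s) * (circlepath 0 R \<theta> - t)) * circlepath 0 R \<theta>)"

lemma norm_circlepath: "0 \<le> R \<Longrightarrow> norm (circlepath 0 R \<theta>) = R"
  by (simp add: circlepath norm_mult)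

lemma continuous_on_circlepath: "continuous_on S (circlepath z R)"
  unfolding circlepath by (intro continuous_intros)

lemma continuous_on_upd_circle:
  assumes "hol_on q r u" "a < q" "0 \<le> R" "R < r"
    and "continuous_on S v" "continuous_on S w" "\<And>x. x \<in> S \<Longrightarrow> v x \<in> polydisc q r"
  shows "continuous_on S (\<lambda>x. u ((v x)(a := circlepath 0 R (w x))))"
proof (rule continuous_on_compose2[of "polydisc q r" u])
  show "continuous_on (polydisc q r) u"
    using assms by (simp add: hol_on_def)
  show "continuous_on S (\<lambda>x. (v x)(a := circlepath 0 R (w x)))"
  proof (rule continuous_on_coordinatewise_then_product)
    fix i
    show "continuous_on S (\<lambda>x. ((v x)(a := circlepath 0 R (w x))) i)"
      using continuous_on_compose2[OF continuous_on_circlepath assms(6), of UNIV]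
        continuous_on_product_then_coordinatewise[OF assms(5)]
      by (cases "i = a") auto
  qed
  show "(\<lambda>x. (v x)(a := circlepath 0 R (w x))) ` S \<subseteq> polydisc q r"
    using assms by (auto simp: norm_circlepath intro!: polydisc_upd)
qed

lemma cauchy_circle:
  assumes g: "g holomorphic_on ball 0 r" and "0 < R" "R < r" "norm w < R"
  shows "((\<lambda>\<theta>. g (circlepath 0 R \<theta>) / (circlepath 0 R \<theta> - w) * circlepath 0 R \<theta>) has_integral g w) (cbox 0 1)"
proof -
  have "g holomorphic_on cball 0 R"
    using g assms by (rule_tac holomorphic_on_subset) auto
  then have "((\<lambda>u. g u / (u - w)) has_contour_integral 2 * complex_of_real pi * \<i> * g w) (circlepath 0 R)"
    using assms by (intro Cauchy_integral_circlepath_simple) auto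
  then have "((\<lambda>x. g (circlepath 0 R x) / (circlepath 0 R x - w) * vector_derivative (circlepath 0 R) (at x within {0..1}))
      has_integral 2 * complex_of_real pi * \<i> * g w) {0..1}"
    by (simp add: has_contour_integral_def)
  then have "((\<lambda>x. (2 * complex_of_real pi * \<i>) * (g (circlepath 0 R x) / (circlepath 0 R x - w) * circlepath 0 R x))
      has_integral 2 * complex_of_real pi * \<i> * g w) {0..1}"
  proof (rule has_integral_eq[rotated])
    fix x :: real assume "x \<in> {0..1}"
    then have "vector_derivative (circlepath 0 R) (at x within {0..1}) = (2 * complex_of_real pi * \<i>) * circlepath 0 R x"
      by (subst vector_derivative_circlepath01) (auto simp: circlepath)
    then show "g (circlepath 0 R x) / (circlepath 0 R x - w) * vector_derivative (circlepath 0 R) (at x within {0..1}) =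
        (2 * complex_of_real pi * \<i>) * (g (circlepath 0 R x) / (circlepath 0 R x - w) * circlepath 0 R x)"
      by simp
  qed
  from has_integral_mult_right[OF this, of "1 / (2 * complex_of_real pi * \<i>)"] show ?thesis
    by (simp add: cbox_interval)
qed

lemma dd_diff:
  assumes "hol_on q r u" "a < q" "0 < R" "R < r" "y \<in> polydisc q r" "norm s < R" "norm t < R"
  shows "(s - t) * dd R u a y s t = u (y(a := s)) - u (y(a := t))"
proof -
  let ?c = "circlepath 0 R" and ?g = "\<lambda>w. u (y(a := w))"
  have g: "?g holomorphic_on ball 0 r"
    using assms by (simp add: hol_on_def)
  have ne: "?c \<theta> \<noteq> s" "?c \<theta> \<noteq> t" for \<theta>
    using norm_circlepath[of R \<theta>] assms by auto
  have *: "((\<lambda>\<theta>. ?g (?c \<theta>) / (?c \<theta> - s) * ?c \<theta> - ?g (?c \<theta>) / (?c \<theta> - t) * ?c \<theta>) has_integral ?g s - ?g t) (cbox 0 1)"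
    using assms by (intro has_integral_diff cauchy_circle[OF g]) auto
  have eq: "?g (?c \<theta>) / (?c \<theta> - s) * ?c \<theta> - ?g (?c \<theta>) / (?c \<theta> - t) * ?c \<theta> =
     (s - t) * (?g (?c \<theta>) / ((?c \<theta> - s) * (?c \<theta> - t)) * ?c \<theta>)" for \<theta>
    using ne[of \<theta>] by (simp add: divide_simps) (simp add: algebra_simps)
  show ?thesis
    unfolding dd_def using integral_unique[OF *[unfolded eq]] by (simp only: integral_mult_right)
qed

lemma dd_continuous:
  assumes "hol_on q r u" "a < q" "0 < R" "R < r"
  shows "continuous_on (polydisc q r \<times> ball 0 R \<times> ball 0 R) (\<lambda>(y, s, t). dd R u a y s t)"
proof -
  let ?U = "polydisc q r \<times> ball 0 R \<times> ball 0 R" and ?c = "circlepath 0 R"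
  have ne: "?c \<theta> \<noteq> s" if "norm s < R" for \<theta> s
    using norm_circlepath[of R \<theta>] assms that by auto
  have "continuous_on (?U \<times> cbox 0 1) (\<lambda>x. u ((fst (fst x))(a := ?c (snd x))) /
     ((?c (snd x) - fst (snd (fst x))) * (?c (snd x) - snd (snd (fst x)))) * ?c (snd x))"
    using assms by (intro continuous_intros continuous_on_upd_circle[OF assms(1,2)]
      continuous_on_compose2[OF continuous_on_circlepath[of UNIV]]) (auto dest!: ne)
  then have "continuous_on ?U (\<lambda>x. integral (cbox 0 1) (\<lambda>\<theta>. u ((fst x)(a := ?c \<theta>)) /
     ((?c \<theta> - fst (snd x)) * (?c \<theta> - snd (snd x))) * ?c \<theta>))"
    by (intro integral_continuous_on_param) (simp add: case_prod_unfold)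
  then show ?thesis
    by (simp add: dd_def case_prod_unfold)
qed

lemma continuous_on_dd:
  assumes "hol_on q r u" "a < q" "0 < R" "R < r"
    and "continuous_on S v" "continuous_on S s" "continuous_on S t"
    and "\<And>x. x \<in> S \<Longrightarrow> v x \<in> polydisc q r \<and> norm (s x) < R \<and> norm (t x) < R"
  shows "continuous_on S (\<lambda>x. dd R u a (v x) (s x) (t x))"
proof -
  have "continuous_on S (\<lambda>x. (\<lambda>(y, s, t). dd R u a y s t) (v x, s x, t x))"
    using assms(8)
    by (intro continuous_on_compose2[OF dd_continuous[OF assms(1-4)]] continuous_on_Pair assms(5-7)) auto
  then show ?thesis by simp
qed

lemma partial_has_derivative:
  assumes u: "hol_on q r u" and a: "a < q" and y: "y \<in> polydisc q r" and s: "norm s < r"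
  shows "((\<lambda>t. u (y(a := t))) has_field_derivative partial a u (y(a := s))) (at s)"
proof -
  have "(\<lambda>t. u (y(a := t))) holomorphic_on ball 0 r"
    using u a y by (simp add: hol_on_def)
  then show ?thesis
    using s holomorphic_derivI[of "\<lambda>t. u (y(a := t))" "ball 0 r" s UNIV]
    by (simp add: partial_def)
qed

text \<open>
  The difference quotient of u in the coordinate a is a divided difference, which is continuous up to
  the diagonal.
\<close>

lemma partial_eq_dd:
  assumes u: "hol_on q r u" and a: "a < q" and R: "0 < R" "R < r" and y: "y \<in> polydisc q r" and s: "norm (y a) < R"
  shows "partial a u y = dd R u a y (y a) (y a)"
proof -
  have "continuous_on (ball 0 R) (\<lambda>t. dd R u a y t (y a))"
    using assms by (intro continuous_on_dd[OF u a R] continuous_intros) auto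
  then have "((\<lambda>t. dd R u a y t (y a)) \<longlongrightarrow> dd R u a y (y a) (y a)) (at (y a))"
    using s by (metis (no_types) continuous_on_eq_continuous_at isCont_def mem_ball_0 open_ball)
  moreover have "\<forall>\<^sub>F t in at (y a). dd R u a y t (y a) = (u (y(a := t)) - u (y(a := y a))) / (t - y a)"
  proof -
    have "\<forall>\<^sub>F t in at (y a). t \<in> ball 0 R - {y a}"
      using s eventually_at_in_open[of "ball 0 R" "y a"] by auto
    then show ?thesis
    proof eventually_elim
      case (elim t)
      then show ?case
        using dd_diff[OF u a R y, of t "y a"] s by (auto simp: field_simps)
    qed
  qed
  ultimately have "((\<lambda>t. (u (y(a := t)) - u (y(a := y a))) / (t - y a)) \<longlongrightarrow> dd R u a y (y a) (y a)) (at (y a))"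
    by (rule Lim_transform_eventually)
  then have "((\<lambda>t. u (y(a := t))) has_field_derivative dd R u a y (y a) (y a)) (at (y a))"
    by (simp add: has_field_derivative_iff)
  then show ?thesis
    by (simp add: partial_def DERIV_imp_deriv)
qed

lemma partial_continuous:
  assumes u: "hol_on q r u" and a: "a < q" and R: "R < r" "0 < R"
  shows "continuous_on (polydisc q R) (partial a u)"
proof -
  have sub: "polydisc q R \<subseteq> polydisc q r"
    using R by (simp add: polydisc_mono)
  have "continuous_on (polydisc q R) (\<lambda>y. dd R u a y (y a) (y a))"
    using R a sub by (intro continuous_on_dd[OF u a] continuous_on_id continuous_on_product_then_coordinatewise[OF continuous_on_id])
      (auto simp: polydisc_iff)
  then show ?thesis
    using R a sub by (subst continuous_on_cong[OF refl partial_eq_dd[OF u a R(2,1)]]) (auto simp: polydisc_iff)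
qed

text \<open>
  The point which agrees with x in the coordinates below a and with y in the others: a path from y to
  x that changes one coordinate at a time.
\<close>

definition mix :: "nat \<Rightarrow> point \<Rightarrow> point \<Rightarrow> point" where
  "mix a x y = (\<lambda>i. if i < a then x i else y i)"

lemma mix_upd: "(mix a x y)(a := x a) = mix (Suc a) x y" "(mix a x y)(a := y a) = mix a x y"
  by (auto simp: mix_def)

lemma mix_polydisc: "x \<in> polydisc q r \<Longrightarrow> y \<in> polydisc q r \<Longrightarrow> mix a x y \<in> polydisc q r"
  by (auto simp: mix_def polydisc_iff)

lemma dd_telescope:
  assumes u: "hol_on q r u" and R: "0 < R" "R < r" and x: "x \<in> polydisc q R" and y: "y \<in> polydisc q R"
  shows "u x - u y = (\<Sum>a<q. (x a - y a) * dd R u a (mix a x y) (x a) (y a))"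
proof -
  have sub: "polydisc q R \<subseteq> polydisc q r"
    using R by (simp add: polydisc_mono)
  have "mix q x y = x" "mix 0 x y = y"
    using x y by (auto simp: mix_def polydisc_iff fun_eq_iff)
  then have "u x - u y = (\<Sum>a<q. u (mix (Suc a) x y) - u (mix a x y))"
    by (simp add: sum_lessThan_telescope[of "\<lambda>a. u (mix a x y)"])
  also have "\<dots> = (\<Sum>a<q. (x a - y a) * dd R u a (mix a x y) (x a) (y a))"
  proof (intro sum.cong refl)
    fix a assume "a \<in> {..<q}"
    then have a: "a < q" and xa: "norm (x a) < R" and ya: "norm (y a) < R"
      using x y by (auto simp: polydisc_iff)
    have "mix a x y \<in> polydisc q r"
      using mix_polydisc[OF x y] sub by blast
    from dd_diff[OF u a R this xa ya]
    show "u (mix (Suc a) x y) - u (mix a x y) = (x a - y a) * dd R u a (mix a x y) (x a) (y a)"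
      by (simp only: mix_upd)
  qed
  finally show ?thesis .
qed

text \<open>
  The increment of u along the curve is the telescoping sum of divided differences times increments
  of the coordinates. Dividing by the increment of the parameter and using the continuity of the
  divided differences gives the derivative; total differentiability of u is not needed.
\<close>

lemma chain_rule:
  assumes u: "hol_on q r u" and r: "0 < r" and v: "v t0 \<in> polydisc q r"
    and near: "\<forall>\<^sub>F t in at t0. v t \<in> cspace q"
    and d: "\<And>a. a < q \<Longrightarrow> ((\<lambda>t. v t a) has_field_derivative d a) (at t0)"
  shows "((\<lambda>t. u (v t)) has_field_derivative (\<Sum>a<q. partial a u (v t0) * d a)) (at t0)"
proof -
  obtain R where R: "0 < R" "R < r" and vR: "v t0 \<in> polydisc q R"
    using polydisc_shrink[OF v r] by blast
  have sub: "polydisc q R \<subseteq> polydisc q r"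
    using R by (simp add: polydisc_mono)
  have lim: "((\<lambda>t. v t a) \<longlongrightarrow> v t0 a) (at t0)" for a
  proof (cases "a < q")
    case True
    then show ?thesis
      using d[OF True] DERIV_isCont isCont_def by blast
  next
    case False
    show ?thesis
      by (rule Lim_transform_eventually[OF tendsto_const], rule eventually_mono[OF near])
         (use False vR in \<open>auto simp: cspace_def polydisc_iff\<close>)
  qed
  have "\<forall>\<^sub>F t in at t0. \<forall>a\<in>{..<q}. norm (v t a) < R"
  proof (rule eventually_ball_finite, simp, rule ballI)
    fix a assume "a \<in> {..<q}"
    then show "\<forall>\<^sub>F t in at t0. norm (v t a) < R"
      using vR by (intro order_tendstoD(2)[OF tendsto_norm[OF lim]]) (auto simp: polydisc_iff)
  qed
  then have ev: "\<forall>\<^sub>F t in at t0. v t \<in> polydisc q R"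
    using near by eventually_elim (auto simp: polydisc_def)
  have "((\<lambda>t. \<Sum>a<q. (v t a - v t0 a) / (t - t0) * dd R u a (mix a (v t) (v t0)) (v t a) (v t0 a)) \<longlongrightarrow>
      (\<Sum>a<q. d a * dd R u a (v t0) (v t0 a) (v t0 a))) (at t0)"
  proof (intro tendsto_sum tendsto_mult)
    fix a assume a: "a \<in> {..<q}"
    then have aq: "a < q" by simp
    show "((\<lambda>t. (v t a - v t0 a) / (t - t0)) \<longlongrightarrow> d a) (at t0)"
      using d a by (simp add: has_field_derivative_iff)
    have "((\<lambda>t. (mix a (v t) (v t0), v t a, v t0 a)) \<longlongrightarrow> (v t0, v t0 a, v t0 a)) (at t0)"
    proof (intro tendsto_Pair tendsto_const tendsto_point)
      show "((\<lambda>t. mix a (v t) (v t0) i) \<longlongrightarrow> v t0 i) (at t0)" for i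
        using lim by (cases "i < a") (auto simp: mix_def)
    qed (rule lim)
    then have "((\<lambda>t. (\<lambda>(y, s, t). dd R u a y s t) (mix a (v t) (v t0), v t a, v t0 a)) \<longlongrightarrow>
        (\<lambda>(y, s, t). dd R u a y s t) (v t0, v t0 a, v t0 a)) (at t0)"
    proof (rule continuous_on_tendsto_compose[OF dd_continuous[OF u aq R]])
      show "(v t0, v t0 a, v t0 a) \<in> polydisc q r \<times> ball 0 R \<times> ball 0 R"
        using v vR a by (auto simp: polydisc_iff)
      show "\<forall>\<^sub>F t in at t0. (mix a (v t) (v t0), v t a, v t0 a) \<in> polydisc q r \<times> ball 0 R \<times> ball 0 R"
        using ev
      proof eventually_elim
        case (elim t)
        then have "mix a (v t) (v t0) \<in> polydisc q r"
          using mix_polydisc[OF elim vR] sub by blast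
        then show ?case
          using elim vR aq by (simp add: polydisc_iff)
      qed
    qed
    then show "((\<lambda>t. dd R u a (mix a (v t) (v t0)) (v t a) (v t0 a)) \<longlongrightarrow> dd R u a (v t0) (v t0 a) (v t0 a)) (at t0)"
      by simp
  qed
  moreover have "\<forall>\<^sub>F t in at t0. (\<Sum>a<q. (v t a - v t0 a) / (t - t0) * dd R u a (mix a (v t) (v t0)) (v t a) (v t0 a)) =
      (u (v t) - u (v t0)) / (t - t0)"
    using ev by eventually_elim (simp add: dd_telescope[OF u R _ vR] sum_divide_distrib)
  ultimately have "((\<lambda>t. (u (v t) - u (v t0)) / (t - t0)) \<longlongrightarrow> (\<Sum>a<q. d a * dd R u a (v t0) (v t0 a) (v t0 a))) (at t0)"
    by (rule Lim_transform_eventually)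
  moreover have "(\<Sum>a<q. d a * dd R u a (v t0) (v t0 a) (v t0 a)) = (\<Sum>a<q. partial a u (v t0) * d a)"
  proof (intro sum.cong refl)
    fix a assume "a \<in> {..<q}"
    then have a: "a < q" and va: "norm (v t0 a) < R"
      using vR by (auto simp: polydisc_iff)
    show "d a * dd R u a (v t0) (v t0 a) (v t0 a) = partial a u (v t0) * d a"
      by (simp add: partial_eq_dd[OF u a R v va])
  qed
  ultimately show ?thesis
    by (simp add: has_field_derivative_iff)
qed

lemma hol_on_compose:
  assumes u: "hol_on q r u" and r: "0 < r"
    and v: "\<And>a. a < q \<Longrightarrow> hol_on m s (\<lambda>x. v x a)"
    and vr: "\<And>x. x \<in> polydisc m s \<Longrightarrow> v x \<in> polydisc q r"
  shows "hol_on m s (\<lambda>x. u (v x))"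
  unfolding hol_on_def
proof (intro conjI ballI allI impI)
  have "continuous_on (polydisc m s) v"
  proof (rule continuous_on_coordinatewise_then_product)
    fix a
    show "continuous_on (polydisc m s) (\<lambda>x. v x a)"
    proof (cases "a < q")
      case True
      then show ?thesis using v by (simp add: hol_on_def)
    next
      case False
      then show ?thesis
        using vr by (subst continuous_on_cong[OF refl, of _ _ "\<lambda>_. 0"]) (auto simp: polydisc_iff)
    qed
  qed
  then show "continuous_on (polydisc m s) (\<lambda>x. u (v x))"
    using vr u[unfolded hol_on_def] by (intro continuous_on_compose2[of "polydisc q r" u "polydisc m s" v] image_subsetI) blast+
  fix x i assume x: "x \<in> polydisc m s" and i: "i < m"
  show "(\<lambda>t. u (v (x(i := t)))) holomorphic_on ball 0 s"
  proof (subst holomorphic_on_open[OF open_ball], intro ballI exI)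
    fix t0 :: complex assume t0: "t0 \<in> ball 0 s"
    show "((\<lambda>t. u (v (x(i := t)))) has_field_derivative
       (\<Sum>a<q. partial a u (v (x(i := t0))) * deriv (\<lambda>t. v (x(i := t)) a) t0)) (at t0)"
    proof (rule chain_rule[OF u r])
      show "v (x(i := t0)) \<in> polydisc q r"
        using t0 by (intro vr polydisc_upd[OF x i]) simp
      have "\<forall>\<^sub>F t in at t0. t \<in> ball 0 s"
        using t0 by (intro eventually_at_in_open') auto
      then show "\<forall>\<^sub>F t in at t0. v (x(i := t)) \<in> cspace q"
      proof eventually_elim
        case (elim t)
        then have "x(i := t) \<in> polydisc m s"
          by (intro polydisc_upd[OF x i]) simp
        then show ?case
          using vr by (simp add: polydisc_def)
      qed
      fix a assume "a < q"
      then have "(\<lambda>t. v (x(i := t)) a) holomorphic_on ball 0 s"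
        using v x i by (simp add: hol_on_def)
      then show "((\<lambda>t. v (x(i := t)) a) has_field_derivative deriv (\<lambda>t. v (x(i := t)) a) t0) (at t0)"
        using t0 by (intro holomorphic_derivI) auto
    qed
  qed
qed

text \<open>
  Seen as a function of the q coordinates of y and of one additional coordinate q, which holds the
  second value, the divided difference is again holomorphic. The entry \<open>y(q := 0)\<close> returns to the
  space of dimension q.
\<close>

lemma hol_on_dd:
  assumes u: "hol_on q r u" and a: "a < q" and R: "0 < R" "R < r"
  shows "hol_on (Suc q) R (\<lambda>y. dd R u a (y(q := 0)) (y a) (y q))"
  unfolding hol_on_def
proof (intro conjI ballI allI impI)
  have trunc: "y(q := 0) \<in> polydisc q R" if "y \<in> polydisc (Suc q) R" for y
    using that by (auto simp: polydisc_iff)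
  have sub: "polydisc q R \<subseteq> polydisc q r"
    using R by (simp add: polydisc_mono)
  have c: "continuous_on S (\<lambda>y::point. y i)" for S i
    by (intro continuous_on_product_then_coordinatewise[OF continuous_on_id])
  show "continuous_on (polydisc (Suc q) R) (\<lambda>y. dd R u a (y(q := 0)) (y a) (y q))"
  proof (rule continuous_on_dd[OF u a R])
    show "continuous_on (polydisc (Suc q) R) (\<lambda>y. y(q := 0))"
    proof (rule continuous_on_coordinatewise_then_product)
      show "continuous_on (polydisc (Suc q) R) (\<lambda>x. (x(q := 0)) i)" for i
        using c by (cases "i = q") auto
    qed
    show "x(q := 0) \<in> polydisc q r \<and> norm (x a) < R \<and> norm (x q) < R" if "x \<in> polydisc (Suc q) R" for x
      using that subsetD[OF sub trunc[OF that]] a by (simp add: polydisc_iff)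
  qed (use c in auto)
  fix y i assume y: "y \<in> polydisc (Suc q) R" and i: "i < Suc q"
  let ?c = "circlepath 0 R" and ?K = "\<lambda>y \<theta>. u (y(q := 0, a := circlepath 0 R \<theta>))"
  have ne: "?c \<theta> \<noteq> s" if "norm s < R" for \<theta> s
    using norm_circlepath[of R \<theta>] R that by auto
  have ne': "?c \<theta> \<noteq> y a" "?c \<theta> \<noteq> y q" for \<theta>
    using ne y a by (auto simp: polydisc_iff)
  have cc: "continuous_on S (\<lambda>x. ?c (f x))" if "continuous_on S f" for S and f :: "'z::topological_space \<Rightarrow> real"
    using continuous_on_compose2[OF continuous_on_circlepath that, of UNIV] by auto
  have y0: "y(q := 0) \<in> polydisc q r"
    using trunc[OF y] sub by auto
  have K: "continuous_on S (\<lambda>x. ?K y (f x))" if "continuous_on S f" for S and f :: "'z::topological_space \<Rightarrow> real"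
    using R y0 by (intro continuous_on_upd_circle[OF u a _ R(2)] that) auto
  have *: "(\<lambda>t. integral (cbox 0 1) (\<lambda>\<theta>. ?K y \<theta> / ((?c \<theta> - b) * (?c \<theta> - t)) * ?c \<theta>)) holomorphic_on ball 0 R"
    if b: "norm b < R" for b
  proof (rule leibniz_rule_holomorphic[where fx="\<lambda>t \<theta>. ?K y \<theta> / ((?c \<theta> - b) * (?c \<theta> - t)^2) * ?c \<theta>"])
    fix t :: complex and \<theta> :: real assume "t \<in> ball 0 R"
    then show "((\<lambda>x. ?K y \<theta> / ((?c \<theta> - b) * (?c \<theta> - x)) * ?c \<theta>) has_field_derivative
              ?K y \<theta> / ((?c \<theta> - b) * (?c \<theta> - t)\<^sup>2) * ?c \<theta>) (at t within ball 0 R)"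
      using ne[of b \<theta>] ne[of t \<theta>] b
      by (auto intro!: derivative_eq_intros simp: divide_simps power2_eq_square) (simp add: algebra_simps)
  next
    fix x :: complex assume "x \<in> ball 0 R"
    then show "(\<lambda>\<theta>. ?K y \<theta> / ((?c \<theta> - b) * (?c \<theta> - x)) * ?c \<theta>) integrable_on cbox 0 1"
      using ne b by (intro integrable_continuous continuous_intros K cc) auto
  next
    show "continuous_on (ball 0 R \<times> cbox 0 1) (\<lambda>(x, t). ?K y t / ((?c t - b) * (?c t - x)\<^sup>2) * ?c t)"
      unfolding case_prod_unfold
      using ne b by (intro continuous_intros K cc) auto
  qed simp
  \<comment> \<open>the two values only enter the kernel of the integral, the other coordinates only u\<close>
  consider "i = a" | "i = q" | "i \<noteq> a" "i < q"
    using i by linarith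
  then show "(\<lambda>t. dd R u a ((y(i := t))(q := 0)) ((y(i := t)) a) ((y(i := t)) q)) holomorphic_on ball 0 R"
  proof cases
    case 1
    have "norm (y q) < R" using y by (auto simp: polydisc_iff)
    moreover have "?K (y(i := t)) \<theta> = ?K y \<theta>" for t \<theta>
      using 1 by (intro arg_cong[of _ _ u]) (auto simp: fun_eq_iff)
    ultimately show ?thesis
      using *[of "y q"] 1 a by (simp add: dd_def mult.commute[of "_ - y q"])
  next
    case 2
    have "norm (y a) < R" using y a by (auto simp: polydisc_iff)
    then show ?thesis
      using *[of "y a"] 2 a by (simp add: dd_def)
  next
    case 3
    define S where "S = (y(q := 0))"
    have S: "S \<in> polydisc q R" "S \<in> polydisc q r" using trunc[OF y] y0 by (auto simp: S_def)
    obtain R' where R': "R < R'" "R' < r" using R dense by blast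
    have "(\<lambda>t. integral (cbox 0 1) (\<lambda>\<theta>. u (S(a := ?c \<theta>, i := t)) / ((?c \<theta> - y a) * (?c \<theta> - y q)) * ?c \<theta>)) holomorphic_on ball 0 R"
    proof (rule leibniz_rule_holomorphic[where fx="\<lambda>t \<theta>. partial i u (S(a := ?c \<theta>, i := t)) / ((?c \<theta> - y a) * (?c \<theta> - y q)) * ?c \<theta>"])
      fix t :: complex and \<theta> :: real assume t: "t \<in> ball 0 R"
      have "S(a := ?c \<theta>) \<in> polydisc q r"
        using S a R by (intro polydisc_upd) (auto simp: norm_circlepath)
      from partial_has_derivative[OF u 3(2) this, of t]
      have "((\<lambda>t. u (S(a := ?c \<theta>, i := t))) has_field_derivative partial i u (S(a := ?c \<theta>, i := t))) (at t within ball 0 R)"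
        using t R has_field_derivative_at_within by force
      then show "((\<lambda>x. u (S(a := ?c \<theta>, i := x)) / ((?c \<theta> - y a) * (?c \<theta> - y q)) * ?c \<theta>) has_field_derivative
              partial i u (S(a := ?c \<theta>, i := t)) / ((?c \<theta> - y a) * (?c \<theta> - y q)) * ?c \<theta>) (at t within ball 0 R)"
        by (intro DERIV_cmult_right DERIV_cdivide)
    next
      fix t :: complex assume t: "t \<in> ball 0 R"
      have "continuous_on (cbox 0 1) (\<lambda>\<theta>. u ((S(i := t))(a := ?c \<theta>)))"
        using t R by (intro continuous_on_upd_circle[OF u a _ R(2)] continuous_on_const continuous_on_id polydisc_upd[OF S(2) 3(2)]) auto
      then show "(\<lambda>\<theta>. u (S(a := ?c \<theta>, i := t)) / ((?c \<theta> - y a) * (?c \<theta> - y q)) * ?c \<theta>) integrable_on cbox 0 1"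
        using ne' 3 by (intro integrable_continuous continuous_intros cc) (auto simp: fun_upd_twist)
    next
      have part: "continuous_on (ball 0 R \<times> cbox 0 1) (\<lambda>x. partial i u (S(a := ?c (snd x), i := fst x)))"
      proof (rule continuous_on_compose2[OF partial_continuous[OF u _ R'(2)]])
        show "continuous_on (ball 0 R \<times> cbox 0 1) (\<lambda>x. S(a := ?c (snd x), i := fst x))"
        proof (rule continuous_on_coordinatewise_then_product)
          fix k show "continuous_on (ball 0 R \<times> cbox 0 1) (\<lambda>x. (S(a := ?c (snd x), i := fst x)) k)"
            by (cases "k = i"; cases "k = a") (auto intro!: cc continuous_on_fst continuous_on_snd continuous_on_id)
        qed
        show "(\<lambda>x. S(a := ?c (snd x), i := fst x)) ` (ball 0 R \<times> cbox 0 1) \<subseteq> polydisc q R'"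
        proof (rule image_subsetI)
          fix x :: "complex \<times> real" assume "x \<in> ball 0 R \<times> cbox 0 1"
          then have x: "norm (fst x) < R'"
            using R' by auto
          have "S \<in> polydisc q R'"
            using S(1) R' polydisc_mono[of R R' q] by auto
          then have "S(a := ?c (snd x)) \<in> polydisc q R'"
            by (rule polydisc_upd) (use a R R' in \<open>auto simp: norm_circlepath\<close>)
          then show "S(a := ?c (snd x), i := fst x) \<in> polydisc q R'"
            by (rule polydisc_upd) (use x 3 in auto)
        qed
      qed (use R R' 3 in auto)
      then show "continuous_on (ball 0 R \<times> cbox 0 1)
         (\<lambda>(x, t). partial i u (S(a := ?c t, i := x)) / ((?c t - y a) * (?c t - y q)) * ?c t)"
        unfolding case_prod_unfold using ne'
        by (intro continuous_on_mult continuous_on_divide continuous_on_diff continuous_on_const cc part continuous_on_snd continuous_on_id) auto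
    qed simp
    moreover have "u (S(a := c, i := t)) = u ((y(i := t))(q := 0, a := c))" for c t
      using 3 by (intro arg_cong[of _ _ u]) (auto simp: fun_eq_iff S_def)
    ultimately show ?thesis
      using 3 by (simp add: dd_def)
  qed
qed

lemma hol_on_partial:
  assumes u: "hol_on q r u" and a: "a < q" and R: "0 < R" "R < r"
  shows "hol_on q R (partial a u)"
proof -
  have "hol_on q R (\<lambda>y. (\<lambda>y. dd R u a (y(q := 0)) (y a) (y q)) (y(q := y a)))"
  proof (rule hol_on_compose[OF hol_on_dd[OF u a R] R(1)])
    show "hol_on q R (\<lambda>x. (x(q := x a)) k)" if "k < Suc q" for k
      using that a by (cases "k = q") (auto intro: hol_on_coord)
    show "x(q := x a) \<in> polydisc (Suc q) R" if "x \<in> polydisc q R" for x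
      using that a by (auto simp: polydisc_iff)
  qed
  moreover have "dd R u a ((y(q := y a))(q := 0)) ((y(q := y a)) a) ((y(q := y a)) q) = partial a u y"
    if y: "y \<in> polydisc q R" for y
  proof -
    have "(y(q := y a))(q := 0) = y" using y by (auto simp: polydisc_iff)
    then show ?thesis
      using y a R polydisc_mono[of R r q] by (subst partial_eq_dd[OF u a R]) (auto simp: polydisc_iff)
  qed
  ultimately show ?thesis
    by (subst (asm) hol_on_cong) auto
qed

section \<open>Germs of functions and of maps\<close>

lemma near_origin_polydisc: "0 < r \<Longrightarrow> near_origin m (\<lambda>x. x \<in> polydisc m r)"
  by (auto simp: near_origin_def)

lemma near_origin_at_origin: "near_origin m Q \<Longrightarrow> Q origin"
  by (auto simp: near_origin_def origin_polydisc)

lemma near_origin_ball: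
  "finite I \<Longrightarrow> (\<And>i. i \<in> I \<Longrightarrow> near_origin m (Q i)) \<Longrightarrow> near_origin m (\<lambda>x. \<forall>i\<in>I. Q i x)"
proof (induction I rule: finite_induct)
  case empty
  then show ?case by (simp add: near_origin_triv)
next
  case (insert a I)
  have "near_origin m (\<lambda>x. Q a x \<and> (\<forall>i\<in>I. Q i x))"
    using insert by (intro near_origin_conj) auto
  then show ?case by (rule near_origin_mono) auto
qed

lemma near_origin_all_less:
  "(\<And>i. i < (n::nat) \<Longrightarrow> near_origin m (Q i)) \<Longrightarrow> near_origin m (\<lambda>x. \<forall>i<n. Q i x)"
  using near_origin_ball[of "{..<n}" m Q] by (auto elim!: near_origin_mono)

text \<open>
  A property near the origin also holds, at every point near the origin, along each coordinate line;
  this is what derivatives depend on.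
\<close>

lemma near_origin_near:
  assumes "near_origin m Q"
  shows "near_origin m (\<lambda>x. \<forall>i<m. \<forall>\<^sub>F t in nhds (x i). Q (x(i := t)))"
proof -
  obtain r where r: "r > 0" "\<forall>x\<in>polydisc m r. Q x"
    using assms by (auto simp: near_origin_def)
  have "\<forall>\<^sub>F t in nhds (x i). Q (x(i := t))" if "x \<in> polydisc m r" "i < m" for x i
  proof -
    have "\<forall>\<^sub>F t in nhds (x i). t \<in> ball 0 r"
      using that by (intro eventually_nhds_in_open) (auto simp: polydisc_iff)
    then show ?thesis
      by eventually_elim (use that r polydisc_upd in auto)
  qed
  then show ?thesis
    using r(1) by (auto simp: near_origin_def)
qed

lemma holomorphic_germ_cong:
  assumes "near_origin m (\<lambda>x. f x = g x)" "holomorphic_germ m f"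
  shows "holomorphic_germ m g"
proof -
  obtain r s where "r > 0" "\<forall>x\<in>polydisc m r. f x = g x" "s > 0" "hol_on m s f"
    using assms by (auto simp: near_origin_def holomorphic_germ_iff)
  then have "hol_on m (min r s) g"
    using hol_on_subset[of m s f "min r s"] hol_on_cong[of m "min r s" f g] polydisc_mono[of "min r s" r m] by auto
  then show ?thesis
    using \<open>r > 0\<close> \<open>s > 0\<close> by (auto simp: holomorphic_germ_iff intro!: exI[of _ "min r s"])
qed

lemma holomorphic_germ_add:
  assumes "holomorphic_germ m f" "holomorphic_germ m g"
  shows "holomorphic_germ m (\<lambda>x. f x + g x)"
  using holomorphic_germ_binop[of "(+)" m f g] assms
  by (simp add: continuous_on_add holomorphic_on_add)

lemma holomorphic_germ_mult:
  assumes "holomorphic_germ m f" "holomorphic_germ m g"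
  shows "holomorphic_germ m (\<lambda>x. f x * g x)"
  using holomorphic_germ_binop[of "(*)" m f g] assms
  by (simp add: continuous_on_mult holomorphic_on_mult)

lemma holomorphic_germ_diff:
  assumes "holomorphic_germ m f" "holomorphic_germ m g"
  shows "holomorphic_germ m (\<lambda>x. f x - g x)"
  using holomorphic_germ_binop[of "(-)" m f g] assms
  by (simp add: continuous_on_diff holomorphic_on_diff)

lemma holomorphic_germ_sum:
  "(\<And>i. i \<in> A \<Longrightarrow> holomorphic_germ m (f i)) \<Longrightarrow> holomorphic_germ m (\<lambda>x. \<Sum>i\<in>A. f i x)"
  by (induction A rule: infinite_finite_induct) (auto simp: holomorphic_germ_const holomorphic_germ_add)

lemma holomorphic_germ_prod:
  "(\<And>i. i \<in> A \<Longrightarrow> holomorphic_germ m (f i)) \<Longrightarrow> holomorphic_germ m (\<lambda>x. \<Prod>i\<in>A. f i x)"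
  by (induction A rule: infinite_finite_induct) (auto simp: holomorphic_germ_const holomorphic_germ_mult)

lemma holomorphic_germ_coord: "i < m \<Longrightarrow> holomorphic_germ m (\<lambda>x. x i)"
  using hol_on_coord[of i m 1] by (auto simp: holomorphic_germ_iff intro: exI[of _ 1])

lemma holomorphic_germ_nonzero:
  assumes "holomorphic_germ m f" "f origin \<noteq> 0"
  shows "near_origin m (\<lambda>x. f x \<noteq> 0)"
proof -
  obtain r where r: "r > 0" "hol_on m r f"
    using assms by (auto simp: holomorphic_germ_iff)
  obtain s where "0 < s" "\<And>x. x \<in> polydisc m s \<Longrightarrow> norm (f x - f origin) < norm (f origin)"
    using continuous_on_small[of m r f "norm (f origin)"] r assms(2) unfolding hol_on_def by (metis zero_less_norm_iff)
  then show ?thesis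
    unfolding near_origin_def by (intro exI[of _ s]) fastforce
qed

lemma holomorphic_germ_inverse:
  assumes "holomorphic_germ m f" "f origin \<noteq> 0"
  shows "holomorphic_germ m (\<lambda>x. inverse (f x))"
proof -
  obtain r s where r: "r > 0" "hol_on m r f" "s > 0" "\<forall>x\<in>polydisc m s. f x \<noteq> 0"
    using assms(1) holomorphic_germ_nonzero[OF assms] by (auto simp: holomorphic_germ_iff near_origin_def)
  define q where "q = min r s"
  have q: "q > 0" "hol_on m q f" and nz: "\<And>x. x \<in> polydisc m q \<Longrightarrow> f x \<noteq> 0"
    using r hol_on_subset[of m r f q] polydisc_mono[of q s m] by (auto simp: q_def)
  have "hol_on m q (\<lambda>x. inverse (f x))"
    unfolding hol_on_def
  proof (intro conjI ballI allI impI)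
    show "continuous_on (polydisc m q) (\<lambda>x. inverse (f x))"
      using q nz by (intro continuous_on_inverse) (auto simp: hol_on_def)
    show "(\<lambda>t. inverse (f (x(i := t)))) holomorphic_on ball 0 q" if "x \<in> polydisc m q" "i < m" for x i
      using q nz polydisc_upd[OF that] that by (intro holomorphic_on_inverse) (auto simp: hol_on_def)
  qed
  then show ?thesis
    using q by (auto simp: holomorphic_germ_iff)
qed

lemmas holomorphic_germ_intros =
  holomorphic_germ_const holomorphic_germ_add holomorphic_germ_mult holomorphic_germ_diff
  holomorphic_germ_sum holomorphic_germ_prod holomorphic_germ_coord

lemma holomorphic_germ_partial:
  assumes "holomorphic_germ m f" "i < m"
  shows "holomorphic_germ m (partial i f)"
proof -
  obtain r where r: "r > 0" "hol_on m r f"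
    using assms by (auto simp: holomorphic_germ_iff)
  then have "hol_on m (r / 2) (partial i f)"
    using assms by (intro hol_on_partial) auto
  then show ?thesis
    using r by (auto simp: holomorphic_germ_iff intro!: exI[of _ "r / 2"])
qed

lemma partial_near_derivative:
  assumes "holomorphic_germ m f" "i < m"
  shows "near_origin m (\<lambda>x. ((\<lambda>t. f (x(i := t))) has_field_derivative partial i f x) (at (x i)))"
proof -
  obtain r where r: "r > 0" "hol_on m r f"
    using assms by (auto simp: holomorphic_germ_iff)
  have "((\<lambda>t. f (x(i := t))) has_field_derivative partial i f x) (at (x i))" if "x \<in> polydisc m r" for x
    using partial_has_derivative[OF r(2) assms(2) that, of "x i"] that assms(2) by (simp add: polydisc_iff)
  then show ?thesis
    using r(1) by (auto simp: near_origin_def)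
qed

lemma partial_eqI:
  "((\<lambda>t. f (x(i := t))) has_field_derivative D) (at (x i)) \<Longrightarrow> partial i f x = D"
  by (simp add: partial_def DERIV_imp_deriv)

lemma partial_cong:
  assumes "near_origin m (\<lambda>x. f x = g x)" "i < m"
  shows "near_origin m (\<lambda>x. partial i f x = partial i g x)"
  using near_origin_near[OF assms(1)]
  by (rule near_origin_mono) (use assms(2) in \<open>auto simp: partial_def intro!: deriv_cong_ev\<close>)

lemma partial_const: "partial i (\<lambda>_. c) x = 0"
  by (simp add: partial_def)

lemma partial_coord: "partial i (\<lambda>x. x j) x = (if i = j then 1 else 0)"
  by (rule partial_eqI) (auto intro!: derivative_eq_intros)

lemma partial_add:
  assumes "holomorphic_germ m f" "holomorphic_germ m g" "i < m"
  shows "near_origin m (\<lambda>x. partial i (\<lambda>x. f x + g x) x = partial i f x + partial i g x)"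
  using near_origin_conj[OF partial_near_derivative[OF assms(1,3)] partial_near_derivative[OF assms(2,3)]]
  by (rule near_origin_mono) (auto intro!: partial_eqI derivative_eq_intros)

lemma partial_mult:
  assumes "holomorphic_germ m f" "holomorphic_germ m g" "i < m"
  shows "near_origin m (\<lambda>x. partial i (\<lambda>x. f x * g x) x = partial i f x * g x + f x * partial i g x)"
  using near_origin_conj[OF partial_near_derivative[OF assms(1,3)] partial_near_derivative[OF assms(2,3)]]
  by (rule near_origin_mono) (auto intro!: partial_eqI derivative_eq_intros)

lemma partial_sum:
  assumes "\<And>j. j \<in> A \<Longrightarrow> holomorphic_germ m (f j)" "i < m"
  shows "near_origin m (\<lambda>x. partial i (\<lambda>x. \<Sum>j\<in>A. f j x) x = (\<Sum>j\<in>A. partial i (f j) x))"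
  using assms(1)
proof (induction A rule: infinite_finite_induct)
  case (insert a A)
  have "near_origin m (\<lambda>x. partial i (\<lambda>x. f a x + (\<Sum>j\<in>A. f j x)) x = partial i (f a) x + partial i (\<lambda>x. \<Sum>j\<in>A. f j x) x)"
    using insert assms(2) by (intro partial_add holomorphic_germ_sum) auto
  moreover have "near_origin m (\<lambda>x. partial i (\<lambda>x. \<Sum>j\<in>A. f j x) x = (\<Sum>j\<in>A. partial i (f j) x))"
    using insert by auto
  ultimately have "near_origin m (\<lambda>x. partial i (\<lambda>x. f a x + (\<Sum>j\<in>A. f j x)) x =
      partial i (f a) x + partial i (\<lambda>x. \<Sum>j\<in>A. f j x) x \<and>
      partial i (\<lambda>x. \<Sum>j\<in>A. f j x) x = (\<Sum>j\<in>A. partial i (f j) x))"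
    by (rule near_origin_conj)
  then show ?case
    by (rule near_origin_mono) (use insert(1,2) in simp)
qed (auto simp: partial_const near_origin_triv)

lemma map_germD:
  assumes "map_germ m q v"
  shows "near_origin m (\<lambda>x. v x \<in> cspace q)" "\<And>a. a < q \<Longrightarrow> holomorphic_germ m (\<lambda>x. v x a)" "v origin = origin"
  using assms by (auto simp: map_germ_def)

lemma map_germ_radius:
  assumes v: "map_germ m q v" and r: "0 < r"
  obtains s where "0 < s" "\<And>a. a < q \<Longrightarrow> hol_on m s (\<lambda>x. v x a)" "\<And>x. x \<in> polydisc m s \<Longrightarrow> v x \<in> polydisc q r"
proof -
  have "\<forall>a\<in>{..<q}. \<exists>s>0. hol_on m s (\<lambda>x. v x a) \<and> (\<forall>x\<in>polydisc m s. norm (v x a) < r)"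
  proof
    fix a assume "a \<in> {..<q}"
    then obtain s where s: "s > 0" "hol_on m s (\<lambda>x. v x a)"
      using map_germD(2)[OF v] by (auto simp: holomorphic_germ_iff)
    obtain s' where s': "0 < s'" "s' \<le> s" "\<And>x. x \<in> polydisc m s' \<Longrightarrow> norm (v x a - v origin a) < r"
      using continuous_on_small[of m s "\<lambda>x. v x a" r] s r by (auto simp: hol_on_def)
    have "v origin a = 0"
      using map_germD(3)[OF v] by (simp add: origin_def)
    then show "\<exists>s>0. hol_on m s (\<lambda>x. v x a) \<and> (\<forall>x\<in>polydisc m s. norm (v x a) < r)"
      using s s' hol_on_subset[OF s(2) s'(2)] by (intro exI[of _ s']) auto
  qed
  then obtain S where S: "\<And>a. a < q \<Longrightarrow> S a > 0" "\<And>a. a < q \<Longrightarrow> hol_on m (S a) (\<lambda>x. v x a)"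
    "\<And>a x. a < q \<Longrightarrow> x \<in> polydisc m (S a) \<Longrightarrow> norm (v x a) < r"
    by (metis lessThan_iff)
  obtain s0 where s0: "s0 > 0" "\<And>x. x \<in> polydisc m s0 \<Longrightarrow> v x \<in> cspace q"
    using map_germD(1)[OF v] by (auto simp: near_origin_def)
  define s where "s = Min (insert s0 (S ` {..<q}))"
  have s: "s > 0" "s \<le> s0" "\<And>a. a < q \<Longrightarrow> s \<le> S a"
    using S(1) s0 by (auto simp: s_def)
  show ?thesis
  proof (rule that[OF s(1)])
    show "hol_on m s (\<lambda>x. v x a)" if "a < q" for a
      using hol_on_subset[OF S(2) s(3)] that by auto
    show "v x \<in> polydisc q r" if "x \<in> polydisc m s" for x
      using that s0(2) S(3) s polydisc_mono[of s s0 m] polydisc_mono[OF s(3), of _ m]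
      unfolding polydisc_def[of q r] by blast
  qed
qed

lemma near_origin_compose:
  assumes "map_germ m q v" "near_origin q Q"
  shows "near_origin m (\<lambda>x. Q (v x))"
proof -
  obtain r where r: "r > 0" "\<forall>x\<in>polydisc q r. Q x"
    using assms by (auto simp: near_origin_def)
  obtain s where "0 < s" "\<And>x. x \<in> polydisc m s \<Longrightarrow> v x \<in> polydisc q r"
    using map_germ_radius[OF assms(1) r(1)] by metis
  then show ?thesis
    using r by (auto simp: near_origin_def)
qed

lemma holomorphic_germ_compose:
  assumes "map_germ m q v" "holomorphic_germ q u"
  shows "holomorphic_germ m (\<lambda>x. u (v x))"
proof -
  obtain r where r: "r > 0" "hol_on q r u"
    using assms by (auto simp: holomorphic_germ_iff)
  obtain s where "0 < s" "\<And>a. a < q \<Longrightarrow> hol_on m s (\<lambda>x. v x a)" "\<And>x. x \<in> polydisc m s \<Longrightarrow> v x \<in> polydisc q r"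
    using map_germ_radius[OF assms(1) r(1)] by metis
  then show ?thesis
    using hol_on_compose[OF r(2,1)] by (auto simp: holomorphic_germ_iff)
qed

lemma map_germ_compose:
  assumes "map_germ m q v" "map_germ q l u"
  shows "map_germ m l (\<lambda>x. u (v x))"
  using near_origin_compose[OF assms(1) map_germD(1)[OF assms(2)]]
    holomorphic_germ_compose[OF assms(1) map_germD(2)[OF assms(2)]] map_germD(3)[OF assms(1)] map_germD(3)[OF assms(2)]
  by (auto simp: map_germ_def)

lemma partial_compose:
  assumes v: "map_germ m q v" and u: "holomorphic_germ q u" and i: "i < m"
  shows "near_origin m (\<lambda>x. partial i (\<lambda>x. u (v x)) x = (\<Sum>a<q. partial a u (v x) * partial i (\<lambda>x. v x a) x))"
proof -
  obtain r where r: "r > 0" "hol_on q r u"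
    using u by (auto simp: holomorphic_germ_iff)
  have "near_origin m (\<lambda>x. \<forall>a<q. ((\<lambda>t. v (x(i := t)) a) has_field_derivative partial i (\<lambda>x. v x a) x) (at (x i)))"
    using partial_near_derivative[OF map_germD(2)[OF v] i] by (rule near_origin_all_less)
  moreover have "near_origin m (\<lambda>x. v x \<in> polydisc q r)"
    by (rule near_origin_compose[OF v near_origin_polydisc[OF r(1)]])
  moreover have "near_origin m (\<lambda>x. \<forall>i<m. \<forall>\<^sub>F t in nhds (x i). v (x(i := t)) \<in> cspace q)"
    by (rule near_origin_near[OF map_germD(1)[OF v]])
  ultimately have "near_origin m (\<lambda>x. (\<forall>a<q. ((\<lambda>t. v (x(i := t)) a) has_field_derivative partial i (\<lambda>x. v x a) x) (at (x i))) \<and>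
      v x \<in> polydisc q r \<and> (\<forall>i<m. \<forall>\<^sub>F t in nhds (x i). v (x(i := t)) \<in> cspace q))"
    by (intro near_origin_conj)
  then show ?thesis
  proof (rule near_origin_mono, elim conjE)
    fix x
    assume d: "\<forall>a<q. ((\<lambda>t. v (x(i := t)) a) has_field_derivative partial i (\<lambda>x. v x a) x) (at (x i))"
      and x: "v x \<in> polydisc q r" and ev: "\<forall>i<m. \<forall>\<^sub>F t in nhds (x i). v (x(i := t)) \<in> cspace q"
    have "((\<lambda>t. u (v (x(i := t)))) has_field_derivative (\<Sum>a<q. partial a u (v (x(i := x i))) * partial i (\<lambda>x. v x a) x)) (at (x i))"
      using d x ev i by (intro chain_rule[OF r(2,1)]) (auto simp: eventually_nhds_conv_at)
    then show "partial i (\<lambda>x. u (v x)) x = (\<Sum>a<q. partial a u (v x) * partial i (\<lambda>x. v x a) x)"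
      by (intro partial_eqI) simp
  qed
qed

text \<open>
  A two-point version of the lemma of Hadamard: the difference of the values of u at two maps lies in
  the ideal generated by the differences of their components.
\<close>

lemma hadamard:
  assumes v: "map_germ m q v" and w: "map_germ m q w" and u: "holomorphic_germ q u"
  obtains c where "\<And>a. a < q \<Longrightarrow> holomorphic_germ m (c a)"
    "near_origin m (\<lambda>x. u (v x) - u (w x) = (\<Sum>a<q. c a x * (v x a - w x a)))"
proof -
  obtain r where r: "r > 0" "hol_on q r u"
    using u by (auto simp: holomorphic_germ_iff)
  define R where "R = r / 2"
  have R: "0 < R" "R < r" using r by (auto simp: R_def)
  define c where "c a x = dd R u a (mix a (v x) (w x)) (v x a) (w x a)" for a x
  show ?thesis
  proof (rule that[of c])
    have "near_origin m (\<lambda>x. v x \<in> polydisc q R \<and> w x \<in> polydisc q R)"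
      using R by (intro near_origin_conj near_origin_compose[OF v] near_origin_compose[OF w] near_origin_polydisc)
    then show "near_origin m (\<lambda>x. u (v x) - u (w x) = (\<Sum>a<q. c a x * (v x a - w x a)))"
      by (rule near_origin_mono) (simp add: dd_telescope[OF r(2) R] c_def mult.commute)
    fix a assume a: "a < q"
    \<comment> \<open>the coordinate a of this point is that of v, the additional coordinate holds that of w\<close>
    define y where "y x = (mix (Suc a) (v x) (w x))(q := w x a)" for x
    have "near_origin m (\<lambda>x. v x \<in> cspace q \<and> w x \<in> cspace q)"
      using map_germD(1)[OF v] map_germD(1)[OF w] by (rule near_origin_conj)
    then have y1: "near_origin m (\<lambda>x. y x \<in> cspace (Suc q))"
      by (rule near_origin_mono) (use a in \<open>auto simp: y_def mix_def cspace_def\<close>)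
    have "holomorphic_germ m (\<lambda>x. y x k)" if "k < Suc q" for k
      using that a map_germD(2)[OF v] map_germD(2)[OF w]
      by (cases "k = q"; cases "k < Suc a") (auto simp: y_def mix_def)
    then have y: "map_germ m (Suc q) y"
      using y1 map_germD(3)[OF v] map_germD(3)[OF w] by (auto simp: map_germ_def y_def mix_def origin_def)
    have "holomorphic_germ (Suc q) (\<lambda>y. dd R u a (y(q := 0)) (y a) (y q))"
      using hol_on_dd[OF r(2) a R] R by (auto simp: holomorphic_germ_iff)
    then have "holomorphic_germ m (\<lambda>x. dd R u a ((y x)(q := 0)) (y x a) (y x q))"
      by (rule holomorphic_germ_compose[OF y])
    moreover have "near_origin m (\<lambda>x. dd R u a ((y x)(q := 0)) (y x a) (y x q) = c a x)"
      using map_germD(1)[OF w]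
    proof (rule near_origin_mono)
      fix x assume "w x \<in> cspace q"
      then have "(y x)(q := 0, a := z) = (mix a (v x) (w x))(a := z)" for z
        using a by (auto simp: y_def mix_def fun_eq_iff cspace_def)
      then show "dd R u a ((y x)(q := 0)) (y x a) (y x q) = c a x"
        using a by (simp add: c_def dd_def) (simp add: y_def mix_def)
    qed
    ultimately show "holomorphic_germ m (c a)"
      by (rule holomorphic_germ_cong[rotated])
  qed
qed

section \<open>Ideals of germs at the level of functions\<close>

text \<open>
  The functions whose germs lie in the ideal generated by the germs of the members of S. Working with
  representatives allows for differentiation and composition; \<open>genideal_germs\<close> below identifies the
  image in the ring of germs.
\<close>

inductive_set ideal_gen :: "nat \<Rightarrow> (point \<Rightarrow> complex) set \<Rightarrow> (point \<Rightarrow> complex) set"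
  for m S where
  zero: "near_origin m (\<lambda>x. f x = 0) \<Longrightarrow> f \<in> ideal_gen m S"
| step: "g \<in> ideal_gen m S \<Longrightarrow> s \<in> S \<Longrightarrow> holomorphic_germ m a \<Longrightarrow>
    near_origin m (\<lambda>x. f x = g x + a x * s x) \<Longrightarrow> f \<in> ideal_gen m S"

lemma ideal_gen_holomorphic:
  "f \<in> ideal_gen m S \<Longrightarrow> S \<subseteq> Collect (holomorphic_germ m) \<Longrightarrow> holomorphic_germ m f"
proof (induction rule: ideal_gen.induct)
  case (zero f)
  then show ?case
    by (intro holomorphic_germ_cong[of m "\<lambda>_. 0" f] holomorphic_germ_const) (auto elim: near_origin_mono)
next
  case (step g s a f)
  then have "holomorphic_germ m (\<lambda>x. g x + a x * s x)"
    by (intro holomorphic_germ_intros) auto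
  then show ?case
    using step.hyps(4) by (rule_tac holomorphic_germ_cong) (auto elim: near_origin_mono)
qed

lemma ideal_gen_cong:
  assumes "f \<in> ideal_gen m S" "near_origin m (\<lambda>x. g x = f x)"
  shows "g \<in> ideal_gen m S"
  using assms
proof (cases rule: ideal_gen.cases)
  case zero
  show ?thesis
    by (rule ideal_gen.zero, rule near_origin_mono[OF near_origin_conj[OF zero assms(2)]]) auto
next
  case (step h s a)
  show ?thesis
    by (rule ideal_gen.step[OF step(1-3)], rule near_origin_mono[OF near_origin_conj[OF step(4) assms(2)]]) auto
qed

lemma ideal_gen_zero: "(\<lambda>_. 0) \<in> ideal_gen m S"
  by (rule ideal_gen.zero) (simp add: near_origin_triv)

lemma ideal_gen_add:
  assumes "f \<in> ideal_gen m S" "g \<in> ideal_gen m S"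
  shows "(\<lambda>x. f x + g x) \<in> ideal_gen m S"
  using assms(1)
proof (induction rule: ideal_gen.induct)
  case (zero f)
  then show ?case
    by (intro ideal_gen_cong[OF assms(2)]) (auto elim: near_origin_mono)
next
  case (step h s a f)
  show ?case
    by (rule ideal_gen.step[OF step(5,2,3)], rule near_origin_mono[OF step(4)]) auto
qed

lemma ideal_gen_mult:
  assumes "f \<in> ideal_gen m S" "holomorphic_germ m b"
  shows "(\<lambda>x. b x * f x) \<in> ideal_gen m S"
  using assms(1)
proof (induction rule: ideal_gen.induct)
  case (zero f)
  then show ?case
    by (intro ideal_gen.zero) (auto elim: near_origin_mono)
next
  case (step h s a f)
  show ?case
    by (rule ideal_gen.step[OF step(5,2) holomorphic_germ_mult[OF assms(2) step(3)]], rule near_origin_mono[OF step(4)])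
      (auto simp: algebra_simps)
qed

lemma ideal_gen_mult_right:
  "f \<in> ideal_gen m S \<Longrightarrow> holomorphic_germ m b \<Longrightarrow> (\<lambda>x. f x * b x) \<in> ideal_gen m S"
  by (subst mult.commute) (rule ideal_gen_mult)

lemma ideal_gen_diff:
  assumes "f \<in> ideal_gen m S" "g \<in> ideal_gen m S"
  shows "(\<lambda>x. f x - g x) \<in> ideal_gen m S"
  using ideal_gen_add[OF assms(1) ideal_gen_mult[OF assms(2) holomorphic_germ_const[of m "-1"]]] by simp

lemma ideal_gen_sum:
  "(\<And>i. i \<in> A \<Longrightarrow> f i \<in> ideal_gen m S) \<Longrightarrow> (\<lambda>x. \<Sum>i\<in>A. f i x) \<in> ideal_gen m S"
  by (induction A rule: infinite_finite_induct) (auto simp: ideal_gen_zero ideal_gen_add)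

lemma ideal_gen_generator: "s \<in> S \<Longrightarrow> s \<in> ideal_gen m S"
  by (rule ideal_gen.step[OF ideal_gen_zero _ holomorphic_germ_const[of m 1]]) (auto simp: near_origin_triv)

lemma ideal_gen_subset:
  assumes "f \<in> ideal_gen m S" "S \<subseteq> ideal_gen m T"
  shows "f \<in> ideal_gen m T"
  using assms(1)
proof (induction rule: ideal_gen.induct)
  case (step g s a f)
  then have "(\<lambda>x. g x + a x * s x) \<in> ideal_gen m T"
    using assms(2) by (intro ideal_gen_add ideal_gen_mult) auto
  then show ?case
    using step(4) by (rule ideal_gen_cong)
qed (rule ideal_gen.zero)

lemma ideal_gen_mono: "f \<in> ideal_gen m S \<Longrightarrow> S \<subseteq> T \<Longrightarrow> f \<in> ideal_gen m T"
  using ideal_gen_subset[of f m S T] ideal_gen_generator by blast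

lemma ideal_gen_compose:
  assumes v: "map_germ m q v" and f: "f \<in> ideal_gen q S"
    and S: "\<And>s. s \<in> S \<Longrightarrow> (\<lambda>x. s (v x)) \<in> ideal_gen m T"
  shows "(\<lambda>x. f (v x)) \<in> ideal_gen m T"
  using f
proof (induction rule: ideal_gen.induct)
  case (zero f)
  then show ?case
    by (intro ideal_gen.zero near_origin_compose[OF v])
next
  case (step g s a f)
  have "(\<lambda>x. g (v x) + a (v x) * s (v x)) \<in> ideal_gen m T"
    by (intro ideal_gen_add[OF step(5)] ideal_gen_mult[OF S[OF step(2)]] holomorphic_germ_compose[OF v step(3)])
  then show ?case
    using near_origin_compose[OF v step(4)] by (rule ideal_gen_cong)
qed

text \<open>
  The derivative of a member of an ideal lies in the ideal generated by the generators and their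
  derivatives, by the product rule.
\<close>

lemma ideal_gen_partial:
  assumes f: "f \<in> ideal_gen m S" and S: "S \<subseteq> Collect (holomorphic_germ m)" and i: "i < m"
  shows "partial i f \<in> ideal_gen m (S \<union> partial i ` S)"
  using f
proof (induction rule: ideal_gen.induct)
  case (zero f)
  then show ?case
    using partial_cong[OF zero i] by (intro ideal_gen.zero) (simp add: partial_const)
next
  case (step g s a f)
  let ?I = "ideal_gen m (S \<union> partial i ` S)"
  have g: "holomorphic_germ m g" and s: "holomorphic_germ m s"
    using step S ideal_gen_holomorphic[OF step(1) S] by auto
  have "s \<in> ?I" "partial i s \<in> ?I"
    using step(2) by (auto intro!: ideal_gen_generator)
  then have "(\<lambda>x. partial i g x + (partial i a x * s x + a x * partial i s x)) \<in> ?I"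
    using step by (intro ideal_gen_add ideal_gen_mult holomorphic_germ_partial i)
  moreover have "near_origin m (\<lambda>x. partial i f x = partial i g x + (partial i a x * s x + a x * partial i s x))"
    using near_origin_conj[OF near_origin_conj[OF partial_cong[OF step(4) i]
      partial_add[OF g holomorphic_germ_mult[OF step(3) s] i]] partial_mult[OF step(3) s i]]
    by (rule near_origin_mono) auto
  ultimately show ?case
    by (rule ideal_gen_cong)
qed

lemma ideal_gen_coefficients:
  assumes "f \<in> ideal_gen m (set F)"
  obtains c where "\<And>b. b < length F \<Longrightarrow> holomorphic_germ m (c b)"
    "near_origin m (\<lambda>x. f x = (\<Sum>b<length F. c b x * (F ! b) x))"
  using assms
proof (induction arbitrary: thesis rule: ideal_gen.induct)
  case (zero f)
  show ?case
    by (rule zero(2)[of "\<lambda>_ _. 0"]) (use zero(1) in \<open>auto simp: holomorphic_germ_const\<close>)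
next
  case (step g s a f)
  obtain c where c: "\<And>b. b < length F \<Longrightarrow> holomorphic_germ m (c b)"
    "near_origin m (\<lambda>x. g x = (\<Sum>b<length F. c b x * (F ! b) x))"
    using step(5) by blast
  obtain k where k: "k < length F" "s = F ! k"
    using step(2) by (auto simp: in_set_conv_nth)
  show ?case
  proof (rule step(6)[of "\<lambda>b x. c b x + (if b = k then a x else 0)"])
    show "holomorphic_germ m (\<lambda>x. c b x + (if b = k then a x else 0))" if "b < length F" for b
      using c(1)[OF that] step(3) by (cases "b = k") (auto intro: holomorphic_germ_add)
    have *: "(\<Sum>b<length F. (c b x + (if b = k then a x else 0)) * (F ! b) x) =
        (\<Sum>b<length F. c b x * (F ! b) x) + a x * s x" for x
      using k by (simp add: distrib_right sum.distrib if_distrib[of "\<lambda>z. z * _"] cong: if_cong)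
    show "near_origin m (\<lambda>x. f x = (\<Sum>b<length F. (c b x + (if b = k then a x else 0)) * (F ! b) x))"
      using near_origin_conj[OF step(4) c(2)] unfolding * by (rule near_origin_mono) simp
  qed
qed

lemma ideal_gen_compose_diff:
  assumes v: "map_germ m q v" and w: "map_germ m q w" and u: "holomorphic_germ q u"
    and d: "\<And>a. a < q \<Longrightarrow> (\<lambda>x. v x a - w x a) \<in> ideal_gen m S"
  shows "(\<lambda>x. u (v x) - u (w x)) \<in> ideal_gen m S"
proof -
  obtain c where c: "\<And>a. a < q \<Longrightarrow> holomorphic_germ m (c a)"
    "near_origin m (\<lambda>x. u (v x) - u (w x) = (\<Sum>a<q. c a x * (v x a - w x a)))"
    using hadamard[OF v w u] by blast
  have "(\<lambda>x. \<Sum>a<q. c a x * (v x a - w x a)) \<in> ideal_gen m S"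
    using c(1) d by (intro ideal_gen_sum ideal_gen_mult) auto
  then show ?thesis
    using c(2) by (rule ideal_gen_cong)
qed

section \<open>Determinants modulo an ideal and ideals of maximal minors\<close>

lemma permutes_lessI: "p permutes {0..<c::nat} \<Longrightarrow> i < c \<Longrightarrow> p i < c"
  using permutes_in_image[of p "{0..<c}" i] by simp

lemma holomorphic_germ_det:
  assumes "\<And>i j. i < c \<Longrightarrow> j < c \<Longrightarrow> holomorphic_germ m (A i j)"
  shows "holomorphic_germ m (\<lambda>x. Determinant.det (mat c c (\<lambda>(i, j). A i j x)))"
proof -
  have "holomorphic_germ m (\<lambda>x. \<Sum>p | p permutes {0..<c}. signof p * (\<Prod>i = 0..<c. A i (p i) x))"
    using assms by (intro holomorphic_germ_intros) (auto dest: permutes_in_image)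
  moreover have "Determinant.det (mat c c (\<lambda>(i, j). A i j x)) =
      (\<Sum>p | p permutes {0..<c}. signof p * (\<Prod>i = 0..<c. A i (p i) x))" for x
    by (subst det_def'[of _ c]) (auto intro!: sum.cong prod.cong dest: permutes_in_image)
  ultimately show ?thesis by simp
qed

lemma ideal_gen_prod_diff:
  assumes "\<And>i. i \<in> X \<Longrightarrow> holomorphic_germ m (f i)" "\<And>i. i \<in> X \<Longrightarrow> holomorphic_germ m (g i)"
    "\<And>i. i \<in> X \<Longrightarrow> (\<lambda>x. f i x - g i x) \<in> ideal_gen m S"
  shows "(\<lambda>x. (\<Prod>i\<in>X. f i x) - (\<Prod>i\<in>X. g i x)) \<in> ideal_gen m S"
  using assms
proof (induction X rule: infinite_finite_induct)
  case (insert a X)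
  have "(\<lambda>x. (f a x - g a x) * (\<Prod>i\<in>X. f i x) + g a x * ((\<Prod>i\<in>X. f i x) - (\<Prod>i\<in>X. g i x))) \<in> ideal_gen m S"
    using insert by (intro ideal_gen_add ideal_gen_mult ideal_gen_mult_right holomorphic_germ_prod) auto
  then show ?case
    using insert(1,2) by (simp add: algebra_simps)
qed (auto simp: ideal_gen_zero)

lemma ideal_gen_det_diff:
  assumes "\<And>i j. i < c \<Longrightarrow> j < c \<Longrightarrow> holomorphic_germ m (A i j)" "\<And>i j. i < c \<Longrightarrow> j < c \<Longrightarrow> holomorphic_germ m (B i j)"
    "\<And>i j. i < c \<Longrightarrow> j < c \<Longrightarrow> (\<lambda>x. A i j x - B i j x) \<in> ideal_gen m S"
  shows "(\<lambda>x. Determinant.det (mat c c (\<lambda>(i, j). A i j x)) - Determinant.det (mat c c (\<lambda>(i, j). B i j x))) \<in> ideal_gen m S"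
proof -
  have "(\<lambda>x. \<Sum>p | p permutes {0..<c}. signof p * ((\<Prod>i = 0..<c. A i (p i) x) - (\<Prod>i = 0..<c. B i (p i) x))) \<in> ideal_gen m S"
    using assms by (intro ideal_gen_sum ideal_gen_mult ideal_gen_prod_diff holomorphic_germ_const) (auto dest: permutes_in_image)
  moreover have "Determinant.det (mat c c (\<lambda>(i, j). C i j x)) =
      (\<Sum>p | p permutes {0..<c}. signof p * (\<Prod>i = 0..<c. C i (p i) x))" for C :: "nat \<Rightarrow> nat \<Rightarrow> point \<Rightarrow> complex" and x
    by (subst det_def'[of _ c]) (auto intro!: sum.cong prod.cong dest: permutes_in_image)
  ultimately show ?thesis
    by (simp add: right_diff_distrib sum_subtractf)
qed

text \<open>
  Expansion of the determinant of a product of a c by m and an m by c matrix by multilinearity in the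
  columns. Together with \<open>det_columns_cases\<close> this stands in for the Cauchy-Binet formula: only the fact
  that the determinant is a combination of maximal minors is needed, not its exact coefficients.
\<close>

lemma det_mult_expand:
  fixes B S :: "nat \<Rightarrow> nat \<Rightarrow> 'a :: comm_ring_1"
  shows "Determinant.det (mat c c (\<lambda>(i, j). \<Sum>b<m. B i b * S b j)) =
    (\<Sum>f\<in>{..<c} \<rightarrow>\<^sub>E {..<m}. (\<Prod>j<c. S (f j) j) * Determinant.det (mat c c (\<lambda>(i, j). B i (f j))))"
proof -
  have det: "Determinant.det (mat c c (\<lambda>(i, j). C i j)) =
      (\<Sum>p | p permutes {0..<c}. signof p * (\<Prod>j<c. C (p j) j))" for C :: "nat \<Rightarrow> nat \<Rightarrow> 'a"
    by (subst det_col[of _ c]) (auto intro!: sum.cong prod.cong dest: permutes_in_image simp: permutes_lessI)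
  have "Determinant.det (mat c c (\<lambda>(i, j). \<Sum>b<m. B i b * S b j)) =
      (\<Sum>p | p permutes {0..<c}. signof p * (\<Sum>f\<in>{..<c} \<rightarrow>\<^sub>E {..<m}. \<Prod>j<c. B (p j) (f j) * S (f j) j))"
    by (simp add: det prod_sum_PiE)
  also have "\<dots> = (\<Sum>f\<in>{..<c} \<rightarrow>\<^sub>E {..<m}. \<Sum>p | p permutes {0..<c}. signof p * (\<Prod>j<c. B (p j) (f j) * S (f j) j))"
    unfolding sum_distrib_left by (rule sum.swap)
  also have "\<dots> = (\<Sum>f\<in>{..<c} \<rightarrow>\<^sub>E {..<m}. (\<Prod>j<c. S (f j) j) * Determinant.det (mat c c (\<lambda>(i, j). B i (f j))))"
    by (simp add: det sum_distrib_left prod.distrib ac_simps)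
  finally show ?thesis .
qed

lemma bij_betw_pick:
  assumes "finite J"
  shows "bij_betw (pick J) {0..<card J} J"
proof -
  have "pick J ` {0..<card J} = J"
  proof (intro equalityI subsetI)
    fix i assume i: "i \<in> J"
    then have "{a \<in> J. a < i} \<subset> J" by auto
    then have "card {a \<in> J. a < i} < card J"
      using assms by (simp add: psubset_card_mono)
    then show "i \<in> pick J ` {0..<card J}"
      by (intro image_eqI[of _ _ "card {a \<in> J. a < i}"]) (simp_all add: pick_card_in_set[OF i])
  next
    fix i assume "i \<in> pick J ` {0..<card J}"
    then show "i \<in> J"
      using pick_in_set[of _ J] by force
  qed
  moreover from this have "inj_on (pick J) {0..<card J}"
    by (intro eq_card_imp_inj_on) auto
  ultimately show ?thesis
    by (simp add: bij_betw_def)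
qed

lemma submatrix_columns:
  assumes "J \<subseteq> {..<m}" "card J = c"
  shows "submatrix (mat c m (\<lambda>(i, j). B i j)) UNIV J = mat c c (\<lambda>(i, j). B i (pick J j))"
proof -
  have J: "{j. j < m \<and> j \<in> J} = J"
    using assms by auto
  have "pick J j < m" if "j < c" for j
    using assms that pick_in_set[of j J] by auto
  then show ?thesis
    unfolding submatrix_def using assms by (intro eq_matI) (auto simp: J pick_UNIV)
qed

text \<open>
  A determinant made of chosen columns vanishes if a column is repeated. Otherwise it is, up to sign,
  the minor whose columns are listed in increasing order; the sign depends on the choice of columns
  but not on the matrix.
\<close>

lemma det_columns_cases:
  assumes f: "f \<in> {..<c} \<rightarrow> {..<m}"
  obtains J e where "J \<subseteq> {..<m}" "card J = c"
    "\<And>B. Determinant.det (mat c c (\<lambda>(i, j). B i (f j))) = (e :: complex) * Determinant.det (mat c c (\<lambda>(i, j). B i (pick J j)))"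
  | "\<And>B. Determinant.det (mat c c (\<lambda>(i, j). B i (f j))) = (0 :: complex)"
proof (cases "inj_on f {..<c}")
  case False
  then obtain i j where ij: "i < c" "j < c" "i \<noteq> j" "f i = f j"
    by (auto simp: inj_on_def)
  have "Determinant.det (mat c c (\<lambda>(i, j). B i (f j))) = 0" for B :: "nat \<Rightarrow> nat \<Rightarrow> complex"
    by (rule det_identical_columns[of _ c i j]) (use ij in \<open>auto intro!: eq_vecI\<close>)
  then show ?thesis by (rule that(2))
next
  case True
  define J where "J = f ` {..<c}"
  have J: "J \<subseteq> {..<m}" "card J = c" "finite J"
    using f True by (auto simp: J_def card_image)
  \<comment> \<open>the permutation that sorts the chosen columns\<close>
  define s where "s j = (if j < c then inv_into {0..<c} (pick J) (f j) else j)" for j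
  have pick: "bij_betw (pick J) {0..<c} J"
    using bij_betw_pick[OF J(3)] J(2) by simp
  have "bij_betw f {0..<c} J"
    using True by (auto simp: J_def bij_betw_def lessThan_atLeast0)
  from bij_betw_trans[OF this bij_betw_inv_into[OF pick]]
  have "bij_betw s {0..<c} {0..<c}"
    by (rule bij_betw_cong[THEN iffD1, rotated]) (auto simp: s_def)
  then have s: "s permutes {0..<c}"
    by (rule bij_imp_permutes) (auto simp: s_def)
  have fs: "f j = pick J (s j)" if "j < c" for j
    using that bij_betw_inv_into_right[OF pick, of "f j"] by (auto simp: s_def J_def)
  show ?thesis
  proof (rule that(1)[OF J(1,2)])
    fix B :: "nat \<Rightarrow> nat \<Rightarrow> complex"
    let ?A = "mat c c (\<lambda>(i, j). B j (pick J i))"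
    have "Determinant.det (mat c c (\<lambda>(i, j). B i (f j))) = Determinant.det (transpose_mat (mat c c (\<lambda>(i, j). ?A $$ (s i, j))))"
      using s by (intro arg_cong[of _ _ Determinant.det] eq_matI) (auto simp: fs permutes_lessI)
    also have "\<dots> = signof s * Determinant.det ?A"
      using det_permute_rows[OF _ s, of ?A] by (subst det_transpose[of _ c]) auto
    also have "Determinant.det ?A = Determinant.det (transpose_mat ?A)"
      by (rule det_transpose[symmetric, of _ c]) auto
    also have "transpose_mat ?A = mat c c (\<lambda>(i, j). B i (pick J j))"
      by (auto intro!: eq_matI)
    finally show "Determinant.det (mat c c (\<lambda>(i, j). B i (f j))) = signof s * Determinant.det (mat c c (\<lambda>(i, j). B i (pick J j)))" .
  qed
qed

text \<open>
  The maximal minors of a c by m matrix of functions, one for each set J of c columns.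
\<close>

definition minors :: "nat \<Rightarrow> nat \<Rightarrow> (nat \<Rightarrow> nat \<Rightarrow> point \<Rightarrow> complex) \<Rightarrow> (point \<Rightarrow> complex) set" where
  "minors c m B = {\<lambda>y. Determinant.det (mat c c (\<lambda>(i, j). B i (pick J j) y)) | J. J \<subseteq> {..<m} \<and> card J = c}"

lemma minors_holomorphic:
  assumes "\<And>i b. i < c \<Longrightarrow> b < m \<Longrightarrow> holomorphic_germ l (B i b)"
  shows "minors c m B \<subseteq> Collect (holomorphic_germ l)"
proof
  fix g assume "g \<in> minors c m B"
  then obtain J where J: "J \<subseteq> {..<m}" "card J = c" and g: "g = (\<lambda>y. Determinant.det (mat c c (\<lambda>(i, j). B i (pick J j) y)))"
    by (auto simp: minors_def)
  have "pick J j < m" if "j < c" for j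
    using J that pick_in_set[of j J] by auto
  then show "g \<in> Collect (holomorphic_germ l)"
    unfolding g using assms by (auto intro!: holomorphic_germ_det)
qed

lemma det_mult_in_minors:
  assumes S: "\<And>b j. b < m \<Longrightarrow> j < c \<Longrightarrow> holomorphic_germ l (S b j)"
    and B: "minors c m B \<subseteq> ideal_gen l T"
  shows "(\<lambda>x. Determinant.det (mat c c (\<lambda>(i, j). \<Sum>b<m. B i b x * S b j x))) \<in> ideal_gen l T"
  unfolding det_mult_expand
proof (intro ideal_gen_sum ideal_gen_mult)
  fix f assume f: "f \<in> {..<c} \<rightarrow>\<^sub>E {..<m}"
  then have "f \<in> {..<c} \<rightarrow> {..<m}" by auto
  then show "(\<lambda>x. Determinant.det (mat c c (\<lambda>(i, j). B i (f j) x))) \<in> ideal_gen l T"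
  proof (cases rule: det_columns_cases)
    case (1 J e)
    then have "(\<lambda>x. Determinant.det (mat c c (\<lambda>(i, j). B i (pick J j) x))) \<in> ideal_gen l T"
      using B by (auto simp: minors_def)
    then show ?thesis
      using 1(3)[of "\<lambda>i b. B i b _"] by (simp add: ideal_gen_mult holomorphic_germ_const)
  next
    case 2
    then show ?thesis
      using 2[of "\<lambda>i b. B i b _"] by (simp add: ideal_gen_zero)
  qed
  show "holomorphic_germ l (\<lambda>x. \<Prod>j<c. S (f j) j x)"
    using f S by (intro holomorphic_germ_prod) auto
qed

text \<open>
  If \<open>A D = M B\<close> modulo an ideal that contains the maximal minors of B, and the square matrix D is
  invertible at the origin, then the ideal contains the maximal minors of A. Multiplication with the
  adjugate of D gives \<open>det D A = M B adj D\<close> modulo the ideal, and det D is a unit. The factor M need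
  not be invertible, since it is square.
\<close>

lemma minors_transfer:
  assumes A: "\<And>i b. i < c \<Longrightarrow> b < m \<Longrightarrow> holomorphic_germ l (A i b)"
    and B: "\<And>i b. i < c \<Longrightarrow> b < m \<Longrightarrow> holomorphic_germ l (B i b)"
    and M: "\<And>i d. i < c \<Longrightarrow> d < c \<Longrightarrow> holomorphic_germ l (M i d)"
    and D: "\<And>a b. a < m \<Longrightarrow> b < m \<Longrightarrow> holomorphic_germ l (D a b)"
    and D0: "Determinant.det (mat m m (\<lambda>(a, b). D a b origin)) \<noteq> 0"
    and AD: "\<And>i b. i < c \<Longrightarrow> b < m \<Longrightarrow>
      (\<lambda>x. (\<Sum>e<m. A i e x * D e b x) - (\<Sum>d<c. M i d x * B d b x)) \<in> ideal_gen l T"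
    and BT: "minors c m B \<subseteq> ideal_gen l T"
  shows "minors c m A \<subseteq> ideal_gen l T"
proof
  fix g assume "g \<in> minors c m A"
  then obtain J where J: "J \<subseteq> {..<m}" "card J = c" and g: "g = (\<lambda>y. Determinant.det (mat c c (\<lambda>(i, j). A i (pick J j) y)))"
    by (auto simp: minors_def)
  have pick: "pick J j < m" if "j < c" for j
    using J that pick_in_set[of j J] by auto
  define Dm where "Dm x = mat m m (\<lambda>(a, b). D a b x)" for x
  define \<delta> where "\<delta> x = Determinant.det (Dm x)" for x
  define E where "E b e x = adj_mat (Dm x) $$ (b, e)" for b e x
  have Dm: "Dm x \<in> carrier_mat m m" for x by (simp add: Dm_def)
  have \<delta>: "holomorphic_germ l \<delta>"
    unfolding \<delta>_def Dm_def using D by (rule holomorphic_germ_det)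
  have E: "holomorphic_germ l (E b e)" if be: "b < m" "e < m" for b e
  proof -
    have "holomorphic_germ l (\<lambda>x. (-1) ^ (e + b) * Determinant.det (mat (m - 1) (m - 1)
        (\<lambda>(i, j). D (insert_index e i) (insert_index b j) x)))"
      by (intro holomorphic_germ_mult holomorphic_germ_const holomorphic_germ_det D) (use be in \<open>auto simp: insert_index_def\<close>)
    moreover have "E b e x = (-1) ^ (e + b) * Determinant.det (mat (m - 1) (m - 1)
        (\<lambda>(i, j). D (insert_index e i) (insert_index b j) x))" for x
    proof -
      have "mat_delete (Dm x) e b = mat (m - 1) (m - 1) (\<lambda>(i, j). D (insert_index e i) (insert_index b j) x)"
        using be by (intro eq_matI) (auto simp: mat_delete_def Dm_def insert_index_def)
      then show ?thesis
        using be by (simp add: E_def adj_mat_def cofactor_def Dm_def)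
    qed
    ultimately show ?thesis
      by (metis (no_types, lifting) ext)
  qed
  have DE: "(\<Sum>b<m. D e b x * E b e' x) = (if e = e' then \<delta> x else 0)" if "e < m" "e' < m" for e e' x
  proof -
    have "(Dm x * adj_mat (Dm x)) $$ (e, e') = (\<Sum>b<m. D e b x * E b e' x)"
      using that Dm[of x] adj_mat(1)[OF Dm, of x]
      by (auto simp: scalar_prod_def E_def lessThan_atLeast0 Dm_def intro!: sum.cong)
    moreover have "(\<delta> x \<cdot>\<^sub>m 1\<^sub>m m) $$ (e, e') = (if e = e' then \<delta> x else 0)"
      using that by simp
    ultimately show ?thesis
      using adj_mat(2)[OF Dm, of x] by (simp add: \<delta>_def)
  qed
  have row: "(\<lambda>x. \<delta> x * A i e x - (\<Sum>d<c. M i d x * (\<Sum>b<m. B d b x * E b e x))) \<in> ideal_gen l T"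
    if i: "i < c" and e: "e < m" for i e
  proof -
    have "(\<lambda>x. \<Sum>b<m. E b e x * ((\<Sum>e'<m. A i e' x * D e' b x) - (\<Sum>d<c. M i d x * B d b x))) \<in> ideal_gen l T"
      using i e by (intro ideal_gen_sum ideal_gen_mult AD E) auto
    moreover have "(\<Sum>b<m. E b e x * ((\<Sum>e'<m. A i e' x * D e' b x) - (\<Sum>d<c. M i d x * B d b x))) =
        \<delta> x * A i e x - (\<Sum>d<c. M i d x * (\<Sum>b<m. B d b x * E b e x))" for x
    proof -
      have "(\<Sum>b<m. E b e x * (\<Sum>e'<m. A i e' x * D e' b x)) = (\<Sum>e'<m. A i e' x * (\<Sum>b<m. D e' b x * E b e x))"
        unfolding sum_distrib_left by (subst sum.swap) (simp add: ac_simps)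
      also have "\<dots> = (\<Sum>e'<m. if e' = e then \<delta> x * A i e x else 0)"
        using e by (intro sum.cong) (auto simp: DE)
      also have "\<dots> = \<delta> x * A i e x"
        using e by simp
      finally have 1: "(\<Sum>b<m. E b e x * (\<Sum>e'<m. A i e' x * D e' b x)) = \<delta> x * A i e x" .
      have 2: "(\<Sum>b<m. E b e x * (\<Sum>d<c. M i d x * B d b x)) = (\<Sum>d<c. M i d x * (\<Sum>b<m. B d b x * E b e x))"
        unfolding sum_distrib_left by (subst sum.swap) (simp add: ac_simps)
      show ?thesis
        by (simp add: right_diff_distrib sum_subtractf 1 2)
    qed
    ultimately show ?thesis by simp
  qed
  let ?P = "\<lambda>i j x. \<Sum>d<c. M i d x * (\<Sum>b<m. B d b x * E b (pick J j) x)"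
  have "(\<lambda>x. Determinant.det (mat c c (\<lambda>(i, j). M i j x)) *
      Determinant.det (mat c c (\<lambda>(i, j). \<Sum>b<m. B i b x * E b (pick J j) x))) \<in> ideal_gen l T"
    using pick by (intro ideal_gen_mult det_mult_in_minors holomorphic_germ_det M BT E) auto
  moreover have "Determinant.det (mat c c (\<lambda>(i, j). M i j x)) *
      Determinant.det (mat c c (\<lambda>(i, j). \<Sum>b<m. B i b x * E b (pick J j) x)) =
      Determinant.det (mat c c (\<lambda>(i, j). ?P i j x))" for x
    by (subst det_mult[symmetric, of _ c])
       (auto intro!: arg_cong[of _ _ Determinant.det] eq_matI sum.cong simp: scalar_prod_def lessThan_atLeast0)
  ultimately have 1: "(\<lambda>x. Determinant.det (mat c c (\<lambda>(i, j). ?P i j x))) \<in> ideal_gen l T"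
    by simp
  have "(\<lambda>x. Determinant.det (mat c c (\<lambda>(i, j). \<delta> x * A i (pick J j) x)) - Determinant.det (mat c c (\<lambda>(i, j). ?P i j x))) \<in> ideal_gen l T"
    using pick by (intro ideal_gen_det_diff holomorphic_germ_intros \<delta> A M B E row) auto
  from ideal_gen_add[OF this 1]
  have "(\<lambda>x. Determinant.det (mat c c (\<lambda>(i, j). \<delta> x * A i (pick J j) x))) \<in> ideal_gen l T"
    by simp
  moreover have "Determinant.det (mat c c (\<lambda>(i, j). \<delta> x * A i (pick J j) x)) = \<delta> x ^ c * g x" for x
  proof -
    have "mat c c (\<lambda>(i, j). \<delta> x * A i (pick J j) x) = \<delta> x \<cdot>\<^sub>m mat c c (\<lambda>(i, j). A i (pick J j) x)"
      by (intro eq_matI) auto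
    then show ?thesis
      by (simp add: g)
  qed
  ultimately have "(\<lambda>x. \<delta> x ^ c * g x) \<in> ideal_gen l T"
    by simp
  moreover have \<delta>0: "\<delta> origin \<noteq> 0"
    using D0 by (simp add: \<delta>_def Dm_def)
  then have "holomorphic_germ l (\<lambda>x. \<Prod>i<c. inverse (\<delta> x))"
    using \<delta> by (intro holomorphic_germ_prod holomorphic_germ_inverse)
  ultimately have "(\<lambda>x. (\<Prod>i<c. inverse (\<delta> x)) * (\<delta> x ^ c * g x)) \<in> ideal_gen l T"
    by (rule ideal_gen_mult)
  moreover have "near_origin l (\<lambda>x. g x = (\<Prod>i<c. inverse (\<delta> x)) * (\<delta> x ^ c * g x))"
    using holomorphic_germ_nonzero[OF \<delta> \<delta>0] by (rule near_origin_mono) (simp add: power_inverse)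
  ultimately show "g \<in> ideal_gen l T"
    by (rule ideal_gen_cong)
qed

section \<open>Generated ideals and quotients of the ring of germs\<close>

lemma genideal_germs:
  assumes S: "S \<subseteq> Collect (holomorphic_germ m)"
  shows "Idl\<^bsub>germ_ring m\<^esub> (germ m ` S) = germ m ` ideal_gen m S"
proof -
  interpret R: cring "germ_ring m" by (rule cring_germ_ring)
  have carr: "germ m ` ideal_gen m S \<subseteq> carrier (germ_ring m)"
    using ideal_gen_holomorphic[OF _ S] by (auto simp: germ_ring_simps)
  have mult: "germ m f \<otimes>\<^bsub>germ_ring m\<^esub> A \<in> germ m ` ideal_gen m S"
    if "f \<in> ideal_gen m S" "A \<in> carrier (germ_ring m)" for f A
    using that by (auto simp: germ_ring_simps intro!: imageI ideal_gen_mult_right)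
  have ideal: "ideal (germ m ` ideal_gen m S) (germ_ring m)"
  proof (rule idealI[OF R.ring_axioms])
    show "subgroup (germ m ` ideal_gen m S) (add_monoid (germ_ring m))"
    proof (rule R.add.subgroupI)
      show "germ m ` ideal_gen m S \<subseteq> carrier (germ_ring m)" by (rule carr)
      show "germ m ` ideal_gen m S \<noteq> {}"
        using ideal_gen_zero by blast
      fix A assume A: "A \<in> germ m ` ideal_gen m S"
      then obtain f where f: "f \<in> ideal_gen m S" "A = germ m f" by auto
      have "germ m f \<otimes>\<^bsub>germ_ring m\<^esub> (\<ominus>\<^bsub>germ_ring m\<^esub> \<one>\<^bsub>germ_ring m\<^esub>) \<in> germ m ` ideal_gen m S"
        using f by (intro mult) auto
      moreover have "germ m f \<otimes>\<^bsub>germ_ring m\<^esub> (\<ominus>\<^bsub>germ_ring m\<^esub> \<one>\<^bsub>germ_ring m\<^esub>) = \<ominus>\<^bsub>germ_ring m\<^esub> A"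
        using A carr f by (simp add: R.r_minus subsetD)
      ultimately show "\<ominus>\<^bsub>germ_ring m\<^esub> A \<in> germ m ` ideal_gen m S" by simp
    next
      fix A B assume "A \<in> germ m ` ideal_gen m S" "B \<in> germ m ` ideal_gen m S"
      then show "A \<oplus>\<^bsub>germ_ring m\<^esub> B \<in> germ m ` ideal_gen m S"
        by (auto simp: germ_ring_simps intro!: imageI ideal_gen_add)
    qed
    show "x \<otimes>\<^bsub>germ_ring m\<^esub> a \<in> germ m ` ideal_gen m S"
      if "a \<in> germ m ` ideal_gen m S" "x \<in> carrier (germ_ring m)" for a x
      using that mult carr R.m_comm by (metis (no_types, lifting) imageE subsetD)
    show "a \<otimes>\<^bsub>germ_ring m\<^esub> x \<in> germ m ` ideal_gen m S"
      if "a \<in> germ m ` ideal_gen m S" "x \<in> carrier (germ_ring m)" for a x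
      using that mult by auto
  qed
  have S': "germ m ` S \<subseteq> carrier (germ_ring m)"
    using S by (auto simp: germ_ring_simps)
  show ?thesis
  proof
    show "Idl\<^bsub>germ_ring m\<^esub> (germ m ` S) \<subseteq> germ m ` ideal_gen m S"
      by (rule R.genideal_minimal[OF ideal]) (auto intro: ideal_gen_generator)
    interpret J: ideal "Idl\<^bsub>germ_ring m\<^esub> (germ m ` S)" "germ_ring m"
      by (rule R.genideal_ideal[OF S'])
    have "germ m f \<in> Idl\<^bsub>germ_ring m\<^esub> (germ m ` S)" if "f \<in> ideal_gen m S" for f
      using that
    proof (induction rule: ideal_gen.induct)
      case (zero f)
      then have "germ m f = \<zero>\<^bsub>germ_ring m\<^esub>"
        by (simp add: germ_ring_simps germ_eq_iff)
      then show ?case by simp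
    next
      case (step g s a f)
      have "germ m f = germ m g \<oplus>\<^bsub>germ_ring m\<^esub> (germ m a \<otimes>\<^bsub>germ_ring m\<^esub> germ m s)"
        using step(4) by (simp add: germ_ring_simps germ_eq_iff)
      moreover have "germ m s \<in> Idl\<^bsub>germ_ring m\<^esub> (germ m ` S)"
        using step(2) R.genideal_self[OF S'] by auto
      moreover have "germ m a \<in> carrier (germ_ring m)"
        using step(3) by (auto simp: germ_ring_simps)
      ultimately show ?case
        using step(5) by (auto intro!: J.a_closed J.I_l_closed)
    qed
    then show "germ m ` ideal_gen m S \<subseteq> Idl\<^bsub>germ_ring m\<^esub> (germ m ` S)" by auto
  qed
qed

lemma ideal_germs: "S \<subseteq> Collect (holomorphic_germ m) \<Longrightarrow> ideal (germ m ` ideal_gen m S) (germ_ring m)"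
  using cring_germ_ring[of m, THEN cring.axioms(1)] ring.genideal_ideal[of "germ_ring m" "germ m ` S"] genideal_germs[of S m]
  by (auto simp: germ_ring_simps image_mono)

lemma germ_in_ideal_gen_iff: "germ m f \<in> germ m ` ideal_gen m S \<longleftrightarrow> f \<in> ideal_gen m S"
proof
  assume "germ m f \<in> germ m ` ideal_gen m S"
  then obtain g where "g \<in> ideal_gen m S" "near_origin m (\<lambda>x. f x = g x)"
    by (auto simp: germ_eq_iff)
  then show "f \<in> ideal_gen m S" by (rule ideal_gen_cong)
qed auto

lemma add_germ_ideals:
  assumes S: "S \<subseteq> Collect (holomorphic_germ m)" and T: "T \<subseteq> Collect (holomorphic_germ m)"
  shows "germ m ` ideal_gen m S <+>\<^bsub>germ_ring m\<^esub> germ m ` ideal_gen m T = germ m ` ideal_gen m (S \<union> T)"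
proof -
  interpret R: cring "germ_ring m" by (rule cring_germ_ring)
  show ?thesis
  proof
    show "germ m ` ideal_gen m S <+>\<^bsub>germ_ring m\<^esub> germ m ` ideal_gen m T \<subseteq> germ m ` ideal_gen m (S \<union> T)"
      by (auto simp: set_add_def' germ_ring_simps intro!: imageI ideal_gen_add intro: ideal_gen_mono)
    have "ideal (germ m ` ideal_gen m S <+>\<^bsub>germ_ring m\<^esub> germ m ` ideal_gen m T) (germ_ring m)"
      by (rule R.add_ideals[OF ideal_germs[OF S] ideal_germs[OF T]])
    moreover have "germ m ` (S \<union> T) \<subseteq> germ m ` ideal_gen m S <+>\<^bsub>germ_ring m\<^esub> germ m ` ideal_gen m T"
    proof -
      have "germ m ` (S \<union> T) \<subseteq> germ m ` ideal_gen m S \<union> germ m ` ideal_gen m T"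
        using ideal_gen_generator[of _ S m] ideal_gen_generator[of _ T m] by auto
      also have "\<dots> \<subseteq> Idl\<^bsub>germ_ring m\<^esub> (germ m ` ideal_gen m S \<union> germ m ` ideal_gen m T)"
        using ideal.Icarr[OF ideal_germs[OF S]] ideal.Icarr[OF ideal_germs[OF T]]
        by (intro R.genideal_self subsetI) (metis UnE)
      finally show ?thesis
        by (simp only: R.union_genideal[OF ideal_germs[OF S] ideal_germs[OF T]])
    qed
    ultimately have "Idl\<^bsub>germ_ring m\<^esub> (germ m ` (S \<union> T)) \<subseteq> germ m ` ideal_gen m S <+>\<^bsub>germ_ring m\<^esub> germ m ` ideal_gen m T"
      by (rule R.genideal_minimal)
    then show "germ m ` ideal_gen m (S \<union> T) \<subseteq> germ m ` ideal_gen m S <+>\<^bsub>germ_ring m\<^esub> germ m ` ideal_gen m T"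
      using S T by (subst (asm) genideal_germs) auto
  qed
qed

lemma dimension_ring_iso:
  assumes R: "ring R" and S: "ring S" and h: "h \<in> ring_iso R S" and K: "K \<subseteq> carrier R"
    and dim: "ring.dimension R n K E"
  shows "ring.dimension S n (h ` K) (h ` E)"
proof -
  interpret R: ring R by fact
  interpret S: ring S by fact
  have hom: "h \<in> Ring.ring_hom R S" and bij: "bij_betw h (carrier R) (carrier S)"
    using h by (auto simp: ring_iso_def)
  interpret h: ring_hom_ring R S h
    by (rule ring_hom_ringI2) (use R S hom in auto)
  have "E \<subseteq> carrier R \<and> S.dimension n (h ` K) (h ` E)"
    using dim K
  proof (induction n K E rule: R.dimension.induct[consumes 1, case_names zero_dim Suc_dim])
    case (zero_dim K)
    then show ?case
      using S.zero_dim[of "h ` K"] by simp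
  next
    case (Suc_dim v E n K)
    have E: "E \<subseteq> carrier R" and dimE: "S.dimension n (h ` K) (h ` E)"
      using Suc_dim by auto
    have sub: "R.line_extension K v E \<subseteq> carrier R"
      using Suc_dim E by (auto simp: R.line_extension_def set_add_def' r_coset_def subset_iff)
    have "h v \<notin> h ` E"
      using Suc_dim(1,2) E bij by (auto simp: bij_betw_def inj_on_def subset_iff)
    moreover have "h ` R.line_extension K v E = S.line_extension (h ` K) (h v) (h ` E)"
    proof -
      have eq: "h (a \<otimes>\<^bsub>R\<^esub> v \<oplus>\<^bsub>R\<^esub> e) = h a \<otimes>\<^bsub>S\<^esub> h v \<oplus>\<^bsub>S\<^esub> h e" if "a \<in> K" "e \<in> E" for a e
        using that Suc_dim(1,5) E by (simp add: subset_iff)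
      have 1: "R.line_extension K v E = {a \<otimes>\<^bsub>R\<^esub> v \<oplus>\<^bsub>R\<^esub> e | a e. a \<in> K \<and> e \<in> E}"
        by (auto simp: R.line_extension_def set_add_def' r_coset_def)
      have 2: "S.line_extension (h ` K) (h v) (h ` E) = {h a \<otimes>\<^bsub>S\<^esub> h v \<oplus>\<^bsub>S\<^esub> h e | a e. a \<in> K \<and> e \<in> E}"
        by (auto simp: S.line_extension_def set_add_def' r_coset_def)
      show ?thesis
        unfolding 1 2 using eq by (auto simp: image_iff) metis+
    qed
    ultimately show ?case
      using S.Suc_dim[OF _ _ dimE, of "h v"] Suc_dim(1) sub by auto
  qed
  then show ?thesis by simp
qed


lemma germ_minus:
  assumes "holomorphic_germ m f" "holomorphic_germ m g"
  shows "germ m f \<ominus>\<^bsub>germ_ring m\<^esub> germ m g = germ m (\<lambda>x. f x - g x)"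
proof -
  interpret R: cring "germ_ring m" by (rule cring_germ_ring)
  have g: "germ m g \<in> carrier (germ_ring m)" "germ m (\<lambda>x. - 1 * g x) \<in> carrier (germ_ring m)"
    using assms(2) holomorphic_germ_mult[OF holomorphic_germ_const[of m "-1"] assms(2)] by (auto simp: germ_ring_simps)
  have "\<ominus>\<^bsub>germ_ring m\<^esub> germ m g = germ m (\<lambda>x. - 1 * g x)"
    using g by (intro R.minus_equality) (auto simp: germ_ring_simps)
  then show ?thesis
    by (simp add: a_minus_def germ_ring_simps)
qed

lemma map_germ_id: "map_germ m m (\<lambda>x. x)"
  by (auto simp: map_germ_def holomorphic_germ_coord near_origin_def polydisc_def intro: exI[of _ 1])

text \<open>
  The image of the field of constants in the quotient by the ideal I.
\<close>

definition constants_mod :: "nat \<Rightarrow> (point \<Rightarrow> complex) set set \<Rightarrow> (point \<Rightarrow> complex) set set set" where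
  "constants_mod m I = (\<lambda>c. I +>\<^bsub>germ_ring m\<^esub> germ m (\<lambda>_. c)) ` UNIV"

text \<open>
  Let \<open>\<Phi>\<close> and \<open>\<Psi>\<close> be holomorphic maps whose pullbacks exchange two ideals and which are inverse to each
  other modulo these ideals. Then pulling back along \<open>\<Phi>\<close> induces an isomorphism of the quotients that
  respects the constants. The maps themselves need not be invertible, so no inverse function theorem
  is involved.
\<close>

lemma quotient_dimension_transfer:
  fixes m :: nat and S1 S2 :: "(point \<Rightarrow> complex) set"
  defines "I1 \<equiv> germ m ` ideal_gen m S1" and "I2 \<equiv> germ m ` ideal_gen m S2"
  assumes S1: "S1 \<subseteq> Collect (holomorphic_germ m)" and S2: "S2 \<subseteq> Collect (holomorphic_germ m)"
    and \<Phi>: "map_germ m m \<Phi>" and \<Psi>: "map_germ m m \<Psi>"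
    and to1: "\<And>s. s \<in> S2 \<Longrightarrow> (\<lambda>x. s (\<Phi> x)) \<in> ideal_gen m S1"
    and to2: "\<And>s. s \<in> S1 \<Longrightarrow> (\<lambda>x. s (\<Psi> x)) \<in> ideal_gen m S2"
    and id1: "\<And>a. a < m \<Longrightarrow> (\<lambda>x. \<Psi> (\<Phi> x) a - x a) \<in> ideal_gen m S1"
    and id2: "\<And>a. a < m \<Longrightarrow> (\<lambda>x. \<Phi> (\<Psi> x) a - x a) \<in> ideal_gen m S2"
    and dim: "ring.dimension (germ_ring m Quot I2) k (constants_mod m I2) (carrier (germ_ring m Quot I2))"
  shows "ring.dimension (germ_ring m Quot I1) k (constants_mod m I1) (carrier (germ_ring m Quot I1))"
proof -
  let ?R = "germ_ring m" and ?Q1 = "germ_ring m Quot I1" and ?Q2 = "germ_ring m Quot I2"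
  interpret R: cring ?R by (rule cring_germ_ring)
  interpret I1: ideal I1 ?R unfolding I1_def by (rule ideal_germs[OF S1])
  interpret I2: ideal I2 ?R unfolding I2_def by (rule ideal_germs[OF S2])
  have carr: "germ m f \<in> carrier ?R" if "holomorphic_germ m f" for f
    using that by (auto simp: germ_ring_simps)
  define pull where "pull A = (\<Union>f\<in>A. germ m (\<lambda>x. f (\<Phi> x)))" for A
  have pull: "pull (germ m f) = germ m (\<lambda>x. f (\<Phi> x))" for f
  proof -
    have "germ m (\<lambda>x. g (\<Phi> x)) = germ m (\<lambda>x. f (\<Phi> x))" if "g \<in> germ m f" for g
      unfolding germ_eq_iff using that by (intro near_origin_compose[OF \<Phi>]) (simp add: germ_def)
    moreover have "germ m f \<noteq> {}"
      using germ_self[of f m] by (simp only: ex_in_conv[symmetric]) (rule exI)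
    ultimately show ?thesis
      unfolding pull_def by (rule SUP_eq_const[rotated])
  qed
  define h where "h A = I1 +>\<^bsub>?R\<^esub> pull A" for A
  have "pull \<in> Ring.ring_hom ?R ?R"
    by (rule ring_hom_memI) (auto simp: germ_ring_simps pull intro!: imageI holomorphic_germ_compose[OF \<Phi>])
  from ring_hom_trans[OF this I1.rcos_ring_hom]
  have "h \<in> Ring.ring_hom ?R ?Q1"
    by (simp add: h_def[abs_def] comp_def)
  then interpret h: ring_hom_ring ?R ?Q1 h
    by (intro ring_hom_ringI2 R.ring_axioms I1.quotient_is_ring)
  have "h ` carrier ?R = carrier ?Q1"
  proof
    show "carrier ?Q1 \<subseteq> h ` carrier ?R"
    proof
      fix X assume "X \<in> carrier ?Q1"
      then obtain f where f: "holomorphic_germ m f" and X: "X = I1 +>\<^bsub>?R\<^esub> germ m f"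
        by (auto simp: FactRing_def A_RCOSETS_def' germ_ring_simps)
      let ?g = "\<lambda>x. f (\<Psi> x)"
      have g: "holomorphic_germ m ?g" "holomorphic_germ m (\<lambda>x. ?g (\<Phi> x))"
        using f by (auto intro: holomorphic_germ_compose[OF \<Phi>] holomorphic_germ_compose[OF \<Psi>])
      have "(\<lambda>x. ?g (\<Phi> x) - f x) \<in> ideal_gen m S1"
        using ideal_gen_compose_diff[OF map_germ_compose[OF \<Phi> \<Psi>] map_germ_id f] id1 by simp
      then have "germ m (\<lambda>x. ?g (\<Phi> x)) \<ominus>\<^bsub>?R\<^esub> germ m f \<in> I1"
        using f g by (simp add: germ_minus I1_def)
      then have "h (germ m ?g) = X"
        using R.quotient_eq_iff_same_a_r_cos[OF I1.ideal_axioms carr carr] f g by (simp add: h_def pull X)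
      then show "X \<in> h ` carrier ?R"
        using carr g by blast
    qed
  qed auto
  then have iso: "(\<lambda>X. the_elem (h ` X)) \<in> ring_iso (?R Quot (a_kernel ?R ?Q1 h)) ?Q1"
    by (rule h.FactRing_iso_set)
  have zero: "h (germ m f) = \<zero>\<^bsub>?Q1\<^esub> \<longleftrightarrow> (\<lambda>x. f (\<Phi> x)) \<in> ideal_gen m S1" if f: "holomorphic_germ m f" for f
  proof -
    have f': "holomorphic_germ m (\<lambda>x. f (\<Phi> x))"
      using f by (rule holomorphic_germ_compose[OF \<Phi>])
    have "\<zero>\<^bsub>?Q1\<^esub> = I1 +>\<^bsub>?R\<^esub> germ m (\<lambda>_. 0)"
      using I1.a_rcos_const[of "germ m (\<lambda>_. 0)"] I1.zero_closed by (simp add: FactRing_def germ_ring_simps)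
    then have "h (germ m f) = \<zero>\<^bsub>?Q1\<^esub> \<longleftrightarrow> germ m (\<lambda>x. f (\<Phi> x)) \<ominus>\<^bsub>?R\<^esub> germ m (\<lambda>_. 0) \<in> I1"
      using R.quotient_eq_iff_same_a_r_cos[OF I1.ideal_axioms carr carr] f' holomorphic_germ_const[of m 0]
      by (simp add: h_def pull)
    then show ?thesis
      using f' holomorphic_germ_const[of m 0] by (simp add: germ_minus I1_def germ_in_ideal_gen_iff)
  qed
  have ker: "a_kernel ?R ?Q1 h = I2"
  proof
    show "I2 \<subseteq> a_kernel ?R ?Q1 h"
    proof
      fix A assume "A \<in> I2"
      then obtain f where f: "f \<in> ideal_gen m S2" "A = germ m f"
        unfolding I2_def by blast
      have hol: "holomorphic_germ m f"
        using f(1) S2 by (rule ideal_gen_holomorphic)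
      have "(\<lambda>x. f (\<Phi> x)) \<in> ideal_gen m S1"
        by (rule ideal_gen_compose[OF \<Phi> f(1) to1])
      then show "A \<in> a_kernel ?R ?Q1 h"
        unfolding a_kernel_def' f(2) using zero[OF hol] carr[OF hol] by blast
    qed
    show "a_kernel ?R ?Q1 h \<subseteq> I2"
    proof
      fix A assume "A \<in> a_kernel ?R ?Q1 h"
      then obtain f where f: "holomorphic_germ m f" "A = germ m f" and f0: "(\<lambda>x. f (\<Phi> x)) \<in> ideal_gen m S1"
        using zero unfolding a_kernel_def' germ_ring_simps(5) by blast
      have "(\<lambda>x. f (\<Phi> (\<Psi> x))) \<in> ideal_gen m S2"
        by (rule ideal_gen_compose[OF \<Psi> f0 to2])
      moreover have "(\<lambda>x. f (\<Phi> (\<Psi> x)) - f x) \<in> ideal_gen m S2"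
        using ideal_gen_compose_diff[OF map_germ_compose[OF \<Psi> \<Phi>] map_germ_id f(1)] id2 by simp
      ultimately have "f \<in> ideal_gen m S2"
        using ideal_gen_diff by fastforce
      then show "A \<in> I2"
        unfolding I2_def f(2) by (rule imageI)
    qed
  qed
  let ?k = "\<lambda>X. the_elem (h ` X)"
  have iso: "?k \<in> ring_iso ?Q2 ?Q1"
    using iso unfolding ker .
  have const: "?k (I2 +>\<^bsub>?R\<^esub> germ m (\<lambda>_. c)) = I1 +>\<^bsub>?R\<^esub> germ m (\<lambda>_. c)" for c
  proof -
    let ?c = "germ m (\<lambda>_. c)"
    have c: "?c \<in> carrier ?R"
      by (intro carr holomorphic_germ_const)
    then have coset: "I2 +>\<^bsub>?R\<^esub> ?c \<in> carrier (?R Quot (a_kernel ?R ?Q1 h))"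
      unfolding ker by (auto simp: FactRing_def A_RCOSETS_def')
    obtain y where y: "h ` (I2 +>\<^bsub>?R\<^esub> ?c) = {y}"
      using h.the_elem_wf[OF coset] by blast
    have "?c \<in> I2 +>\<^bsub>?R\<^esub> ?c"
      using c by (rule I2.a_rcos_self)
    then have "h ?c = y"
      using y by blast
    moreover have "h ?c = I1 +>\<^bsub>?R\<^esub> ?c"
      by (simp add: h_def pull)
    ultimately show ?thesis
      unfolding y by simp
  qed
  have "constants_mod m I2 \<subseteq> carrier ?Q2"
    using carr[OF holomorphic_germ_const] by (auto simp: constants_mod_def FactRing_def A_RCOSETS_def')
  from dimension_ring_iso[OF I2.quotient_is_ring I1.quotient_is_ring iso this dim]
  have "ring.dimension ?Q1 k (?k ` constants_mod m I2) (?k ` carrier ?Q2)" .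
  moreover have "?k ` constants_mod m I2 = constants_mod m I1"
    by (auto simp: constants_mod_def image_image const)
  moreover have "?k ` carrier ?Q2 = carrier ?Q1"
    using iso by (simp add: ring_iso_def bij_betw_def)
  ultimately show ?thesis by simp
qed

lemma quotient_dim_eq:
  assumes S1: "S1 \<subseteq> Collect (holomorphic_germ m)" and S2: "S2 \<subseteq> Collect (holomorphic_germ m)"
    and \<Phi>: "map_germ m m \<Phi>" and \<Psi>: "map_germ m m \<Psi>"
    and to1: "\<And>s. s \<in> S2 \<Longrightarrow> (\<lambda>x. s (\<Phi> x)) \<in> ideal_gen m S1"
    and to2: "\<And>s. s \<in> S1 \<Longrightarrow> (\<lambda>x. s (\<Psi> x)) \<in> ideal_gen m S2"
    and id1: "\<And>a. a < m \<Longrightarrow> (\<lambda>x. \<Psi> (\<Phi> x) a - x a) \<in> ideal_gen m S1"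
    and id2: "\<And>a. a < m \<Longrightarrow> (\<lambda>x. \<Phi> (\<Psi> x) a - x a) \<in> ideal_gen m S2"
  shows "quotient_dim m (germ m ` ideal_gen m S1) = quotient_dim m (germ m ` ideal_gen m S2)"
proof -
  let ?dim = "\<lambda>I k. ring.dimension (germ_ring m Quot I) k (constants_mod m I) (carrier (germ_ring m Quot I))"
  have quot: "quotient_dim m I = (if \<exists>k. ?dim I k then enat (THE k. ?dim I k) else \<infinity>)"
    if "ideal I (germ_ring m)" for I
    using ideal.quotient_is_ring[OF that]
    by (simp add: quotient_dim_def Let_def constants_mod_def ring.finite_dimension_def ring.dim_def)
  have "?dim (germ m ` ideal_gen m S1) k \<longleftrightarrow> ?dim (germ m ` ideal_gen m S2) k" for k
    using quotient_dimension_transfer[OF S1 S2 \<Phi> \<Psi> to1 to2 id1 id2]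
      quotient_dimension_transfer[OF S2 S1 \<Psi> \<Phi> to2 to1 id2 id1] by blast
  then show ?thesis
    by (simp add: quot[OF ideal_germs[OF S1]] quot[OF ideal_germs[OF S2]])
qed

text \<open>
  The pullback ideal is generated by the components. If they all vanish at the origin, this is the
  lemma of Hadamard; if one of them does not, it is a unit, and both ideals are the unit ideal.
\<close>

lemma pullback_ideal_eq:
  assumes F: "set F \<subseteq> Collect (holomorphic_germ m)"
  shows "pullback_ideal m F = germ m ` ideal_gen m (set F)"
proof -
  interpret R: cring "germ_ring m" by (rule cring_germ_ring)
  let ?c = "length F"
  let ?G = "{germ m (u \<circ> eval_map F) | u. germ ?c u \<in> max_ideal ?c \<and> holomorphic_germ m (u \<circ> eval_map F)}"
  have G: "?G \<subseteq> carrier (germ_ring m)"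
    by (auto simp: germ_ring_simps)
  have "?G \<subseteq> germ m ` ideal_gen m (set F)"
  proof safe
    fix u assume u: "germ ?c u \<in> max_ideal ?c" and hol: "holomorphic_germ m (u \<circ> eval_map F)"
    have "u \<circ> eval_map F \<in> ideal_gen m (set F)"
    proof (cases "\<forall>a<?c. (F ! a) origin = 0")
      case True
      obtain u' where u': "holomorphic_germ ?c u'" "u' origin = 0" "near_origin ?c (\<lambda>x. u x = u' x)"
        using u by (auto simp: max_ideal_def germ_eq_iff)
      have "holomorphic_germ m (\<lambda>x. eval_map F x a)" if "a < ?c" for a
        using that subsetD[OF F nth_mem[OF that]] by (simp add: eval_map_def)
      moreover have "eval_map F x \<in> cspace ?c" for x
        by (auto simp: eval_map_def cspace_def)
      moreover have "eval_map F origin = origin"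
        using True by (auto simp: eval_map_def origin_def)
      ultimately have ev: "map_germ m ?c (eval_map F)"
        by (simp add: map_germ_def near_origin_triv)
      have "map_germ m ?c (\<lambda>_. origin)"
        by (auto simp: map_germ_def near_origin_triv holomorphic_germ_const cspace_def origin_def)
      then have "(\<lambda>x. u' (eval_map F x) - u' origin) \<in> ideal_gen m (set F)"
      proof (rule ideal_gen_compose_diff[OF ev _ u'(1)])
        fix a assume "a < ?c"
        then show "(\<lambda>x. eval_map F x a - origin a) \<in> ideal_gen m (set F)"
          by (simp add: eval_map_def origin_def ideal_gen_generator)
      qed
      then show ?thesis
        using near_origin_compose[OF ev u'(3)] by (auto simp: u'(2) elim: ideal_gen_cong)
    next
      case False
      then obtain a where a: "a < ?c" "(F ! a) origin \<noteq> 0" by auto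
      then have Fa: "F ! a \<in> set F" "holomorphic_germ m (F ! a)"
        using subsetD[OF F nth_mem[OF a(1)]] by auto
      have "(\<lambda>x. ((u \<circ> eval_map F) x * inverse ((F ! a) x)) * (F ! a) x) \<in> ideal_gen m (set F)"
        by (rule ideal_gen_mult[OF ideal_gen_generator[OF Fa(1)] holomorphic_germ_mult[OF hol holomorphic_germ_inverse[OF Fa(2) a(2)]]])
      moreover have "near_origin m (\<lambda>x. (u \<circ> eval_map F) x = ((u \<circ> eval_map F) x * inverse ((F ! a) x)) * (F ! a) x)"
        using holomorphic_germ_nonzero[OF Fa(2) a(2)] by (rule near_origin_mono) simp
      ultimately show ?thesis
        by (rule ideal_gen_cong)
    qed
    then show "germ m (u \<circ> eval_map F) \<in> germ m ` ideal_gen m (set F)" by simp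
  qed
  then have "Idl\<^bsub>germ_ring m\<^esub> ?G \<subseteq> germ m ` ideal_gen m (set F)"
    by (rule R.genideal_minimal[OF ideal_germs[OF F]])
  moreover have "germ m ` set F \<subseteq> ?G"
  proof safe
    fix f assume "f \<in> set F"
    then obtain a where a: "a < ?c" "f = F ! a" by (auto simp: in_set_conv_nth)
    have "(\<lambda>y. y a) \<circ> eval_map F = f"
      using a by (auto simp: eval_map_def)
    moreover have "germ ?c (\<lambda>y. y a) \<in> max_ideal ?c"
      using holomorphic_germ_coord[OF a(1)] by (auto simp: max_ideal_def origin_def)
    ultimately show "\<exists>u. germ m f = germ m (u \<circ> eval_map F) \<and> germ ?c u \<in> max_ideal ?c \<and> holomorphic_germ m (u \<circ> eval_map F)"
      using F \<open>f \<in> set F\<close> by (intro exI[of _ "\<lambda>y. y a"]) auto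
  qed
  then have "Idl\<^bsub>germ_ring m\<^esub> (germ m ` set F) \<subseteq> Idl\<^bsub>germ_ring m\<^esub> ?G"
    using R.genideal_self[OF G] by (intro R.genideal_minimal R.genideal_ideal[OF G]) blast
  ultimately show ?thesis
    unfolding pullback_ideal_def using genideal_germs[OF F] by blast
qed

text \<open>
  The entries of the Jacobian matrix as functions, indexed by component and variable.
\<close>

definition gradients :: "(point \<Rightarrow> complex) list \<Rightarrow> nat \<Rightarrow> nat \<Rightarrow> point \<Rightarrow> complex" where
  "gradients F = (\<lambda>i b. partial b (F ! i))"

lemma gradients_holomorphic:
  "set F \<subseteq> Collect (holomorphic_germ m) \<Longrightarrow> i < length F \<Longrightarrow> b < m \<Longrightarrow> holomorphic_germ m (gradients F i b)"
  unfolding gradients_def by (rule holomorphic_germ_partial) (use nth_mem in blast)+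

lemma minors_ideal_eq:
  assumes F: "set F \<subseteq> Collect (holomorphic_germ m)"
  shows "minors_ideal m F = germ m ` ideal_gen m (minors (length F) m (gradients F))"
proof -
  have "{germ m (\<lambda>y. Determinant.det (submatrix (jacobian m F y) UNIV J)) | J. J \<subseteq> {..<m} \<and> card J = length F} =
      germ m ` minors (length F) m (gradients F)"
    unfolding minors_def jacobian_def gradients_def setcompr_eq_image image_image
    by (rule image_cong) (simp_all add: submatrix_columns)
  then show ?thesis
    unfolding minors_ideal_def
    using genideal_germs[OF minors_holomorphic[of "length F" m m "gradients F"]] gradients_holomorphic[OF F] by simp
qed

section \<open>The multiple point equations\<close>

lemma sum_lessThan_last: "1 \<le> n \<Longrightarrow> (\<Sum>a<n. g a) = (\<Sum>a<n - 1. g a) + g (n - 1)" for g :: "nat \<Rightarrow> complex"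
  by (cases n) auto

lemma map_germ_proj_part:
  assumes "1 \<le> n" "i < l"
  shows "map_germ (n - 1 + l) n (proj_part n i)"
  unfolding map_germ_def
proof (intro conjI allI impI)
  show "near_origin (n - 1 + l) (\<lambda>x. proj_part n i x \<in> cspace n)"
    using assms by (intro near_origin_triv) (auto simp: proj_part_def cspace_def)
  show "holomorphic_germ (n - 1 + l) (\<lambda>x. proj_part n i x j)" if "j < n" for j
  proof (cases "j < n - 1")
    case True
    then show ?thesis
      using assms by (auto simp: proj_part_def intro!: holomorphic_germ_coord)
  next
    case False
    then have "j = n - 1" using that by simp
    moreover have "n - 1 + i < n - 1 + l" using assms by simp
    ultimately show ?thesis
      by (simp add: proj_part_def holomorphic_germ_coord del: add_diff_assoc2 diff_add_assoc2)
  qed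
  show "proj_part n i origin = origin"
    by (auto simp: proj_part_def origin_def)
qed

lemma h_comp_holomorphic:
  "map_germ n p f \<Longrightarrow> 1 \<le> n \<Longrightarrow> n < p \<Longrightarrow> j < p - n + 1 \<Longrightarrow> holomorphic_germ n (h_comp n f j)"
  unfolding h_comp_def by (rule map_germD(2)) auto

lemma holomorphic_germ_partial_funpow:
  "holomorphic_germ m f \<Longrightarrow> i < m \<Longrightarrow> holomorphic_germ m ((partial i ^^ s) f)"
  by (induction s) (auto intro: holomorphic_germ_partial)

lemma set_G_map:
  "set (G_map n p f P) = {\<lambda>y. h_comp n f j (proj_part n 0 y) - h_comp n f j (proj_part n i y) | i j.
     1 \<le> i \<and> i < length P \<and> j < p - n + 1}"
proof -
  have "set (concat (map (\<lambda>i. map (g i) js) is)) = {g i j | i j. i \<in> set is \<and> j \<in> set js}"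
    for g :: "nat \<Rightarrow> nat \<Rightarrow> point \<Rightarrow> complex" and "is" js by auto
  from this[of "\<lambda>i j y. h_comp n f j (proj_part n 0 y) - h_comp n f j (proj_part n i y)"]
  show ?thesis
    by (simp only: G_map_def set_upt atLeastLessThan_iff) auto
qed

lemma set_H_map:
  "set (H_map n p f P) = {\<lambda>y. (partial (n - 1) ^^ s) (h_comp n f j) (proj_part n i y) | i s j.
     i < length P \<and> 1 \<le> s \<and> s < P ! i \<and> j < p - n + 1}"
proof -
  have "set (concat (map (\<lambda>i. concat (map (\<lambda>s. map (g i s) js) (ss i))) is)) =
      {g i s j | i s j. i \<in> set is \<and> s \<in> set (ss i) \<and> j \<in> set js}"
    for g :: "nat \<Rightarrow> nat \<Rightarrow> nat \<Rightarrow> point \<Rightarrow> complex" and "is" js ss by auto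
  from this[of "\<lambda>i s j y. (partial (n - 1) ^^ s) (h_comp n f j) (proj_part n i y)"]
  show ?thesis
    by (simp only: H_map_def comp_def set_upt atLeastLessThan_iff) auto
qed

lemma F_map_holomorphic:
  assumes "map_germ n p f" "1 \<le> n" "n < p" "P \<noteq> []"
  shows "set (F_map n p f P) \<subseteq> Collect (holomorphic_germ (n - 1 + length P))"
proof -
  have "0 < length P" "n - 1 < n"
    using assms by auto
  then show ?thesis
    unfolding F_map_def set_append set_G_map set_H_map
    by (intro Un_least subsetI)
      (elim CollectE exE conjE, simp only: mem_Collect_eq, intro holomorphic_germ_diff
        holomorphic_germ_compose[OF map_germ_proj_part[OF assms(2)]] holomorphic_germ_partial_funpow
        h_comp_holomorphic[OF assms(1-3)], assumption+)+
qed

text \<open>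
  A self-map \<open>\<theta> = (X, Z)\<close> of the source acts on tuples by
  \<open>(x, z\<^sub>0, ..., z\<^sub>l\<^sub>-\<^sub>1) \<mapsto> (X(x, z\<^sub>0), Z(x, z\<^sub>0), ..., Z(x, z\<^sub>l\<^sub>-\<^sub>1))\<close>. The first block is taken from the
  part 0; modulo the equations of the multiple point space every other part gives the same block.
\<close>

definition part_lift :: "nat \<Rightarrow> nat \<Rightarrow> (point \<Rightarrow> point) \<Rightarrow> point \<Rightarrow> point" where
  "part_lift n l \<theta> = (\<lambda>y a. if a < n - 1 then \<theta> (proj_part n 0 y) a
     else if a < n - 1 + l then \<theta> (proj_part n (a - (n - 1)) y) (n - 1) else 0)"

lemma map_germ_part_lift:
  assumes \<theta>: "map_germ n n \<theta>" and n: "1 \<le> n" and l: "1 \<le> l"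
  shows "map_germ (n - 1 + l) (n - 1 + l) (part_lift n l \<theta>)"
  unfolding map_germ_def
proof (intro conjI allI impI)
  show "near_origin (n - 1 + l) (\<lambda>x. part_lift n l \<theta> x \<in> cspace (n - 1 + l))"
    by (intro near_origin_triv) (auto simp: part_lift_def cspace_def)
  have hol: "holomorphic_germ (n - 1 + l) (\<lambda>y. \<theta> (proj_part n i y) a)" if "i < l" "a < n" for i a
    using holomorphic_germ_compose[OF map_germ_proj_part[OF n that(1)] map_germD(2)[OF \<theta> that(2)]] .
  show "holomorphic_germ (n - 1 + l) (\<lambda>y. part_lift n l \<theta> y a)" if "a < n - 1 + l" for a
  proof (cases "a < n - 1")
    case True
    then show ?thesis
      using hol[of 0 a] l by (simp add: part_lift_def)
  next
    case False
    then have "a - (n - 1) < l" using that by simp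
    then show ?thesis
      using False that hol[of "a - (n - 1)" "n - 1"] n by (simp only: part_lift_def if_True if_False)
  qed
  have "proj_part n i origin = origin" for i
    by (auto simp: proj_part_def origin_def)
  then show "part_lift n l \<theta> origin = origin"
    using map_germD(3)[OF \<theta>] by (auto simp: part_lift_def origin_def)
qed

lemma proj_part_lift:
  assumes "1 \<le> n" "i < l" "a < n"
  shows "proj_part n i (part_lift n l \<theta> y) a = (if a < n - 1 then \<theta> (proj_part n 0 y) a else \<theta> (proj_part n i y) a)"
  using assms by (auto simp: proj_part_def part_lift_def)

text \<open>
  A germ in the normal form \<open>(x, z) \<mapsto> (x, h(x, z))\<close> with vanishing first derivatives of h in the
  direction z at the origin, together with the number and sizes of the parts.
\<close>

locale multiple_points =
  fixes n p :: nat and P :: "nat list" and f :: "point \<Rightarrow> point"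
  assumes n: "1 \<le> n" and np: "n < p" and P: "P \<noteq> []"
    and f: "map_germ n p f" and lin: "in_linear_form n f"
    and crit: "\<And>j. j < p - n + 1 \<Longrightarrow> partial (n - 1) (h_comp n f j) origin = 0"
begin

abbreviation "m \<equiv> n - 1 + length P"
abbreviation "I \<equiv> ideal_gen m (set (F_map n p f P))"

text \<open>
  The ideal generated by the first s derivatives of h in the direction z. Differentiation in this
  direction maps the ideal with index s into the next one.
\<close>

definition K :: "nat \<Rightarrow> (point \<Rightarrow> complex) set" where
  "K s = ideal_gen n {(partial (n - 1) ^^ t) (h_comp n f j) | t j. 1 \<le> t \<and> t \<le> s \<and> j < p - n + 1}"

lemma h_hol: "j < p - n + 1 \<Longrightarrow> holomorphic_germ n (h_comp n f j)"
  by (rule h_comp_holomorphic[OF f n np])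

lemma K_generators_holomorphic:
  "{(partial (n - 1) ^^ t) (h_comp n f j) | t j. 1 \<le> t \<and> t \<le> s \<and> j < p - n + 1} \<subseteq> Collect (holomorphic_germ n)"
  using n by (auto intro!: holomorphic_germ_partial_funpow h_hol)

lemma K_mono: "g \<in> K s \<Longrightarrow> s \<le> t \<Longrightarrow> g \<in> K t"
  unfolding K_def by (erule ideal_gen_mono) force

lemma K_partial:
  assumes "g \<in> K s"
  shows "partial (n - 1) g \<in> K (Suc s)"
proof -
  let ?S = "\<lambda>s. {(partial (n - 1) ^^ t) (h_comp n f j) | t j. 1 \<le> t \<and> t \<le> s \<and> j < p - n + 1}"
  have "partial (n - 1) g \<in> ideal_gen n (?S s \<union> partial (n - 1) ` ?S s)"
    using assms n unfolding K_def by (intro ideal_gen_partial K_generators_holomorphic) auto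
  moreover have "?S s \<union> partial (n - 1) ` ?S s \<subseteq> ?S (Suc s)"
  proof -
    have "partial (n - 1) ((partial (n - 1) ^^ t) (h_comp n f j)) \<in> ?S (Suc s)"
      if "1 \<le> t" "t \<le> s" "j < p - n + 1" for t j
      using that by (intro CollectI exI[of _ "Suc t"] exI[of _ j]) auto
    then show ?thesis by fastforce
  qed
  ultimately show ?thesis
    unfolding K_def by (rule ideal_gen_mono)
qed

lemma K1_origin: "g \<in> K 1 \<Longrightarrow> g origin = 0"
  unfolding K_def
proof (induction rule: ideal_gen.induct)
  case (zero f)
  then show ?case by (rule near_origin_at_origin)
next
  case (step g s a f')
  then obtain t j where "1 \<le> t" "t \<le> 1" "j < p - n + 1" "s = (partial (n - 1) ^^ t) (h_comp n f j)"
    by blast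
  then have "s origin = 0"
    using crit by (cases t) auto
  then show ?case
    using near_origin_at_origin[OF step(4)] step(5) by simp
qed

lemma K_compose:
  assumes g: "g \<in> K s" and i: "i < length P" and s: "s < P ! i"
  shows "(\<lambda>y. g (proj_part n i y)) \<in> I"
proof (rule ideal_gen_compose[OF map_germ_proj_part[OF n i] g[unfolded K_def]])
  fix u assume "u \<in> {(partial (n - 1) ^^ t) (h_comp n f j) | t j. 1 \<le> t \<and> t \<le> s \<and> j < p - n + 1}"
  then obtain t j where tj: "1 \<le> t" "t \<le> s" "j < p - n + 1" "u = (partial (n - 1) ^^ t) (h_comp n f j)"
    by blast
  have "(\<lambda>y. u (proj_part n i y)) \<in> set (F_map n p f P)"
    unfolding F_map_def set_append set_H_map tj(4)
    by (rule UnI2, rule CollectI, intro exI[of _ i] exI[of _ t] exI[of _ j]) (use tj i s in auto)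
  then show "(\<lambda>y. u (proj_part n i y)) \<in> I"
    by (rule ideal_gen_generator)
qed

text \<open>
  Modulo the equations, the points belonging to the different parts have the same image under f.
\<close>

lemma fibre:
  assumes a: "a < p" and i: "i < length P"
  shows "(\<lambda>y. f (proj_part n i y) a - f (proj_part n 0 y) a) \<in> I"
proof (cases "a < n - 1")
  case True
  have 0: "0 < length P" using P by simp
  have "near_origin m (\<lambda>y. (\<forall>a<n-1. f (proj_part n i y) a = proj_part n i y a) \<and>
      (\<forall>a<n-1. f (proj_part n 0 y) a = proj_part n 0 y a))"
    using lin unfolding in_linear_form_def
    by (intro near_origin_conj near_origin_compose[OF map_germ_proj_part[OF n]] i 0)
  then show ?thesis
    by (intro ideal_gen.zero) (rule near_origin_mono, assumption, use True in \<open>simp add: proj_part_def\<close>)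
next
  case False
  define j where "j = a - (n - 1)"
  have j: "a = n - 1 + j" "j < p - n + 1"
    using False a np by (auto simp: j_def)
  show ?thesis
  proof (cases "i = 0")
    case True
    then show ?thesis by (simp add: ideal_gen_zero)
  next
    case False
    have "(\<lambda>y. h_comp n f j (proj_part n 0 y) - h_comp n f j (proj_part n i y)) \<in> set (F_map n p f P)"
      unfolding F_map_def set_append set_G_map
      by (rule UnI1, rule CollectI, intro exI[of _ i] exI[of _ j]) (use False i j in auto)
    from ideal_gen_mult[OF ideal_gen_generator[OF this] holomorphic_germ_const[of m "-1"]]
    show ?thesis
      by (simp add: h_comp_def j(1))
  qed
qed

lemma fibre_compose:
  assumes u: "holomorphic_germ p u" and i: "i < length P"
  shows "(\<lambda>y. u (f (proj_part n i y)) - u (f (proj_part n 0 y))) \<in> I"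
proof -
  have "0 < length P" using P by simp
  then show ?thesis
    using i by (intro ideal_gen_compose_diff[OF _ _ u] fibre map_germ_compose[OF map_germ_proj_part[OF n] f])
qed

text \<open>
  Along the direction z the first components of f are constant, so the derivative of a function of f
  is a combination of the derivatives of h.
\<close>

lemma partial_z_compose:
  assumes u: "holomorphic_germ p u"
  shows "partial (n - 1) (\<lambda>x. u (f x)) \<in> K 1"
proof -
  have z: "n - 1 < n" using n by simp
  have "near_origin n (\<lambda>x. partial (n - 1) (\<lambda>x. f x b) x = 0)" if "b < n - 1" for b
  proof -
    have "near_origin n (\<lambda>x. f x b = x b)"
      using lin that by (auto simp: in_linear_form_def elim: near_origin_mono)
    from partial_cong[OF this z] show ?thesis
      by (rule near_origin_mono) (use that in \<open>simp add: partial_coord\<close>)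
  qed
  then have "partial (n - 1) (\<lambda>x. f x b) \<in> K 1" if "b < p" for b
  proof (cases "b < n - 1")
    case True
    with \<open>\<And>b. b < n - 1 \<Longrightarrow> _\<close> show ?thesis
      unfolding K_def by (intro ideal_gen.zero) auto
  next
    case False
    define j where "j = b - (n - 1)"
    have j: "b = n - 1 + j" "j < p - n + 1"
      using False that np by (auto simp: j_def)
    show ?thesis
      unfolding K_def using j by (intro ideal_gen_generator CollectI exI[of _ 1] exI[of _ j]) (auto simp: h_comp_def)
  qed
  then have "(\<lambda>x. \<Sum>b<p. partial b u (f x) * partial (n - 1) (\<lambda>x. f x b) x) \<in> K 1"
    unfolding K_def by (intro ideal_gen_sum ideal_gen_mult holomorphic_germ_compose[OF f] holomorphic_germ_partial u) auto
  then show ?thesis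
    unfolding K_def by (rule ideal_gen_cong) (rule partial_compose[OF f u z])
qed

end

section \<open>Change of coordinates\<close>

text \<open>
  Two germs in normal form with \<open>f' \<circ> \<theta> = \<psi> \<circ> f\<close>, where \<open>\<phi>\<close> is a left inverse of \<open>\<theta>\<close>.
\<close>

locale multiple_points_change = multiple_points +
  fixes f' \<theta> \<phi> \<psi> :: "point \<Rightarrow> point"
  assumes f': "map_germ n p f'" and lin': "in_linear_form n f'"
    and \<theta>: "map_germ n n \<theta>" and \<phi>: "map_germ n n \<phi>" and \<phi>\<theta>: "near_origin n (\<lambda>x. \<phi> (\<theta> x) = x)"
    and \<psi>: "map_germ p p \<psi>" and eq: "near_origin n (\<lambda>x. f' (\<theta> x) = \<psi> (f x))"
begin

lemma z_less: "n - 1 < n" and length_pos: "0 < length P"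
  using n P by auto

lemma \<psi>_hol: "a < p \<Longrightarrow> holomorphic_germ p (\<lambda>w. \<psi> w a)"
  by (rule map_germD(2)[OF \<psi>])

lemma f'_\<theta>: "near_origin n (\<lambda>x. f' (\<theta> x) a = \<psi> (f x) a)"
  using eq by (rule near_origin_mono) simp

lemma \<theta>_eq: "a < n - 1 \<Longrightarrow> near_origin n (\<lambda>x. \<theta> x a = \<psi> (f x) a)"
  using near_origin_conj[OF near_origin_compose[OF \<theta> lin'[unfolded in_linear_form_def]] eq]
  by (rule near_origin_mono) auto

lemma \<theta>_hol: "a < n \<Longrightarrow> holomorphic_germ n (\<lambda>x. \<theta> x a)"
  by (rule map_germD(2)[OF \<theta>])

text \<open>
  By the normal form of f', the first components of \<open>\<theta>\<close> are functions of f. They therefore agree on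
  all parts modulo the equations, and their derivatives in the direction z lie in the ideal of the
  first derivatives of h.
\<close>

lemma \<theta>_fibre:
  assumes "a < n - 1" "i < length P"
  shows "(\<lambda>y. \<theta> (proj_part n i y) a - \<theta> (proj_part n 0 y) a) \<in> I"
proof -
  have "near_origin m (\<lambda>y. \<theta> (proj_part n i y) a = \<psi> (f (proj_part n i y)) a \<and> \<theta> (proj_part n 0 y) a = \<psi> (f (proj_part n 0 y)) a)"
    using assms length_pos by (intro near_origin_conj near_origin_compose[OF map_germ_proj_part[OF n]] \<theta>_eq) auto
  moreover have "(\<lambda>y. \<psi> (f (proj_part n i y)) a - \<psi> (f (proj_part n 0 y)) a) \<in> I"
    using assms np by (intro fibre_compose[OF \<psi>_hol]) auto
  ultimately show ?thesis
    by (rule_tac ideal_gen_cong) (auto elim: near_origin_mono)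
qed

lemma partial_z_\<theta>: "a < n - 1 \<Longrightarrow> partial (n - 1) (\<lambda>x. \<theta> x a) \<in> K 1"
  using partial_z_compose[OF \<psi>_hol, of a] np unfolding K_def
  by (rule_tac ideal_gen_cong[OF _ partial_cong[OF \<theta>_eq z_less]]) auto

lemma partial_z_\<theta>_origin: "a < n - 1 \<Longrightarrow> partial (n - 1) (\<lambda>x. \<theta> x a) origin = 0"
  by (intro K1_origin partial_z_\<theta>)

text \<open>
  The derivative of the last component of \<open>\<theta>\<close> in the direction z. It is a unit, because \<open>\<theta>\<close> has a left
  inverse and the other components of \<open>\<theta>\<close> have vanishing derivative in this direction at the origin.
\<close>

definition dZ :: "point \<Rightarrow> complex" where
  "dZ = partial (n - 1) (\<lambda>x. \<theta> x (n - 1))"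

lemma dZ_hol: "holomorphic_germ n dZ"
  unfolding dZ_def by (intro holomorphic_germ_partial \<theta>_hol z_less)

lemma dZ_origin: "dZ origin \<noteq> 0"
proof -
  have "near_origin n (\<lambda>x. \<phi> (\<theta> x) (n - 1) = x (n - 1))"
    using \<phi>\<theta> by (rule near_origin_mono) simp
  from near_origin_conj[OF partial_cong[OF this z_less] partial_compose[OF \<theta> map_germD(2)[OF \<phi> z_less] z_less]]
  have "(\<Sum>a<n. partial a (\<lambda>x. \<phi> x (n - 1)) (\<theta> origin) * partial (n - 1) (\<lambda>x. \<theta> x a) origin) = 1"
    by (auto dest!: near_origin_at_origin simp: partial_coord)
  then show ?thesis
    by (auto simp: sum_lessThan_last[OF n] partial_z_\<theta>_origin dZ_def simp del: One_nat_def)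
qed

text \<open>
  In the chain rule for \<open>g \<circ> \<theta>\<close> in the direction z all terms but the last one lie in the ideal, and in
  the last one the factor dZ can be cancelled.
\<close>

lemma cancel_dZ:
  assumes g: "holomorphic_germ n g" and s: "1 \<le> s" and d: "partial (n - 1) (\<lambda>x. g (\<theta> x)) \<in> K s"
  shows "(\<lambda>x. partial (n - 1) g (\<theta> x)) \<in> K s"
proof -
  have hol: "holomorphic_germ n (\<lambda>x. partial a g (\<theta> x))" if "a < n" for a
    using that g by (intro holomorphic_germ_compose[OF \<theta>] holomorphic_germ_partial)
  have "partial (n - 1) (\<lambda>x. \<theta> x a) \<in> K s" if "a < n - 1" for a
    using partial_z_\<theta>[OF that] s by (rule K_mono)
  then have "(\<lambda>x. partial (n - 1) (\<lambda>x. g (\<theta> x)) x - (\<Sum>a<n-1. partial a g (\<theta> x) * partial (n - 1) (\<lambda>x. \<theta> x a) x)) \<in> K s"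
    using d hol unfolding K_def by (intro ideal_gen_diff ideal_gen_sum ideal_gen_mult) auto
  moreover have "holomorphic_germ n (\<lambda>x. inverse (dZ x))"
    by (intro holomorphic_germ_inverse dZ_hol dZ_origin)
  ultimately have "(\<lambda>x. inverse (dZ x) * (partial (n - 1) (\<lambda>x. g (\<theta> x)) x - (\<Sum>a<n-1. partial a g (\<theta> x) * partial (n - 1) (\<lambda>x. \<theta> x a) x))) \<in> K s"
    unfolding K_def by (rule ideal_gen_mult)
  moreover have "near_origin n (\<lambda>x. partial (n - 1) g (\<theta> x) =
      inverse (dZ x) * (partial (n - 1) (\<lambda>x. g (\<theta> x)) x - (\<Sum>a<n-1. partial a g (\<theta> x) * partial (n - 1) (\<lambda>x. \<theta> x a) x)))"
    using near_origin_conj[OF partial_compose[OF \<theta> g z_less] holomorphic_germ_nonzero[OF dZ_hol dZ_origin]]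
    by (rule near_origin_mono) (simp add: sum_lessThan_last[OF n] dZ_def)
  ultimately show ?thesis
    unfolding K_def by (rule ideal_gen_cong)
qed

lemma h'_hol: "j < p - n + 1 \<Longrightarrow> holomorphic_germ n (h_comp n f' j)"
  by (rule h_comp_holomorphic[OF f' n np])

text \<open>
  A derivative of h' in the direction z of positive order, composed with \<open>\<theta>\<close>, lies in the ideal of the
  derivatives of h of positive order up to the same one. The induction differentiates the membership
  for one order to get the next, and cancels the unit dZ.
\<close>

lemma z_derivatives:
  assumes j: "j < p - n + 1"
  shows "(\<lambda>x. (partial (n - 1) ^^ Suc s) (h_comp n f' j) (\<theta> x)) \<in> K (Suc s)"
proof (induction s)
  case 0
  have "partial (n - 1) (\<lambda>x. \<psi> (f x) (n - 1 + j)) \<in> K 1"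
    using j np n by (intro partial_z_compose \<psi>_hol) auto
  then have "partial (n - 1) (\<lambda>x. h_comp n f' j (\<theta> x)) \<in> K 1"
    unfolding K_def h_comp_def by (rule ideal_gen_cong[OF _ partial_cong[OF f'_\<theta> z_less]])
  then show ?case
    using cancel_dZ[OF h'_hol[OF j]] by simp
next
  case (Suc s)
  from cancel_dZ[OF _ _ K_partial[OF this]] show ?case
    using holomorphic_germ_partial_funpow[OF h'_hol[OF j] z_less, of "Suc s"] by simp
qed

abbreviation "\<Phi> \<equiv> part_lift n (length P) \<theta>"
abbreviation "\<Psi> \<equiv> part_lift n (length P) \<phi>"

lemma \<Phi>: "map_germ m m \<Phi>" and \<Psi>: "map_germ m m \<Psi>"
proof -
  have l: "1 \<le> length P" using length_pos by linarith
  show "map_germ m m \<Phi>" "map_germ m m \<Psi>"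
    by (rule map_germ_part_lift[OF \<theta> n l], rule map_germ_part_lift[OF \<phi> n l])
qed

text \<open>
  Modulo the equations, the i-th point of the tuple moved by \<open>\<Phi>\<close> is the image under \<open>\<theta>\<close> of the i-th
  point.
\<close>

lemma proj_\<Phi>_diff:
  assumes u: "holomorphic_germ n u" and i: "i < length P"
  shows "(\<lambda>y. u (proj_part n i (\<Phi> y)) - u (\<theta> (proj_part n i y))) \<in> I"
proof (rule ideal_gen_compose_diff[OF _ _ u])
  show "map_germ m n (\<lambda>y. proj_part n i (\<Phi> y))"
    by (rule map_germ_compose[OF \<Phi> map_germ_proj_part[OF n i]])
  show "map_germ m n (\<lambda>y. \<theta> (proj_part n i y))"
    by (rule map_germ_compose[OF map_germ_proj_part[OF n i] \<theta>])
  fix a assume a: "a < n"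
  show "(\<lambda>y. proj_part n i (\<Phi> y) a - \<theta> (proj_part n i y) a) \<in> I"
  proof (cases "a < n - 1")
    case True
    from ideal_gen_mult[OF \<theta>_fibre[OF True i] holomorphic_germ_const[of m "-1"]]
    show ?thesis
      using True by (simp add: proj_part_lift[OF n i a])
  qed (simp add: proj_part_lift[OF n i a] ideal_gen_zero)
qed

lemma F_map_\<Phi>:
  assumes g: "g \<in> set (F_map n p f' P)"
  shows "(\<lambda>y. g (\<Phi> y)) \<in> I"
proof -
  consider "g \<in> set (G_map n p f' P)" | "g \<in> set (H_map n p f' P)"
    using g by (auto simp: F_map_def)
  then show ?thesis
  proof cases
    assume "g \<in> set (G_map n p f' P)"
    then obtain i j where i: "i < length P" and j: "j < p - n + 1"
      and g: "g = (\<lambda>y. h_comp n f' j (proj_part n 0 y) - h_comp n f' j (proj_part n i y))"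
      unfolding set_G_map by blast
    let ?u = "\<lambda>w. \<psi> w (n - 1 + j)"
    have "holomorphic_germ p ?u"
      using j np n by (intro \<psi>_hol) auto
    from fibre_compose[OF this i]
    have "(\<lambda>y. ?u (f (proj_part n i y)) - ?u (f (proj_part n 0 y))) \<in> I" .
    moreover have "near_origin m (\<lambda>y. h_comp n f' j (\<theta> (proj_part n i y)) - h_comp n f' j (\<theta> (proj_part n 0 y)) =
        ?u (f (proj_part n i y)) - ?u (f (proj_part n 0 y)))"
      unfolding h_comp_def
      using near_origin_conj[OF near_origin_compose[OF map_germ_proj_part[OF n i] f'_\<theta>, of "n - 1 + j"]
        near_origin_compose[OF map_germ_proj_part[OF n length_pos] f'_\<theta>, of "n - 1 + j"]]
      by (rule near_origin_mono) simp
    ultimately have 1: "(\<lambda>y. h_comp n f' j (\<theta> (proj_part n i y)) - h_comp n f' j (\<theta> (proj_part n 0 y))) \<in> I"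
      by (rule ideal_gen_cong)
    from ideal_gen_diff[OF ideal_gen_diff[OF proj_\<Phi>_diff[OF h'_hol[OF j] length_pos] proj_\<Phi>_diff[OF h'_hol[OF j] i]] 1]
    show ?thesis
      by (simp add: g)
  next
    assume "g \<in> set (H_map n p f' P)"
    then obtain i s j where i: "i < length P" and s: "1 \<le> s" "s < P ! i" and j: "j < p - n + 1"
      and g: "g = (\<lambda>y. (partial (n - 1) ^^ s) (h_comp n f' j) (proj_part n i y))"
      unfolding set_H_map by blast
    let ?u = "(partial (n - 1) ^^ s) (h_comp n f' j)"
    obtain t where t: "s = Suc t" using s(1) by (cases s) auto
    have "(\<lambda>y. ?u (\<theta> (proj_part n i y))) \<in> I"
      using K_compose[OF z_derivatives[OF j] i, of t] s(2) unfolding t by blast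
    from ideal_gen_add[OF proj_\<Phi>_diff[OF holomorphic_germ_partial_funpow[OF h'_hol[OF j] z_less, of s] i] this]
    show ?thesis
      by (simp add: g)
  qed
qed

text \<open>
  Every coordinate of the space of tuples is a coordinate of one of the points of the tuple, and the
  maps between the spaces of tuples respect this description.
\<close>

lemma part_index:
  assumes "a < m"
  obtains i c where "i < length P" "c < n" "\<And>y. proj_part n i y c = y a"
    "\<And>\<theta> y. part_lift n (length P) \<theta> y a = \<theta> (proj_part n i y) c"
proof (cases "a < n - 1")
  case True
  then show ?thesis
    using length_pos by (intro that[of 0 a]) (auto simp: proj_part_def part_lift_def)
next
  case False
  then have "a - (n - 1) < length P" "n - 1 + (a - (n - 1)) = a"
    using assms by auto
  then show ?thesis
    using False n assms by (intro that[of "a - (n - 1)" "n - 1"]) (simp_all only: proj_part_def part_lift_def, simp_all)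
qed

lemma \<Psi>_\<Phi>:
  assumes "a < m"
  shows "(\<lambda>y. \<Psi> (\<Phi> y) a - y a) \<in> I"
proof -
  obtain i c where i: "i < length P" and c: "c < n" and y: "\<And>y. proj_part n i y c = y a"
    and lift: "\<And>\<theta> y. part_lift n (length P) \<theta> y a = \<theta> (proj_part n i y) c"
    using part_index[OF assms] by metis
  have "(\<lambda>y. \<phi> (proj_part n i (\<Phi> y)) c - \<phi> (\<theta> (proj_part n i y)) c) \<in> I"
    by (rule proj_\<Phi>_diff[OF map_germD(2)[OF \<phi> c] i])
  moreover have "near_origin m (\<lambda>y. \<Psi> (\<Phi> y) a - y a = \<phi> (proj_part n i (\<Phi> y)) c - \<phi> (\<theta> (proj_part n i y)) c)"
    using near_origin_compose[OF map_germ_proj_part[OF n i] \<phi>\<theta>]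
    by (rule near_origin_mono) (simp add: lift y)
  ultimately show ?thesis
    by (rule ideal_gen_cong)
qed

lemma proj_part_index: "a < n - 1 \<Longrightarrow> proj_part n k y a = y a"
  by (simp add: proj_part_def)

lemma partial_proj_\<Phi>_origin:
  assumes b: "b < m" and i: "i < length P" and e: "e < n"
  shows "partial b (\<lambda>y. proj_part n i (\<Phi> y) e) origin = partial b (\<lambda>y. \<theta> (proj_part n i y) e) origin"
proof (cases "e < n - 1")
  case False
  then show ?thesis
    by (simp add: proj_part_lift[OF n i e])
next
  case True
  have *: "partial b (\<lambda>y. \<theta> (proj_part n k y) e) origin = (\<Sum>a<n-1. partial a (\<lambda>x. \<theta> x e) origin * partial b (\<lambda>y. y a) origin)"
    if k: "k < length P" for k
  proof -
    have "proj_part n k origin = origin"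
      by (rule map_germD(3)[OF map_germ_proj_part[OF n k]])
    with near_origin_at_origin[OF partial_compose[OF map_germ_proj_part[OF n k] \<theta>_hol[OF e] b]]
    have "partial b (\<lambda>y. \<theta> (proj_part n k y) e) origin =
        (\<Sum>a<n. partial a (\<lambda>x. \<theta> x e) origin * partial b (\<lambda>y. proj_part n k y a) origin)"
      by simp
    then show ?thesis
      by (simp add: sum_lessThan_last[OF n] partial_z_\<theta>_origin[OF True] proj_part_index del: One_nat_def)
  qed
  show ?thesis
    using True *[OF i] *[OF length_pos] by (simp add: proj_part_lift[OF n i e])
qed

text \<open>
  Although \<open>\<Psi> \<circ> \<Phi>\<close> is the identity only modulo the equations, its derivative at the origin is exactly
  the identity. Hence the Jacobian matrix of \<open>\<Phi>\<close> is invertible at the origin.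
\<close>

lemma partial_\<Psi>_\<Phi>_origin:
  assumes a: "a < m" and b: "b < m"
  shows "(\<Sum>e<m. partial e (\<lambda>y. \<Psi> y a) origin * partial b (\<lambda>y. \<Phi> y e) origin) = (if a = b then 1 else 0)"
proof -
  obtain i c where i: "i < length P" and c: "c < n" and y: "\<And>y. proj_part n i y c = y a"
    and lift: "\<And>\<theta> y. part_lift n (length P) \<theta> y a = \<theta> (proj_part n i y) c"
    using part_index[OF a] by metis
  have 0: "\<Phi> origin = origin" "proj_part n i origin = origin" "\<theta> origin = origin"
    using map_germD(3)[OF \<Phi>] map_germD(3)[OF map_germ_proj_part[OF n i]] map_germD(3)[OF \<theta>] by auto
  have "(\<Sum>e<m. partial e (\<lambda>y. \<Psi> y a) origin * partial b (\<lambda>y. \<Phi> y e) origin) = partial b (\<lambda>y. \<Psi> (\<Phi> y) a) origin"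
    using near_origin_at_origin[OF partial_compose[OF \<Phi> map_germD(2)[OF \<Psi> a] b]] 0 by simp
  also have "\<dots> = partial b (\<lambda>y. \<phi> (proj_part n i (\<Phi> y)) c) origin"
    by (simp only: lift)
  also have "\<dots> = (\<Sum>e<n. partial e (\<lambda>x. \<phi> x c) origin * partial b (\<lambda>y. proj_part n i (\<Phi> y) e) origin)"
    using near_origin_at_origin[OF partial_compose[OF map_germ_compose[OF \<Phi> map_germ_proj_part[OF n i]] map_germD(2)[OF \<phi> c] b]] 0
    by simp
  also have "\<dots> = (\<Sum>e<n. partial e (\<lambda>x. \<phi> x c) origin * partial b (\<lambda>y. \<theta> (proj_part n i y) e) origin)"
    using partial_proj_\<Phi>_origin[OF b i] by simp
  also have "\<dots> = partial b (\<lambda>y. \<phi> (\<theta> (proj_part n i y)) c) origin"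
    using near_origin_at_origin[OF partial_compose[OF map_germ_compose[OF map_germ_proj_part[OF n i] \<theta>] map_germD(2)[OF \<phi> c] b]] 0
    by simp
  also have "\<dots> = partial b (\<lambda>y. y a) origin"
  proof -
    have "near_origin m (\<lambda>y. \<phi> (\<theta> (proj_part n i y)) c = y a)"
      using near_origin_compose[OF map_germ_proj_part[OF n i] \<phi>\<theta>] by (rule near_origin_mono) (simp add: y)
    from near_origin_at_origin[OF partial_cong[OF this b]] show ?thesis .
  qed
  finally show ?thesis
    by (simp only: partial_coord eq_commute[of b a])
qed

lemma det_\<Phi>_origin: "Determinant.det (mat m m (\<lambda>(a, b). partial b (\<lambda>y. \<Phi> y a) origin)) \<noteq> 0"
proof
  let ?D = "mat m m (\<lambda>(a, b). partial b (\<lambda>y. \<Phi> y a) origin)" and ?E = "mat m m (\<lambda>(a, b). partial b (\<lambda>y. \<Psi> y a) origin)"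
  assume "Determinant.det ?D = 0"
  moreover have "?E * ?D = 1\<^sub>m m"
    by (rule eq_matI) (auto simp: scalar_prod_def lessThan_atLeast0[symmetric] partial_\<Psi>_\<Phi>_origin simp del: One_nat_def)
  then have "Determinant.det ?E * Determinant.det ?D = 1"
    using det_mult[of ?E m ?D] by simp
  ultimately show False by simp
qed

text \<open>
  Differentiating \<open>F' \<circ> \<Phi> = M F\<close> gives \<open>(DF' \<circ> \<Phi>) D\<Phi> = M DF\<close> modulo the components of F. The matrix M
  is square, as both maps have the same number of components.
\<close>

lemma minors_\<Phi>:
  assumes len: "length (F_map n p f' P) = length (F_map n p f P)"
    and g: "g \<in> minors (length (F_map n p f' P)) m (gradients (F_map n p f' P))"
  shows "(\<lambda>y. g (\<Phi> y)) \<in> ideal_gen m (set (F_map n p f P) \<union> minors (length (F_map n p f P)) m (gradients (F_map n p f P)))"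
proof -
  define F where "F = F_map n p f P"
  define F' where "F' = F_map n p f' P"
  define c where "c = length F"
  have c: "length F' = c" "length F = c"
    using len by (auto simp: c_def F_def F'_def)
  have F: "set F \<subseteq> Collect (holomorphic_germ m)" and F': "set F' \<subseteq> Collect (holomorphic_germ m)"
    unfolding F_def F'_def using F_map_holomorphic[OF f n np P] F_map_holomorphic[OF f' n np P] by auto
  have Fd: "holomorphic_germ m (F ! d)" and F'd: "holomorphic_germ m (F' ! d)" if "d < c" for d
    using that subsetD[OF F nth_mem[of d F]] subsetD[OF F' nth_mem[of d F']] c by auto
  let ?T = "set F \<union> minors c m (gradients F)"
  have "\<exists>M. (\<forall>d<c. holomorphic_germ m (M d)) \<and> near_origin m (\<lambda>y. (F' ! i) (\<Phi> y) = (\<Sum>d<c. M d y * (F ! d) y))"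
    if "i < c" for i
  proof -
    have "F' ! i \<in> set (F_map n p f' P)"
      using that c nth_mem[of i F'] by (simp add: F'_def)
    from F_map_\<Phi>[OF this] show ?thesis
      unfolding F_def[symmetric] by (elim ideal_gen_coefficients) (use c in auto)
  qed
  then have "\<forall>i. \<exists>M. i < c \<longrightarrow> (\<forall>d<c. holomorphic_germ m (M d)) \<and>
      near_origin m (\<lambda>y. (F' ! i) (\<Phi> y) = (\<Sum>d<c. M d y * (F ! d) y))"
    by blast
  from choice[OF this] obtain M where M: "\<And>i d. i < c \<Longrightarrow> d < c \<Longrightarrow> holomorphic_germ m (M i d)"
    and F'\<Phi>: "\<And>i. i < c \<Longrightarrow> near_origin m (\<lambda>y. (F' ! i) (\<Phi> y) = (\<Sum>d<c. M i d y * (F ! d) y))"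
    by blast
  have "minors c m (\<lambda>i b y. gradients F' i b (\<Phi> y)) \<subseteq> ideal_gen m ?T"
  proof (rule minors_transfer[where B="gradients F" and M=M and D="\<lambda>a b. partial b (\<lambda>y. \<Phi> y a)"])
    show "holomorphic_germ m (\<lambda>y. gradients F' i b (\<Phi> y))" if "i < c" "b < m" for i b
      using gradients_holomorphic[OF F'] that c by (intro holomorphic_germ_compose[OF \<Phi>]) auto
    show "holomorphic_germ m (gradients F i b)" if "i < c" "b < m" for i b
      using gradients_holomorphic[OF F] that c by auto
    show "holomorphic_germ m (M i d)" if "i < c" "d < c" for i d
      using M that .
    show "holomorphic_germ m (partial b (\<lambda>y. \<Phi> y a))" if "a < m" "b < m" for a b
      using that by (intro holomorphic_germ_partial map_germD(2)[OF \<Phi>])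
    show "Determinant.det (mat m m (\<lambda>(a, b). partial b (\<lambda>y. \<Phi> y a) origin)) \<noteq> 0"
      by (rule det_\<Phi>_origin)
    show "minors c m (gradients F) \<subseteq> ideal_gen m ?T"
      by (auto intro: ideal_gen_generator)
    fix i b assume i: "i < c" and b: "b < m"
    have "(\<lambda>y. \<Sum>d<c. partial b (M i d) y * (F ! d) y) \<in> ideal_gen m ?T"
      using M i b c by (intro ideal_gen_sum ideal_gen_mult ideal_gen_generator holomorphic_germ_partial) auto
    moreover have "near_origin m (\<lambda>y. (\<Sum>e<m. gradients F' i e (\<Phi> y) * partial b (\<lambda>y. \<Phi> y e) y) -
        (\<Sum>d<c. M i d y * gradients F d b y) = (\<Sum>d<c. partial b (M i d) y * (F ! d) y))"
    proof -
      have 1: "near_origin m (\<lambda>y. partial b (\<lambda>y. (F' ! i) (\<Phi> y)) y = (\<Sum>e<m. gradients F' i e (\<Phi> y) * partial b (\<lambda>y. \<Phi> y e) y))"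
        unfolding gradients_def by (rule partial_compose[OF \<Phi> F'd[OF i] b])
      have 2: "near_origin m (\<lambda>y. partial b (\<lambda>y. (F' ! i) (\<Phi> y)) y = partial b (\<lambda>y. \<Sum>d<c. M i d y * (F ! d) y) y)"
        by (rule partial_cong[OF F'\<Phi>[OF i] b])
      have 3: "near_origin m (\<lambda>y. partial b (\<lambda>y. \<Sum>d<c. M i d y * (F ! d) y) y = (\<Sum>d<c. partial b (\<lambda>y. M i d y * (F ! d) y) y))"
        using M[OF i] Fd b by (intro partial_sum holomorphic_germ_mult) auto
      have 4: "near_origin m (\<lambda>y. \<forall>d<c. partial b (\<lambda>y. M i d y * (F ! d) y) y = partial b (M i d) y * (F ! d) y + M i d y * partial b (F ! d) y)"
        using M[OF i] Fd b by (intro near_origin_all_less partial_mult) auto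
      show ?thesis
        using near_origin_conj[OF near_origin_conj[OF 1 2] near_origin_conj[OF 3 4]]
        by (rule near_origin_mono) (auto simp: sum.distrib gradients_def diff_eq_eq)
    qed
    ultimately show "(\<lambda>y. (\<Sum>e<m. gradients F' i e (\<Phi> y) * partial b (\<lambda>y. \<Phi> y e) y) -
        (\<Sum>d<c. M i d y * gradients F d b y)) \<in> ideal_gen m ?T"
      by (rule ideal_gen_cong)
  qed
  moreover have "(\<lambda>y. g (\<Phi> y)) \<in> minors c m (\<lambda>i b y. gradients F' i b (\<Phi> y))"
    using g unfolding F'_def[symmetric] c by (auto simp: minors_def)
  ultimately show ?thesis
    unfolding F_def[symmetric] c by blast
qed

end

section \<open>Invariance of the dimension\<close>

text \<open>
  In normal form, the rows of the Jacobian matrix for the first n - 1 components form an identity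
  block. A nonzero derivative of some component of h in the direction z would complete it to a
  triangular minor of size n, against the rank n - 1.
\<close>

lemma critical_of_corank:
  assumes n: "1 \<le> n" and np: "n < p" and f: "map_germ n p f" and lin: "in_linear_form n f"
    and corank: "corank n p f = 1" and j: "j < p - n + 1"
  shows "partial (n - 1) (h_comp n f j) origin = 0"
proof (rule ccontr)
  assume nz: "partial (n - 1) (h_comp n f j) origin \<noteq> 0"
  define A where "A = mat p n (\<lambda>(j, i). partial i (\<lambda>x. f x j) origin)"
  define J where "J = insert (n - 1 + j) {..<n - 1}"
  have J: "J \<subseteq> {..<p}" "card J = n" "finite J"
    using n np j by (auto simp: J_def)
  have rank: "vec_space.rank p A = n - 1"
    using corank np n by (simp add: corank_def A_def)
  have A: "A \<in> carrier_mat p n"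
    by (simp add: A_def)
  have lin': "partial i (\<lambda>x. f x k) origin = (if i = k then 1 else 0)" if "k < n - 1" "i < n" for i k
  proof -
    have "near_origin n (\<lambda>x. f x k = x k)"
      using lin that by (auto simp: in_linear_form_def elim: near_origin_mono)
    from near_origin_at_origin[OF partial_cong[OF this that(2)]] show ?thesis
      by (simp add: partial_coord)
  qed
  have pick1: "pick J i = i" if "i < n - 1" for i
  proof -
    have "{a \<in> J. a < i} = {..<i}"
      using that by (auto simp: J_def)
    then show ?thesis
      using pick_card_in_set[of i J] that by (simp add: J_def)
  qed
  have pick2: "pick J (n - 1) = n - 1 + j"
  proof -
    have "{a \<in> J. a < n - 1 + j} = {..<n - 1}"
      by (auto simp: J_def)
    then show ?thesis
      using pick_card_in_set[of "n - 1 + j" J] by (simp add: J_def)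
  qed
  have Jp: "{i. i < p \<and> i \<in> J} = J"
    using J(1) by auto
  let ?B = "submatrix A J UNIV"
  have B: "?B \<in> carrier_mat n n"
    using J(2) by (intro carrier_matI) (auto simp: dim_submatrix A_def Jp)
  have entry: "?B $$ (a, i) = partial i (\<lambda>x. f x (pick J a)) origin" if "a < n" "i < n" for a i
  proof -
    have "pick J a < p"
      using that J pick_in_set[of a J] by auto
    then show ?thesis
      using that J(2) by (subst submatrix_index) (auto simp: A_def Jp pick_UNIV)
  qed
  have low: "?B $$ (a, i) = (if a = n - 1 then partial i (h_comp n f j) origin else if i = a then 1 else 0)"
    if "a < n" "i < n" for a i
  proof (cases "a = n - 1")
    case True
    then show ?thesis
      using entry[OF that] by (simp add: pick2 h_comp_def del: One_nat_def)
  next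
    case False
    then have "a < n - 1" using that by simp
    then show ?thesis
      using entry[OF that] lin'[OF _ that(2)] False by (simp add: pick1)
  qed
  have "Determinant.det ?B = prod_list (diag_mat ?B)"
    by (rule det_lower_triangular[OF _ B]) (use low in auto)
  moreover have "0 \<notin> set (diag_mat ?B)"
    using B low nz by (auto simp: diag_mat_def)
  ultimately have "Determinant.det ?B \<noteq> 0"
    by (simp add: prod_list_zero_iff)
  then have "card {i. i < n \<and> i \<in> (UNIV :: nat set)} \<le> vec_space.rank p A"
    by (rule vec_space.rank_gt_minor[OF A])
  then show False
    using rank n by simp
qed

lemma N_inv_eq:
  assumes "1 \<le> n" "n < p" "P \<noteq> []" "map_germ n p f"
  shows "N_inv n p f P = quotient_dim (n - 1 + length P) (germ (n - 1 + length P) ` ideal_gen (n - 1 + length P)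
    (set (F_map n p f P) \<union> minors (length (F_map n p f P)) (n - 1 + length P) (gradients (F_map n p f P))))"
proof -
  let ?m = "n - 1 + length P" and ?F = "F_map n p f P"
  have F: "set ?F \<subseteq> Collect (holomorphic_germ ?m)"
    by (rule F_map_holomorphic[OF assms(4,1,2,3)])
  have "minors (length ?F) ?m (gradients ?F) \<subseteq> Collect (holomorphic_germ ?m)"
    by (rule minors_holomorphic) (rule gradients_holomorphic[OF F])
  from add_germ_ideals[OF F this] show ?thesis
    unfolding N_inv_def Let_def pullback_ideal_eq[OF F] minors_ideal_eq[OF F] by (rule arg_cong)
qed

theorem proposition6p1:
  fixes n p k :: nat and P :: "nat list" and f1 f2 :: "point \<Rightarrow> point"
  assumes "1 \<le> n" and "n < p"
    and "partition_of k P"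
    and "int p - int k * (int p - int n + 1) + int (length P) \<ge> 0"
    and "map_germ n p f1" and "corank n p f1 = 1" and "in_linear_form n f1" and "A_finite n p f1"
    and "map_germ n p f2" and "corank n p f2 = 1" and "in_linear_form n f2" and "A_finite n p f2"
    and "A_equivalent n p f1 f2"
  shows "N_inv n p f1 P = N_inv n p f2 P"
proof -
  have P: "P \<noteq> []"
    using assms(3) by (simp add: partition_of_def)
  \<comment> \<open>the second germ is \<open>\<psi> \<circ> f1 \<circ> \<phi>\<close>, and \<open>\<phi>'\<close>, \<open>\<psi>'\<close> are the inverse germs\<close>
  obtain \<phi> \<psi> \<phi>' \<psi>' where \<phi>: "map_germ n n \<phi>" "map_germ n n \<phi>'"
    and \<psi>: "map_germ p p \<psi>" "map_germ p p \<psi>'"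
    and \<phi>'\<phi>: "near_origin n (\<lambda>x. \<phi>' (\<phi> x) = x)" and \<phi>\<phi>': "near_origin n (\<lambda>x. \<phi> (\<phi>' x) = x)"
    and \<psi>'\<psi>: "near_origin p (\<lambda>x. \<psi>' (\<psi> x) = x)"
    and f2: "near_origin n (\<lambda>x. f2 x = \<psi> (f1 (\<phi> x)))"
    using assms(13) unfolding A_equivalent_def diffeo_germ_def by blast
  interpret A: multiple_points n p P f1
    using assms P critical_of_corank[OF assms(1,2,5,7,6)] by unfold_locales
  interpret B: multiple_points n p P f2
    using assms P critical_of_corank[OF assms(1,2,9,11,10)] by unfold_locales
  \<comment> \<open>\<open>f2 \<circ> \<phi>' = \<psi> \<circ> f1\<close> and \<open>f1 \<circ> \<phi> = \<psi>' \<circ> f2\<close>: the change of coordinates applies both ways\<close>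
  interpret A: multiple_points_change n p P f1 f2 \<phi>' \<phi> \<psi>
  proof
    show "near_origin n (\<lambda>x. f2 (\<phi>' x) = \<psi> (f1 x))"
      using near_origin_conj[OF near_origin_compose[OF \<phi>(2) f2] \<phi>\<phi>'] by (rule near_origin_mono) auto
  qed (use assms \<phi> \<psi> \<phi>\<phi>' in auto)
  interpret B: multiple_points_change n p P f2 f1 \<phi> \<phi>' \<psi>'
  proof
    show "near_origin n (\<lambda>x. f1 (\<phi> x) = \<psi>' (f2 x))"
      using near_origin_conj[OF near_origin_compose[OF map_germ_compose[OF \<phi>(1) assms(5)] \<psi>'\<psi>] f2]
      by (rule near_origin_mono) auto
  qed (use assms \<phi> \<psi> \<phi>'\<phi> in auto)
  let ?m = "n - 1 + length P"
  define S where "S f = set (F_map n p f P) \<union> minors (length (F_map n p f P)) ?m (gradients (F_map n p f P))" for f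
  have hol: "S f \<subseteq> Collect (holomorphic_germ ?m)" if "map_germ n p f" for f
    unfolding S_def
    using F_map_holomorphic[OF that assms(1,2) P] by (intro Un_least minors_holomorphic gradients_holomorphic)
  \<comment> \<open>the number of equations depends on n, p and the partition only\<close>
  have len: "length (F_map n p f2 P) = length (F_map n p f1 P)"
    by (simp only: length_F_map[OF assms(3)])
  have F_S: "g \<in> ideal_gen ?m (S f)" if "g \<in> ideal_gen ?m (set (F_map n p f P))" for g f
    using that by (rule ideal_gen_mono) (simp add: S_def)
  have "quotient_dim ?m (germ ?m ` ideal_gen ?m (S f1)) = quotient_dim ?m (germ ?m ` ideal_gen ?m (S f2))"
  proof (rule quotient_dim_eq[OF hol[OF assms(5)] hol[OF assms(9)] A.\<Phi> B.\<Phi>])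
    show "(\<lambda>x. s (A.\<Phi> x)) \<in> ideal_gen ?m (S f1)" if "s \<in> S f2" for s
      using that A.F_map_\<Phi>[THEN F_S] A.minors_\<Phi>[OF len] unfolding S_def by blast
    show "(\<lambda>x. s (B.\<Phi> x)) \<in> ideal_gen ?m (S f2)" if "s \<in> S f1" for s
      using that B.F_map_\<Phi>[THEN F_S] B.minors_\<Phi>[OF len[symmetric]] unfolding S_def by blast
    show "(\<lambda>x. B.\<Phi> (A.\<Phi> x) a - x a) \<in> ideal_gen ?m (S f1)" if "a < ?m" for a
      by (rule F_S[OF A.\<Psi>_\<Phi>[OF that]])
    show "(\<lambda>x. A.\<Phi> (B.\<Phi> x) a - x a) \<in> ideal_gen ?m (S f2)" if "a < ?m" for a
      by (rule F_S[OF B.\<Psi>_\<Phi>[OF that]])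
  qed
  then show ?thesis
    unfolding N_inv_eq[OF assms(1,2) P assms(5)] N_inv_eq[OF assms(1,2) P assms(9)] S_def .
qed

end
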